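(* Let $E\subset\mathbb{R}$ be measurable with $0<|E|<\infty$, let $\phi$ belong to the singular Herglotz class with linear coefficient $\beta>0$, and put $$S=\{(x,y)\in\mathbb{R}^2:\ x-\phi(y)\in E\}.$$ Then every horizontal cross-section $\{x:(x,y)\in S\}$ of $S$ has measure $|E|$, every vertical cross-section $\{y:(x,y)\in S\}$ has measure $|E|/\beta$, and $$\mathbf{H}\chi_S=\chi_S$$ in the slice-wise sense.
   Context: $|\cdot|$ is Lebesgue measure. The singular Herglotz class consists of the functions $$\phi(w)=\beta w+\gamma+\int_{\mathbb{R}}\Big(\frac1{s-w}-\frac{s}{1+s^2}\Big)d\mu(s),\qquad \beta>0,\ \gamma\in\mathbb{R},$$ where $\mu$ is a positive Borel measure on $\mathbb{R}$, purely singular with respect to Lebesgue measure, with $\int(1+s^2)^{-1}d\mu(s)<\infty$. Such $\phi$ maps the upper half-plane into itself; its boundary values $\phi(y)$, $y\in\mathbb{R}$, exist and are real for a.e. $y$, and $\phi(y)$ in the definition of $S$ denotes this boundary value (horizontal cross-sections are considered at heights $y$ where it is defined; $S$ is thus defined up to a null set of heights). The Hilbert transform is $\mathcal{H}f(x)=\frac1\pi\,\mathrm{p.v.}\int_{\mathbb{R}}\frac{f(t)}{x-t}dt$ and $\mathbf{H}=\mathcal{H}_2\mathcal{H}_1$, with $\mathcal{H}_1,\mathcal{H}_2$ the Hilbert transforms in the first and second variable. Slice-wise sense of $\mathbf{H}\chi_S=\chi_S$: for a.e. $y$, $\mathcal{H}_1$ is applied to the slice $\chi_S(\cdot,y)\in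 L^1\cap L^2$; for a.e. $x$, $\mathcal{H}_2$ is applied to the resulting function $y\mapsto\mathcal{H}_1\chi_S(x,y)$ (which lies in $L^2(\mathbb{R})$); and the output coincides with $\chi_S$ a.e. on $\mathbb{R}^2$. *)

theory Defs
  imports "HOL-Analysis.Analysis"
begin

definition lebesgue_singular :: "real measure \<Rightarrow> bool" where
  "lebesgue_singular \<mu> \<longleftrightarrow>
     (\<exists>N\<in>sets borel. emeasure lborel N = 0 \<and> emeasure \<mu> (- N) = 0)"

text \<open>The argument \<open>\<beta>\<close> is the linear coefficient; only the values of \<open>\<phi>\<close> on the open upper
  half-plane are constrained.\<close>

definition singular_herglotz :: "real \<Rightarrow> (complex \<Rightarrow> complex) \<Rightarrow> bool" where
  "singular_herglotz \<beta> \<phi> \<longleftrightarrow> \<beta> > 0 \<and>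
     (\<exists>(\<gamma>::real) (\<mu>::real measure).
        sets \<mu> = sets borel \<and> lebesgue_singular \<mu> \<and>
        integrable \<mu> (\<lambda>s. 1 / (1 + s\<^sup>2)) \<and>
        (\<forall>w. Im w > 0 \<longrightarrow>
           \<phi> w = of_real \<beta> * w + of_real \<gamma> +
             (LINT s|\<mu>. 1 / (of_real s - w) - of_real (s / (1 + s\<^sup>2)))))"

text \<open>Boundary values are vertical limits \<open>\<phi>(y + i0)\<close>; only finite real ones count.\<close>

definition has_boundary_value :: "(complex \<Rightarrow> complex) \<Rightarrow> real \<Rightarrow> real \<Rightarrow> bool" where
  "has_boundary_value \<phi> y r \<longleftrightarrow>
     ((\<lambda>\<epsilon>. \<phi> (Complex y \<epsilon>)) \<longlongrightarrow> of_real r) (at_right 0)"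

text \<open>The set of all \<open>(x, y)\<close> with \<open>x - \<phi>(y) \<in> E\<close>. Heights without a real boundary value
  contribute an empty horizontal section.\<close>

definition herglotz_set :: "(complex \<Rightarrow> complex) \<Rightarrow> real set \<Rightarrow> (real \<times> real) set" where
  "herglotz_set \<phi> E = {(x, y). \<exists>r. has_boundary_value \<phi> y r \<and> x - r \<in> E}"

definition truncated_hilbert :: "(real \<Rightarrow> real) \<Rightarrow> real \<Rightarrow> real \<Rightarrow> real" where
  "truncated_hilbert f \<epsilon> x = 1 / pi * (LINT t:{t. \<epsilon> < \<bar>x - t\<bar>}|lebesgue. f t / (x - t))"

text \<open>The value \<open>hilbert f x\<close> is meaningful only under \<open>hilbert_exists f x\<close>. For \<open>f\<close> in
  \<open>L\<^sup>p\<close> with \<open>1 \<le> p < \<infinity>\<close> the truncated integrals converge absolutely at infinity, so the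
  principal value concerns only the singularity at \<open>x\<close>.\<close>

definition hilbert_exists :: "(real \<Rightarrow> real) \<Rightarrow> real \<Rightarrow> bool" where
  "hilbert_exists f x \<longleftrightarrow>
     (\<forall>\<epsilon>>0. set_integrable lebesgue {t. \<epsilon> < \<bar>x - t\<bar>} (\<lambda>t. f t / (x - t))) \<and>
     (\<exists>h. ((\<lambda>\<epsilon>. truncated_hilbert f \<epsilon> x) \<longlongrightarrow> h) (at_right 0))"

definition hilbert :: "(real \<Rightarrow> real) \<Rightarrow> real \<Rightarrow> real" where
  "hilbert f x = Lim (at_right 0) (\<lambda>\<epsilon>. truncated_hilbert f \<epsilon> x)"

definition square_integrable :: "(real \<Rightarrow> real) \<Rightarrow> bool" where
  "square_integrable f \<longleftrightarrow>
     f \<in> borel_measurable lebesgue \<and> integrable lebesgue (\<lambda>t. (f t)\<^sup>2)"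

definition hilbert1 :: "(real \<times> real \<Rightarrow> real) \<Rightarrow> real \<times> real \<Rightarrow> real" where
  "hilbert1 F = (\<lambda>(x, y). hilbert (\<lambda>t. F (t, y)) x)"

definition hilbert2 :: "(real \<times> real \<Rightarrow> real) \<Rightarrow> real \<times> real \<Rightarrow> real" where
  "hilbert2 F = (\<lambda>(x, y). hilbert (\<lambda>t. F (x, t)) y)"

text \<open>The equation \<open>hilbert2 (hilbert1 F) = G\<close> in the slice-wise sense, including the
  assertion that both steps make sense: for a.e. \<open>y\<close> the slice \<open>F(\<cdot>, y)\<close> lies in
  \<open>L\<^sup>1 \<inter> L\<^sup>2\<close> and has a Hilbert transform a.e.; for a.e. \<open>x\<close> the function
  \<open>hilbert1 F (x, \<cdot>)\<close> is defined a.e., lies in \<open>L\<^sup>2\<close> and has a Hilbert transform a.e.\<close>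

definition slicewise_double_hilbert_eq ::
  "(real \<times> real \<Rightarrow> real) \<Rightarrow> (real \<times> real \<Rightarrow> real) \<Rightarrow> bool" where
  "slicewise_double_hilbert_eq F G \<longleftrightarrow>
     (AE y in lebesgue.
        integrable lebesgue (\<lambda>t. F (t, y)) \<and> square_integrable (\<lambda>t. F (t, y)) \<and>
        (AE x in lebesgue. hilbert_exists (\<lambda>t. F (t, y)) x)) \<and>
     (AE x in lebesgue.
        (AE y in lebesgue. hilbert_exists (\<lambda>t. F (t, y)) x) \<and>
        square_integrable (\<lambda>t. hilbert1 F (x, t)) \<and>
        (AE y in lebesgue. hilbert_exists (\<lambda>t. hilbert1 F (x, t)) y)) \<and>
     (AE p in lebesgue. hilbert2 (hilbert1 F) p = G p)"

end

theory Submission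
  imports Defs "HOL-Probability.Probability" "HOL-Complex_Analysis.Complex_Analysis"
begin

text \<open>
  Write \<open>P\<^sub>z f\<close> and \<open>Q\<^sub>z f\<close> for the Poisson and conjugate Poisson integrals. The function
  \<open>exp (\<i> \<phi>)\<close> is bounded, hence has vertical limits almost everywhere (Fatou); since \<open>\<mu>\<close> is
  singular they are unimodular, so \<open>\<phi>\<close> itself has real boundary values. The bounded functions
  \<open>exp (\<i> \<lambda> \<phi>)\<close>, \<open>\<lambda> \<ge> 0\<close>, are Poisson integrals of their boundary values, so by uniqueness
  of characteristic functions the boundary function pushes \<open>P\<^sub>z dy\<close> forward to
  \<open>P\<^bsub>\<phi> z\<^esub> dt\<close>. Letting \<open>z = \<i> \<eta>\<close>, \<open>\<eta> \<rightarrow> \<infinity>\<close>, Lebesgue measure is pushed to Lebesgue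
  measure divided by \<open>\<beta>\<close> (Boole, Letac).

  For \<open>a, b \<in> L\<^sup>2\<close> the Hilbert transform of \<open>a\<close> is \<open>b\<close> as soon as \<open>P\<^sub>z (a + \<i> b)\<close> is
  holomorphic in \<open>z\<close>: then \<open>Q\<^sub>z a = P\<^sub>z b\<close>, and the truncated integrals differ from
  \<open>Q\<^bsub>x + \<i> \<epsilon>\<^esub> a\<close> by a quantity vanishing at Lebesgue points. Since
  composition with \<open>\<phi>\<close> preserves holomorphy and commutes with Poisson integration, the Hilbert
  transform in \<open>y\<close> of \<open>g (x - \<phi> y)\<close>, where \<open>g\<close> is the Hilbert transform of the indicator
  of \<open>E\<close>, is the indicator evaluated at \<open>x - \<phi> y\<close>.
\<close>

section \<open>Poisson integrals and Lebesgue points\<close>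

text \<open>Two Hilbert transforms in the same variable would give -1. Here the second one acts on
  \<open>g (x - \<phi> y)\<close> as a function of y, and the reflection u \<mapsto> x - u exchanges
  the half-planes, so it reverses conjugation and turns -1 into +1. Singularity of \<mu> enters only
  through the size of \<open>Im \<phi>\<close>: off an open neighbourhood of the null set carrying
  \<mu>, its integral over a bounded set at height \<epsilon> tends to 0, and 1 - exp (-u) \<le> u
  transfers this to the modulus of \<open>exp (\<i> \<phi>)\<close>. The function g must exist
  before any principal value is known to converge. It is obtained as the boundary function of the
  imaginary part of a Cauchy transform, whose square integrals along horizontal lines are controlled
  by integrating the square of that transform over a contour. Lebesgue points then link g to
  truncated integrals. The final equation is a.e. in the plane, whereas convergence is proved line
  by line and E is only Lebesgue measurable. Hence Borel representatives are carried throughout, and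
  the exceptional set has to be made jointly measurable.\<close>

definition poisson_kernel :: "complex \<Rightarrow> real \<Rightarrow> real" where
  "poisson_kernel z t = Im z / (pi * ((t - Re z)\<^sup>2 + (Im z)\<^sup>2))"

text \<open>The sign makes \<open>poisson_kernel z t + \<i> * conj_kernel z t\<close> equal to
  \<open>\<i> / (pi * (z - t))\<close>, which is holomorphic in \<open>z\<close>; at height 0 the
  second kernel becomes the Hilbert kernel \<open>1 / (pi * (x - t))\<close>.\<close>

definition conj_kernel :: "complex \<Rightarrow> real \<Rightarrow> real" where
  "conj_kernel z t = (Re z - t) / (pi * ((t - Re z)\<^sup>2 + (Im z)\<^sup>2))"

definition poisson :: "(real \<Rightarrow> real) \<Rightarrow> complex \<Rightarrow> real" where
  "poisson f z = (LINT t|lborel. poisson_kernel z t * f t)"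

definition conj_poisson :: "(real \<Rightarrow> real) \<Rightarrow> complex \<Rightarrow> real" where
  "conj_poisson f z = (LINT t|lborel. conj_kernel z t * f t)"

text \<open>The weight admits constants, so that \<open>\<bar>a t - a x\<bar>\<close> can be
  integrated against the Poisson kernel at a Lebesgue point; square integrability would be lost when
  a constant is subtracted.\<close>

definition poisson_summable :: "(real \<Rightarrow> real) \<Rightarrow> bool" where
  "poisson_summable f \<longleftrightarrow> f \<in> borel_measurable borel \<and> integrable lborel (\<lambda>t. f t / (1 + t\<^sup>2))"

definition L2_fun :: "(real \<Rightarrow> real) \<Rightarrow> bool" where
  "L2_fun f \<longleftrightarrow> f \<in> borel_measurable borel \<and> integrable lborel (\<lambda>t. (f t)\<^sup>2)"

section \<open>Size, integrals and integrability of the two kernels\<close>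

lemma poisson_kernel_measurable [measurable]:
  "poisson_kernel z \<in> borel_measurable borel"
  "(\<lambda>t. poisson_kernel (Complex t e) s) \<in> borel_measurable borel"
proof -
  show "poisson_kernel z \<in> borel_measurable borel"
    unfolding poisson_kernel_def[abs_def] by measurable
  show "(\<lambda>t. poisson_kernel (Complex t e) s) \<in> borel_measurable borel"
    by (simp add: poisson_kernel_def)
qed

lemma conj_kernel_measurable [measurable]: "conj_kernel z \<in> borel_measurable borel"
  unfolding conj_kernel_def by measurable

lemma kernel_denominator_pos: "Im z \<noteq> 0 \<Longrightarrow> (t - Re z)\<^sup>2 + (Im z)\<^sup>2 > 0"
  by (simp add: add_nonneg_pos)

lemma poisson_kernel_pos: "Im z > 0 \<Longrightarrow> poisson_kernel z t > 0"
  unfolding poisson_kernel_def using kernel_denominator_pos[of z t] by simp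

lemma poisson_kernel_nonneg: "Im z > 0 \<Longrightarrow> poisson_kernel z t \<ge> 0"
  using poisson_kernel_pos[of z t] by linarith

lemma poisson_kernel_le: assumes "Im z > 0" shows "poisson_kernel z t \<le> 1 / (pi * Im z)"
proof -
  have "poisson_kernel z t \<le> Im z / (pi * (Im z)\<^sup>2)"
    unfolding poisson_kernel_def using assms kernel_denominator_pos[of z t]
    by (intro divide_left_mono mult_left_mono) auto
  also have "\<dots> = 1 / (pi * Im z)" using assms by (simp add: power2_eq_square)
  finally show ?thesis .
qed

lemma frac_le_cross:
  fixes a d i k :: real
  assumes "a \<le> k * d" "a > 0" "d > 0" "i \<ge> 0"
  shows "i / d \<le> i * k / a"
  using mult_left_mono[OF assms(1,4)] assms by (simp add: field_simps)

text \<open>Away from \<open>Re z\<close> the kernel is \<open>Im z\<close> times an integrable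
  weight whose constant depends only on \<open>Re z\<close> and \<open>r\<close>, so tails vanish
  linearly as the height tends to 0.\<close>

lemma poisson_kernel_le_tail:
  assumes "Im z > 0" "r > 0" "\<bar>t - Re z\<bar> \<ge> r"
  shows "poisson_kernel z t \<le> Im z * (2 + (1 + 2 * (Re z)\<^sup>2) / r\<^sup>2) / (1 + t\<^sup>2)"
proof -
  let ?u = "t - Re z"
  have r: "r\<^sup>2 \<le> ?u\<^sup>2" using assms by (metis abs_le_square_iff abs_of_pos)
  have "t\<^sup>2 \<le> 2 * ?u\<^sup>2 + 2 * (Re z)\<^sup>2"
    using zero_le_power2[of "?u - Re z"] by (simp add: power2_eq_square algebra_simps)
  moreover have "(1 + 2 * (Re z)\<^sup>2) \<le> (1 + 2 * (Re z)\<^sup>2) / r\<^sup>2 * ?u\<^sup>2"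
    using mult_left_mono[OF r, of "1 + 2 * (Re z)\<^sup>2"] \<open>r > 0\<close> by (simp add: pos_le_divide_eq)
  ultimately have "1 + t\<^sup>2 \<le> (2 + (1 + 2 * (Re z)\<^sup>2) / r\<^sup>2) * ?u\<^sup>2"
    by (simp add: algebra_simps)
  also have "\<dots> \<le> (2 + (1 + 2 * (Re z)\<^sup>2) / r\<^sup>2) * (pi * (?u\<^sup>2 + (Im z)\<^sup>2))"
  proof (intro mult_left_mono)
    have "?u\<^sup>2 + (Im z)\<^sup>2 \<le> pi * (?u\<^sup>2 + (Im z)\<^sup>2)"
      using pi_ge_two by (intro mult_right_mono[of 1 pi, simplified]) auto
    then show "?u\<^sup>2 \<le> pi * (?u\<^sup>2 + (Im z)\<^sup>2)"  using zero_le_power2[of "Im z"] by linarith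
  qed auto
  finally show ?thesis
    unfolding poisson_kernel_def using kernel_denominator_pos[of z t] assms
    by (intro frac_le_cross) (auto intro: add_pos_nonneg)
qed

text \<open>This is the constant of the tail bound at \<open>r = Im z\<close>; near
  \<open>Re z\<close> the term \<open>(Im z)\<^sup>2\<close> of the denominator replaces the
  distance.\<close>

lemma poisson_kernel_le_inverse_square:
  assumes "Im z > 0"
  shows "poisson_kernel z t \<le> Im z * (2 + (1 + 2 * (Re z)\<^sup>2) / (Im z)\<^sup>2) / (1 + t\<^sup>2)"
proof -
  let ?u = "t - Re z" let ?C = "2 + (1 + 2 * (Re z)\<^sup>2) / (Im z)\<^sup>2"
  have "t\<^sup>2 \<le> 2 * ?u\<^sup>2 + 2 * (Re z)\<^sup>2"
    using zero_le_power2[of "?u - Re z"] by (simp add: power2_eq_square algebra_simps)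
  moreover have "?C * (?u\<^sup>2 + (Im z)\<^sup>2) = 2 * ?u\<^sup>2 + (1 + 2 * (Re z)\<^sup>2) / (Im z)\<^sup>2 * ?u\<^sup>2 + 2 * (Im z)\<^sup>2 + (1 + 2 * (Re z)\<^sup>2)"
    using assms by (simp add: field_simps)
  moreover have "(1 + 2 * (Re z)\<^sup>2) / (Im z)\<^sup>2 * ?u\<^sup>2 \<ge> 0" by simp
  ultimately have "1 + t\<^sup>2 \<le> ?C * (?u\<^sup>2 + (Im z)\<^sup>2)"
    using zero_le_power2[of "Im z"] by linarith
  also have "\<dots> \<le> ?C * (pi * (?u\<^sup>2 + (Im z)\<^sup>2))"
  proof (intro mult_left_mono)
    show "?u\<^sup>2 + (Im z)\<^sup>2 \<le> pi * (?u\<^sup>2 + (Im z)\<^sup>2)"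
      using pi_ge_two by (intro mult_right_mono[of 1 pi, simplified]) auto
  qed auto
  finally show ?thesis
    unfolding poisson_kernel_def using kernel_denominator_pos[of z t] assms
    by (intro frac_le_cross) (auto intro: add_pos_nonneg)
qed

lemma integrable_inverse_one_plus_square: "integrable lborel (\<lambda>t::real. 1 / (1 + t\<^sup>2))"
  using integrable_inverse_1_plus_square by (simp add: set_integrable_def einterval_def inverse_eq_divide)

lemma integral_inverse_one_plus_square: "(LINT t|lborel. 1 / (1 + t\<^sup>2)) = pi"
  using LBINT_inverse_1_plus_square
  by (simp add: interval_lebesgue_integral_def set_lebesgue_integral_def einterval_def inverse_eq_divide)

lemma poisson_kernel_integral:
  assumes "Im z > 0"
  shows "integrable lborel (poisson_kernel z)" "(LINT t|lborel. poisson_kernel z t) = 1"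
proof -
  have eq: "Im z * poisson_kernel z (Re z + Im z * t) = 1 / pi * (1 / (1 + t\<^sup>2))" for t
  proof -
    have "Im z * poisson_kernel z (Re z + Im z * t) = (Im z)\<^sup>2 / (pi * ((Im z)\<^sup>2 * (1 + t\<^sup>2)))"
      unfolding poisson_kernel_def by (simp add: algebra_simps power2_eq_square)
    then show ?thesis using assms by simp
  qed
  have "integrable lborel (\<lambda>t. poisson_kernel z (Re z + Im z * t))"
  proof -
    have "integrable lborel (\<lambda>t. 1 / Im z * (1 / pi * (1 / (1 + t\<^sup>2))))"
      by (intro integrable_mult_right integrable_inverse_one_plus_square)
    also have "(\<lambda>t. 1 / Im z * (1 / pi * (1 / (1 + t\<^sup>2)))) = (\<lambda>t. poisson_kernel z (Re z + Im z * t))"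
      unfolding eq[symmetric] using assms by simp
    finally show ?thesis .
  qed
  then show "integrable lborel (poisson_kernel z)"
    using lborel_integrable_real_affine_iff[of "Im z" "poisson_kernel z" "Re z"] assms by simp
  have "(LINT t|lborel. poisson_kernel z t) = (LINT t|lborel. Im z * poisson_kernel z (Re z + Im z * t))"
    by (subst lborel_integral_real_affine[of "Im z" _ "Re z"]) (use assms in auto)
  also have "\<dots> = 1 / pi * pi" unfolding eq
    by (subst integral_mult_right_zero) (simp only: integral_inverse_one_plus_square)
  finally show "(LINT t|lborel. poisson_kernel z t) = 1" by simp
qed

lemma poisson_kernel_nn_integral:
  "Im z > 0 \<Longrightarrow> (\<integral>\<^sup>+t. ennreal (poisson_kernel z t) \<partial>lborel) = 1"
  using poisson_kernel_integral[of z] by (subst nn_integral_eq_integral) (auto simp: poisson_kernel_nonneg)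

lemma poisson_kernel_swap: "poisson_kernel (Complex x e) t = poisson_kernel (Complex t e) x"
  by (simp add: poisson_kernel_def power2_commute)

lemma poisson_summable_integrable:
  assumes "poisson_summable f" "Im z > 0"
  shows "integrable lborel (\<lambda>t. poisson_kernel z t * f t)"
proof -
  have [measurable]: "f \<in> borel_measurable borel" using assms by (simp add: poisson_summable_def)
  let ?C = "Im z * (2 + (1 + 2 * (Re z)\<^sup>2) / (Im z)\<^sup>2)"
  have "integrable lborel (\<lambda>t. ?C * (f t / (1 + t\<^sup>2)))"
    using assms by (intro integrable_mult_right) (auto simp: poisson_summable_def)
  then show ?thesis
  proof (rule Bochner_Integration.integrable_bound)
    show "AE t in lborel. norm (poisson_kernel z t * f t) \<le> norm (?C * (f t / (1 + t\<^sup>2)))"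
    proof (intro AE_I2)
      fix t
      have "norm (poisson_kernel z t * f t) = poisson_kernel z t * \<bar>f t\<bar>"
        using poisson_kernel_nonneg[OF assms(2)] by (simp add: abs_mult)
      also have "\<dots> \<le> ?C / (1 + t\<^sup>2) * \<bar>f t\<bar>"
        by (intro mult_right_mono poisson_kernel_le_inverse_square assms) auto
      also have "\<dots> = norm (?C * (f t / (1 + t\<^sup>2)))"
      proof -
        have "norm (C * (x / D)) = C / D * \<bar>x\<bar>" if "C \<ge> 0" "D > 0" for C D x :: real
          using that by (simp add: abs_mult)
        note h = this[symmetric]
        show ?thesis by (rule h) (insert assms(2), auto intro!: add_pos_nonneg mult_nonneg_nonneg)
      qed
      finally show "norm (poisson_kernel z t * f t) \<le> norm (?C * (f t / (1 + t\<^sup>2)))" .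
    qed
  qed simp
qed

lemma abs_mult_le_sum_squares: "\<bar>a * b\<bar> \<le> a\<^sup>2 + (b::real)\<^sup>2"
proof -
  have "2 * \<bar>a * b\<bar> \<le> a\<^sup>2 + b\<^sup>2" using sum_squares_bound[of "\<bar>a\<bar>" "\<bar>b\<bar>"] by (simp add: abs_mult)
  then show ?thesis using abs_ge_zero[of "a * b"] by linarith
qed

lemma integrable_mult_of_squares:
  fixes f g :: "'a \<Rightarrow> real"
  assumes [measurable]: "f \<in> borel_measurable M" "g \<in> borel_measurable M"
    and "integrable M (\<lambda>x. (f x)\<^sup>2)" "integrable M (\<lambda>x. (g x)\<^sup>2)"
  shows "integrable M (\<lambda>x. f x * g x)"
proof (rule Bochner_Integration.integrable_bound)
  show "integrable M (\<lambda>x. (f x)\<^sup>2 + (g x)\<^sup>2)" using assms by simp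
  show "AE x in M. norm (f x * g x) \<le> norm ((f x)\<^sup>2 + (g x)\<^sup>2)"
    using abs_mult_le_sum_squares by (intro AE_I2) simp
qed simp

lemma L2_fun_poisson_summable:
  assumes "L2_fun f" shows "poisson_summable f"
proof -
  have [measurable]: "f \<in> borel_measurable borel" using assms by (simp add: L2_fun_def)
  have "integrable lborel (\<lambda>t::real. (1 / (1 + t\<^sup>2))\<^sup>2)"
  proof (rule Bochner_Integration.integrable_bound[OF integrable_inverse_one_plus_square])
    have "(1 / (1 + t\<^sup>2))\<^sup>2 \<le> 1 / (1 + t\<^sup>2)" for t :: real
      unfolding power2_eq_square[of "1 / (1 + t\<^sup>2)"] by (rule mult_left_le) (auto simp: divide_le_eq_1 add_pos_nonneg)
    then show "AE t in lborel. norm ((1 / (1 + t\<^sup>2))\<^sup>2) \<le> norm (1 / (1 + t\<^sup>2 :: real))" by simp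
  qed simp
  then have "integrable lborel (\<lambda>t. (1 / (1 + t\<^sup>2)) * f t)"
    using assms by (intro integrable_mult_of_squares) (auto simp: L2_fun_def)
  then show ?thesis by (simp add: poisson_summable_def)
qed

text \<open>The squares of both kernels add up to exactly
  \<open>poisson_kernel z t / (pi * Im z)\<close>.\<close>

lemma conj_kernel_square_le:
  assumes "Im z > 0" shows "(conj_kernel z t)\<^sup>2 \<le> poisson_kernel z t / (pi * Im z)"
proof -
  let ?D = "(t - Re z)\<^sup>2 + (Im z)\<^sup>2"
  have D: "?D > 0" using assms by (intro kernel_denominator_pos) simp
  have "(conj_kernel z t)\<^sup>2 = (t - Re z)\<^sup>2 / (pi * ?D)\<^sup>2"
    by (simp add: conj_kernel_def power_divide power2_commute)
  also have "\<dots> \<le> ?D / (pi * ?D)\<^sup>2" by (intro divide_right_mono) auto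
  also have "\<dots> = poisson_kernel z t / (pi * Im z)"
  proof -
    have "D / (pi * D)\<^sup>2 = i / (pi * D) / (pi * i)" if "D > 0" "i > 0" for D i :: real
      using that by (simp add: power2_eq_square)
    from this[OF D assms] show ?thesis by (simp add: poisson_kernel_def)
  qed
  finally show ?thesis .
qed

lemma L2_fun_conj_kernel: assumes "Im z > 0" shows "L2_fun (conj_kernel z)"
  unfolding L2_fun_def
proof
  show "integrable lborel (\<lambda>t. (conj_kernel z t)\<^sup>2)"
  proof (rule Bochner_Integration.integrable_bound)
    show "integrable lborel (\<lambda>t. poisson_kernel z t / (pi * Im z))" using poisson_kernel_integral[OF assms] by simp
    show "AE t in lborel. norm ((conj_kernel z t)\<^sup>2) \<le> norm (poisson_kernel z t / (pi * Im z))"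
      using conj_kernel_square_le[OF assms] poisson_kernel_nonneg[OF assms] assms by simp
  qed simp
qed simp

lemma conj_kernel_integrable:
  "L2_fun f \<Longrightarrow> Im z > 0 \<Longrightarrow> integrable lborel (\<lambda>t. conj_kernel z t * f t)"
  using L2_fun_conj_kernel[of z] by (intro integrable_mult_of_squares) (auto simp: L2_fun_def)

text \<open>A covering argument: \<open>A\<close> has no mass for the density \<open>f\<close>, so
  it lies in an open set U of small mass. A point violating the bound is the centre of arbitrarily
  small balls in U whose length is less than \<open>2 / c\<close> times their mass. By Vitali,
  disjoint balls of this kind cover almost all violating points, which therefore have arbitrarily
  small measure.\<close>

lemma ball_average_AE_bounded:
  fixes f :: "real \<Rightarrow> real"
  assumes [measurable]: "f \<in> borel_measurable borel" and int: "integrable lborel f"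
    and f0: "\<And>x. f x \<ge> 0" and A: "A \<in> sets borel" and fA: "\<And>x. x \<in> A \<Longrightarrow> f x = 0" and "c > 0"
  shows "AE x in lborel. x \<in> A \<longrightarrow> (\<exists>r0>0. \<forall>r. 0 < r \<and> r < r0 \<longrightarrow> (\<integral>\<^sup>+t. f t * indicator (ball x r) t \<partial>lborel) \<le> c * r)"
proof -
  define \<nu> where "\<nu> = density lborel (\<lambda>t. ennreal (f t))"
  have sets_\<nu>: "sets \<nu> = sets borel" by (simp add: \<nu>_def)
  have \<nu>: "emeasure \<nu> B = (\<integral>\<^sup>+t. f t * indicator B t \<partial>lborel)" if "B \<in> sets borel" for B
    using that f0 by (auto simp: \<nu>_def emeasure_density intro!: nn_integral_cong split: split_indicator)
  have fin: "emeasure \<nu> (space \<nu>) \<noteq> \<infinity>"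
    using int f0 by (simp add: \<nu>[of UNIV] \<nu>_def emeasure_density nn_integral_eq_integral)
  define S where "S = {x \<in> A. \<forall>r0>0. \<exists>r. 0 < r \<and> r < r0 \<and> emeasure \<nu> (ball x r) > c * r}"
  have "negligible S"
    unfolding negligible_outer
  proof (intro allI impI)
    fix e :: real assume "e > 0"
    have "emeasure \<nu> A = (\<integral>\<^sup>+t. 0 \<partial>(lborel :: real measure))" unfolding \<nu>[OF A]
      using fA by (intro nn_integral_cong) (auto simp: indicator_def)
    then have "emeasure \<nu> A = 0" by simp
    moreover have "emeasure \<nu> A = (INF U\<in>{U. A \<subseteq> U \<and> open U}. emeasure \<nu> U)"
      using outer_regular[OF sets_\<nu>] A fin by auto
    \<comment> \<open>The comparison of length with mass costs a factor \<open>2 / c\<close>, which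
      leaves \<open>e / 2\<close>, strictly below \<open>e\<close>.\<close>
    ultimately have "(INF U\<in>{U. A \<subseteq> U \<and> open U}. emeasure \<nu> U) < ennreal (e * c / 4)"
      using \<open>e > 0\<close> \<open>c > 0\<close> by simp
    then obtain U where U: "A \<subseteq> U" "open U" "emeasure \<nu> U < ennreal (e * c / 4)"
      by (auto simp: INF_less_iff)
    define K where "K = {(x, r). 0 < r \<and> ball x r \<subseteq> U \<and> emeasure \<nu> (ball x r) > c * r}"
    obtain C where C: "countable C" "C \<subseteq> K"
      "pairwise (\<lambda>i j. disjnt (ball (fst i) (snd i)) (ball (fst j) (snd j))) C"
      "negligible (S - (\<Union>i\<in>C. ball (fst i) (snd i)))"
    proof (rule Vitali_covering_theorem_balls[of S K fst snd])
      fix x d :: real assume "x \<in> S" "d > 0"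
      then obtain \<rho> where \<rho>: "\<rho> > 0" "ball x \<rho> \<subseteq> U" using U openE[of U x] unfolding S_def by blast
      obtain r where r: "0 < r" "r < min d \<rho>" "emeasure \<nu> (ball x r) > c * r"
        using \<open>x \<in> S\<close> \<open>d > 0\<close> \<rho> unfolding S_def by (auto dest: spec[of _ "min d \<rho>"])
      then have "(x, r) \<in> K" using \<rho> by (auto simp: K_def)
      then show "\<exists>i. i \<in> K \<and> x \<in> ball (fst i) (snd i) \<and> snd i < d" using r by force
    qed
    define W where "W = (\<Union>i\<in>C. ball (fst i) (snd i))"
    have disj: "disjoint_family_on (\<lambda>i. ball (fst i) (snd i)) C"
      using C(3) by (auto simp: disjoint_family_on_def pairwise_def disjnt_def)
    have "emeasure lborel W = (\<integral>\<^sup>+i. emeasure lborel (ball (fst i) (snd i)) \<partial>count_space C)"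
      unfolding W_def using C disj by (intro emeasure_UN_countable) auto
    also have "\<dots> \<le> (\<integral>\<^sup>+i. ennreal (2 / c) * emeasure \<nu> (ball (fst i) (snd i)) \<partial>count_space C)"
    proof (intro nn_integral_mono)
      fix i assume "i \<in> space (count_space C)"
      then have i: "0 < snd i" "emeasure \<nu> (ball (fst i) (snd i)) > c * snd i" using C by (auto simp: K_def)
      have "emeasure lborel (ball (fst i) (snd i)) = ennreal (2 * snd i)"
        using i by (simp add: ball_eq_greaterThanLessThan)
      also have "\<dots> = ennreal (2 / c) * ennreal (c * snd i)"
        using i \<open>c > 0\<close> by (simp flip: ennreal_mult')
      also have "\<dots> \<le> ennreal (2 / c) * emeasure \<nu> (ball (fst i) (snd i))"
        using i by (intro mult_left_mono) auto
      finally show "emeasure lborel (ball (fst i) (snd i)) \<le> ennreal (2 / c) * emeasure \<nu> (ball (fst i) (snd i))" .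
    qed
    also have "\<dots> = ennreal (2 / c) * emeasure \<nu> W"
      unfolding W_def using C disj
      by (subst emeasure_UN_countable) (auto simp: nn_integral_cmult sets_\<nu>)
    also have "\<dots> \<le> ennreal (2 / c) * emeasure \<nu> U"
    proof (intro mult_left_mono emeasure_mono)
      show "W \<subseteq> U" unfolding W_def
      proof (rule UN_least)
        fix i assume "i \<in> C"
        then have "i \<in> K" using C by auto
        then show "ball (fst i) (snd i) \<subseteq> U" unfolding K_def by (cases i) (simp add: mem_Collect_eq)
      qed
    qed (use U in \<open>auto simp: sets_\<nu>\<close>)
    also have "\<dots> \<le> ennreal (2 / c) * ennreal (e * c / 4)" using U by (intro mult_left_mono) auto
    also have "\<dots> = ennreal (e / 2)" using \<open>c > 0\<close> \<open>e > 0\<close> by (simp flip: ennreal_mult')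
    finally have W: "emeasure lborel W \<le> ennreal (e / 2)" .
    have Wm: "W \<in> sets lborel" unfolding W_def by (auto intro: open_UN borel_open)
    \<comment> \<open>What the balls miss is null but not known to be Borel, hence the passage from
      \<open>lborel\<close> to \<open>lebesgue\<close>.\<close>
    define Z where "Z = S - W"
    have Z: "Z \<in> null_sets lebesgue" using C(4) by (simp add: Z_def W_def negligible_iff_null_sets)
    have Wl: "W \<in> sets lebesgue" "emeasure lebesgue W \<le> ennreal (e / 2)" using W Wm by auto
    have em: "emeasure lebesgue (W \<union> Z) \<le> ennreal (e / 2)"
      using Wl Z by (simp add: emeasure_Un_null_set)
    show "\<exists>T. S \<subseteq> T \<and> T \<in> lmeasurable \<and> measure lebesgue T < e"
    proof (intro exI[of _ "W \<union> Z"] conjI)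
      show "S \<subseteq> W \<union> Z" by (auto simp: Z_def)
      show "W \<union> Z \<in> lmeasurable" using Wl Z em
        by (intro fmeasurableI) (auto simp: null_setsD2 intro: le_less_trans)
      have "measure lebesgue (W \<union> Z) \<le> e / 2" using em \<open>e > 0\<close> unfolding measure_def
        by (intro enn2real_leI) auto
      then show "measure lebesgue (W \<union> Z) < e" using \<open>e > 0\<close> by linarith
    qed
  qed
  then have "AE x in lebesgue. x \<notin> S"
    by (simp add: negligible_iff_null_sets AE_not_in)
  then have "AE x in lborel. x \<notin> S" by (simp add: AE_completion_iff)
  then show ?thesis
  proof eventually_elim
    case (elim x)
    then show ?case unfolding S_def by (force simp: \<nu> not_less)
  qed
qed

text \<open>If \<open>2 ^ k * \<epsilon>\<close> is the first dyadic radius exceeding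
  \<open>\<bar>t - x\<bar>\<close> and k > 0, the distance is at least half of it, which gives the
  height \<open>4 / (pi * \<epsilon>) * (1 / 4) ^ k\<close>. That term alone bounds the kernel; the
  sum over nested balls is taken because it reduces Poisson integrals to ball averages.\<close>

lemma poisson_kernel_dyadic_bound:
  assumes "\<epsilon> > 0"
  shows "ennreal (poisson_kernel (Complex x \<epsilon>) t)
    \<le> (\<Sum>k. ennreal (4 / (pi * \<epsilon>) * (1 / 4) ^ k) * indicator (ball x (2 ^ k * \<epsilon>)) t)"
proof -
  let ?g = "\<lambda>k. ennreal (4 / (pi * \<epsilon>) * (1 / 4) ^ k) * indicator (ball x (2 ^ k * \<epsilon>)) t"
  let ?u = "\<bar>t - x\<bar>"
  have ex: "\<exists>k. ?u < 2 ^ k * \<epsilon>"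
    using real_arch_pow[of 2 "?u / \<epsilon>"] assms by (auto simp: pos_divide_less_eq)
  define k where "k = (LEAST k. ?u < 2 ^ k * \<epsilon>)"
  have k: "?u < 2 ^ k * \<epsilon>" unfolding k_def by (rule LeastI_ex[OF ex])
  have "poisson_kernel (Complex x \<epsilon>) t \<le> 4 / (pi * \<epsilon>) * (1 / 4) ^ k"
  proof (cases k)
    case 0
    have "1 / (pi * \<epsilon>) \<le> 4 / (pi * \<epsilon>)" using assms by (intro divide_right_mono) auto
    then show ?thesis using poisson_kernel_le[of "Complex x \<epsilon>" t] assms 0 by simp
  next
    case (Suc j)
    have "\<not> ?u < 2 ^ j * \<epsilon>" using not_less_Least[of j "\<lambda>k. ?u < 2 ^ k * \<epsilon>"] Suc k_def by auto
    then have "(2 ^ j * \<epsilon>)\<^sup>2 \<le> (t - x)\<^sup>2"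
      using assms by (subst abs_le_square_iff[symmetric]) (auto simp: abs_mult)
    then have "(2 ^ j * \<epsilon>)\<^sup>2 \<le> (t - x)\<^sup>2 + \<epsilon>\<^sup>2" using zero_le_power2[of \<epsilon>] by linarith
    then have "poisson_kernel (Complex x \<epsilon>) t \<le> \<epsilon> / (pi * (2 ^ j * \<epsilon>)\<^sup>2)"
      unfolding poisson_kernel_def complex.sel using assms
      by (intro divide_left_mono mult_left_mono mult_pos_pos) (auto intro!: add_nonneg_pos)
    also have "\<dots> = 4 / (pi * \<epsilon>) * (1 / 4) ^ k"
    proof -
      have "(2::real) ^ j * 2 ^ j = 4 ^ j" by (simp flip: power_mult_distrib)
      then show ?thesis using assms Suc
        by (simp add: power2_eq_square power_divide field_simps)
    qed
    finally show ?thesis .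
  qed
  then have "ennreal (poisson_kernel (Complex x \<epsilon>) t) \<le> ?g k"
    using k by (auto simp: dist_real_def abs_minus_commute indicator_def intro: ennreal_leI)
  also have "\<dots> \<le> (\<Sum>k. ?g k)"
  proof -
    have "sum h {k} \<le> suminf h" for h :: "nat \<Rightarrow> ennreal" by (intro sum_le_suminf) auto
    then have "h k \<le> suminf h" for h :: "nat \<Rightarrow> ennreal" by simp
    then show ?thesis .
  qed
  finally show ?thesis .
qed

text \<open>The k-th dyadic ball has height proportional to \<open>(1 / 4) ^ k\<close> and mass at
  most proportional to \<open>2 ^ k\<close>, so the contributions form a geometric series of ratio
  1/2. Its sum \<open>8 * c / pi\<close> is independent of \<epsilon>.\<close>

lemma nn_integral_poisson_local_le:
  fixes f :: "real \<Rightarrow> real"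
  assumes [measurable]: "f \<in> borel_measurable borel" and f0: "\<And>t. f t \<ge> 0"
    and "\<epsilon> > 0" "c > 0" "r1 > 0"
    and avg: "\<And>r. 0 < r \<Longrightarrow> r \<le> r1 \<Longrightarrow> (\<integral>\<^sup>+t. f t * indicator (ball x r) t \<partial>lborel) \<le> ennreal (c * r)"
  shows "(\<integral>\<^sup>+t. poisson_kernel (Complex x \<epsilon>) t * (f t * indicator (ball x r1) t) \<partial>lborel) \<le> ennreal (8 * c / pi)"
proof -
  let ?g = "\<lambda>k t. ennreal (4 / (pi * \<epsilon>) * (1 / 4) ^ k) * indicator (ball x (2 ^ k * \<epsilon>)) t"
  let ?h = "\<lambda>t. ennreal (f t * indicator (ball x r1) t)"
  have [measurable]: "ball x r \<in> sets borel" for r by (intro borel_open open_ball)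
  have pk: "poisson_kernel (Complex x \<epsilon>) t \<ge> 0" for t using poisson_kernel_nonneg assms by simp
  \<comment> \<open>Once \<open>f\<close> is cut off outside \<open>ball x r1\<close>, the average
    bound extends to all radii, as the dyadic balls exceed \<open>r1\<close>.\<close>
  have avg': "(\<integral>\<^sup>+t. ?h t * indicator (ball x r) t \<partial>lborel) \<le> ennreal (c * r)" if "r > 0" for r
  proof (cases "r \<le> r1")
    case True
    have "(\<integral>\<^sup>+t. ?h t * indicator (ball x r) t \<partial>lborel) \<le> (\<integral>\<^sup>+t. f t * indicator (ball x r) t \<partial>lborel)"
      by (intro nn_integral_mono) (auto simp: indicator_def)
    then show ?thesis using avg[OF that True] by (rule order_trans)
  next
    case False
    have "(\<integral>\<^sup>+t. ?h t * indicator (ball x r) t \<partial>lborel) \<le> (\<integral>\<^sup>+t. f t * indicator (ball x r1) t \<partial>lborel)"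
      by (intro nn_integral_mono) (auto simp: indicator_def)
    also have "\<dots> \<le> ennreal (c * r1)" using avg[of r1] assms by simp
    also have "\<dots> \<le> ennreal (c * r)" using False assms by (intro ennreal_leI mult_left_mono) auto
    finally show ?thesis .
  qed
  have "(\<integral>\<^sup>+t. poisson_kernel (Complex x \<epsilon>) t * (f t * indicator (ball x r1) t) \<partial>lborel)
      \<le> (\<integral>\<^sup>+t. (\<Sum>k. ?g k t * ?h t) \<partial>lborel)"
  proof (intro nn_integral_mono)
    fix t
    have "ennreal (poisson_kernel (Complex x \<epsilon>) t * (f t * indicator (ball x r1) t))
       = ennreal (poisson_kernel (Complex x \<epsilon>) t) * ?h t" using pk by (simp add: ennreal_mult')
    also have "\<dots> \<le> (\<Sum>k. ?g k t) * ?h t"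
      by (intro mult_right_mono poisson_kernel_dyadic_bound assms) auto
    finally show "ennreal (poisson_kernel (Complex x \<epsilon>) t * (f t * indicator (ball x r1) t)) \<le> (\<Sum>k. ?g k t * ?h t)"
      by simp
  qed
  also have "\<dots> = (\<Sum>k. \<integral>\<^sup>+t. ?g k t * ?h t \<partial>lborel)"
    by (rule nn_integral_suminf) measurable
  also have "\<dots> \<le> (\<Sum>k. ennreal (4 * c / pi * (1 / 2) ^ k))"
  proof (intro suminf_le)
    fix k
    have "(\<integral>\<^sup>+t. ?g k t * ?h t \<partial>lborel) = (\<integral>\<^sup>+t. ennreal (4 / (pi * \<epsilon>) * (1 / 4) ^ k) * (?h t * indicator (ball x (2 ^ k * \<epsilon>)) t) \<partial>lborel)"
      by (intro nn_integral_cong) (simp add: ac_simps)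
    also have "\<dots> = ennreal (4 / (pi * \<epsilon>) * (1 / 4) ^ k) * (\<integral>\<^sup>+t. ?h t * indicator (ball x (2 ^ k * \<epsilon>)) t \<partial>lborel)"
      by (intro nn_integral_cmult) measurable
    also have "\<dots> \<le> ennreal (4 / (pi * \<epsilon>) * (1 / 4) ^ k) * ennreal (c * (2 ^ k * \<epsilon>))"
      using assms by (intro mult_left_mono avg') auto
    also have "\<dots> = ennreal (4 * c / pi * (1 / 2) ^ k)"
    proof -
      have "(1/4::real) ^ k * 2 ^ k = (1/2) ^ k" by (simp flip: power_mult_distrib)
      then have "4 / (pi * \<epsilon>) * (1 / 4) ^ k * (c * (2 ^ k * \<epsilon>)) = 4 * c / pi * (1 / 2) ^ k"
        using assms by (simp add: field_simps)
      then show ?thesis using assms by (simp flip: ennreal_mult)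
    qed
    finally show "(\<integral>\<^sup>+t. ?g k t * ?h t \<partial>lborel) \<le> ennreal (4 * c / pi * (1 / 2) ^ k)" .
  qed auto
  also have "\<dots> = ennreal (8 * c / pi)"
  proof -
    have "(\<lambda>k. 4 * c / pi * (1 / 2) ^ k) sums (4 * c / pi * (1 / (1 - 1 / 2)))"
      by (intro sums_mult geometric_sums) auto
    then show ?thesis using assms by (subst suminf_ennreal_eq) auto
  qed
  finally show ?thesis .
qed

lemma poisson_nn_integral:
  assumes "poisson_summable f" "\<And>t. f t \<ge> 0" "Im z > 0"
  shows "ennreal (poisson f z) = (\<integral>\<^sup>+t. ennreal (poisson_kernel z t * f t) \<partial>lborel)"
  unfolding poisson_def using assms poisson_kernel_nonneg[OF assms(3)]
  by (intro nn_integral_eq_integral[symmetric] poisson_summable_integrable) auto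

text \<open>Near x the dyadic estimate bounds the integral by a small constant uniformly in
  \<epsilon>; the rest is covered by the tail bound, which is linear in \<epsilon>.\<close>

lemma poisson_tendsto_zero_AE:
  assumes f: "poisson_summable f" and f0: "\<And>t. f t \<ge> 0"
    and A: "A \<in> sets borel" and fA: "\<And>x. x \<in> A \<Longrightarrow> f x = 0"
  shows "AE x in lborel. x \<in> A \<longrightarrow> ((\<lambda>\<epsilon>. poisson f (Complex x \<epsilon>)) \<longlongrightarrow> 0) (at_right 0)"
proof -
  have [measurable]: "f \<in> borel_measurable borel" using f by (simp add: poisson_summable_def)
  have [measurable]: "ball x r \<in> sets borel" for x r :: real by (intro borel_open open_ball)
  have int: "integrable lborel (\<lambda>t. f t * indicator {-real m..real m} t)" for m
  proof (rule Bochner_Integration.integrable_bound)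
    show "integrable lborel (\<lambda>t. (1 + (real m)\<^sup>2) * (f t / (1 + t\<^sup>2)))"
      using f by (intro integrable_mult_right) (auto simp: poisson_summable_def)
    show "AE t in lborel. norm (f t * indicator {-real m..real m} t) \<le> norm ((1 + (real m)\<^sup>2) * (f t / (1 + t\<^sup>2)))"
    proof (intro AE_I2)
      fix t :: real
      have "t\<^sup>2 \<le> (real m)\<^sup>2" if "t \<in> {-real m..real m}"
        using that by (intro power2_le_iff_abs_le[THEN iffD2]) auto
      then show "norm (f t * indicator {-real m..real m} t) \<le> norm ((1 + (real m)\<^sup>2) * (f t / (1 + t\<^sup>2)))"
        using f0[of t] by (auto simp: abs_mult indicator_def field_simps add_pos_nonneg mult_left_mono)
    qed
  qed simp
  \<comment> \<open>Cutting off to \<open>{-real m..real m}\<close> makes \<open>f\<close>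
    integrable, as the ball averages require. Since m and k range over countable sets, one null set
    serves all cut-offs and all constants.\<close>
  have "AE x in lborel. \<forall>m k::nat. x \<in> A \<longrightarrow> (\<exists>r0>0. \<forall>r. 0 < r \<and> r < r0 \<longrightarrow>
      (\<integral>\<^sup>+t. (f t * indicator {-real m..real m} t) * indicator (ball x r) t \<partial>lborel) \<le> ennreal (1 / (real k + 1) * r))"
    unfolding AE_all_countable
    by (intro allI ball_average_AE_bounded int A) (auto simp: f0 fA)
  then show ?thesis
  proof (eventually_elim, intro impI tendstoI)
    fix x \<eta> :: real
    assume *: "\<forall>m k::nat. x \<in> A \<longrightarrow> (\<exists>r0>0. \<forall>r. 0 < r \<and> r < r0 \<longrightarrow>
      (\<integral>\<^sup>+t. (f t * indicator {-real m..real m} t) * indicator (ball x r) t \<partial>lborel) \<le> ennreal (1 / (real k + 1) * r))"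
      and "x \<in> A" "\<eta> > 0"
    obtain m :: nat where m: "\<bar>x\<bar> + 1 \<le> real m" using real_arch_simple by blast
    \<comment> \<open>Chosen so that the local contribution \<open>8 * c / pi\<close> with
      \<open>c = 1 / (real k + 1)\<close> stays below \<open>\<eta> / 2\<close>.\<close>
    obtain k :: nat where k: "16 / (pi * \<eta>) < real k" using reals_Archimedean2 by blast
    define c where "c = 1 / (real k + 1)"
    have "c > 0" by (simp add: c_def)
    have "16 / (pi * \<eta>) < real k + 1" using k by simp
    then have "16 < (real k + 1) * (pi * \<eta>)" using \<open>\<eta> > 0\<close> by (simp add: pos_divide_less_eq)
    then have "8 / (pi * (real k + 1)) < \<eta> / 2" by (subst pos_divide_less_eq) (auto simp: algebra_simps intro: add_pos_nonneg)
    then have ck: "8 * c / pi < \<eta> / 2" by (simp add: c_def mult.commute)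
    obtain r0 where r0: "r0 > 0" "\<And>r. 0 < r \<Longrightarrow> r < r0 \<Longrightarrow>
       (\<integral>\<^sup>+t. (f t * indicator {-real m..real m} t) * indicator (ball x r) t \<partial>lborel) \<le> ennreal (c * r)"
      using *[rule_format, OF \<open>x \<in> A\<close>, of m k] unfolding c_def by auto
    define r1 where "r1 = min (r0 / 2) 1"
    have r1: "r1 > 0" "r1 < r0" "r1 \<le> 1" using r0 by (auto simp: r1_def)
    have avg: "(\<integral>\<^sup>+t. f t * indicator (ball x r) t \<partial>lborel) \<le> ennreal (c * r)" if "0 < r" "r \<le> r1" for r
    proof -
      have "t \<in> {-real m..real m}" if "t \<in> ball x r" for t
        using that m r1 \<open>r \<le> r1\<close> by (auto simp: dist_real_def)
      then have "(\<integral>\<^sup>+t. f t * indicator (ball x r) t \<partial>lborel) = (\<integral>\<^sup>+t. (f t * indicator {-real m..real m} t) * indicator (ball x r) t \<partial>lborel)"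
        by (intro nn_integral_cong) (auto simp: indicator_def)
      then show ?thesis using r0(2)[of r] that r1 by simp
    qed
    define I where "I = (LINT t|lborel. f t / (1 + t\<^sup>2))"
    define C where "C = 2 + (1 + 2 * x\<^sup>2) / r1\<^sup>2"
    have "C \<ge> 0" by (simp add: C_def)
    have "I \<ge> 0" unfolding I_def using f0 by (intro Bochner_Integration.integral_nonneg) auto
    have bound: "poisson f (Complex x \<epsilon>) \<le> 8 * c / pi + \<epsilon> * C * I" if "\<epsilon> > 0" for \<epsilon>
    proof -
      have pk: "poisson_kernel (Complex x \<epsilon>) t \<ge> 0" for t using that by (intro poisson_kernel_nonneg) simp
      have "ennreal (poisson f (Complex x \<epsilon>)) = (\<integral>\<^sup>+t. ennreal (poisson_kernel (Complex x \<epsilon>) t * f t) \<partial>lborel)"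
        using that f f0 by (intro poisson_nn_integral) auto
      also have "\<dots> \<le> (\<integral>\<^sup>+t. ennreal (poisson_kernel (Complex x \<epsilon>) t * (f t * indicator (ball x r1) t)) + ennreal (\<epsilon> * C * (f t / (1 + t\<^sup>2))) \<partial>lborel)"
      proof (intro nn_integral_mono)
        fix t
        show "ennreal (poisson_kernel (Complex x \<epsilon>) t * f t) \<le> ennreal (poisson_kernel (Complex x \<epsilon>) t * (f t * indicator (ball x r1) t)) + ennreal (\<epsilon> * C * (f t / (1 + t\<^sup>2)))"
        proof (cases "t \<in> ball x r1")
          case False
          then have "poisson_kernel (Complex x \<epsilon>) t \<le> \<epsilon> * C / (1 + t\<^sup>2)"
            using poisson_kernel_le_tail[of "Complex x \<epsilon>" r1 t] r1 that by (auto simp: C_def dist_real_def abs_minus_commute)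
          then have "poisson_kernel (Complex x \<epsilon>) t * f t \<le> \<epsilon> * C / (1 + t\<^sup>2) * f t"
            using f0 by (intro mult_right_mono) auto
          then show ?thesis using False by (auto intro!: ennreal_leI)
        qed auto
      qed
      also have "\<dots> = (\<integral>\<^sup>+t. ennreal (poisson_kernel (Complex x \<epsilon>) t * (f t * indicator (ball x r1) t)) \<partial>lborel) + (\<integral>\<^sup>+t. ennreal (\<epsilon> * C * (f t / (1 + t\<^sup>2))) \<partial>lborel)"
        by (intro nn_integral_add) auto
      also have "\<dots> \<le> ennreal (8 * c / pi) + ennreal (\<epsilon> * C * I)"
      proof (rule add_mono)
        have "(\<integral>\<^sup>+t. ennreal (\<epsilon> * C * (f t / (1 + t\<^sup>2))) \<partial>lborel) = ennreal (\<epsilon> * C * I)"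
          unfolding I_def using f f0 \<open>C \<ge> 0\<close> that
          by (subst nn_integral_eq_integral) (auto simp: poisson_summable_def simp del: times_divide_eq_right)
        then show "(\<integral>\<^sup>+t. ennreal (\<epsilon> * C * (f t / (1 + t\<^sup>2))) \<partial>lborel) \<le> ennreal (\<epsilon> * C * I)" by simp
        show "(\<integral>\<^sup>+t. ennreal (poisson_kernel (Complex x \<epsilon>) t * (f t * indicator (ball x r1) t)) \<partial>lborel) \<le> ennreal (8 * c / pi)"
          using avg f0 that \<open>c > 0\<close> r1 by (intro nn_integral_poisson_local_le) auto
      qed
      also have "ennreal (8 * c / pi) + ennreal (\<epsilon> * C * I) = ennreal (8 * c / pi + \<epsilon> * C * I)"
        using \<open>c > 0\<close> \<open>C \<ge> 0\<close> \<open>I \<ge> 0\<close> that by simp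
      finally show ?thesis
        using \<open>c > 0\<close> \<open>C \<ge> 0\<close> \<open>I \<ge> 0\<close> that by (subst (asm) ennreal_le_iff) auto
    qed
    have "((\<lambda>\<epsilon>. \<epsilon> * C * I) \<longlongrightarrow> 0 * C * I) (at_right 0)"
      by (intro tendsto_intros)
    then have "eventually (\<lambda>\<epsilon>. \<epsilon> * C * I < \<eta> / 2) (at_right 0)"
      using \<open>\<eta> > 0\<close> by (intro order_tendstoD) auto
    moreover have "eventually (\<lambda>\<epsilon>::real. \<epsilon> > 0) (at_right 0)" by (simp add: eventually_at_right_less)
    ultimately show "eventually (\<lambda>\<epsilon>. dist (poisson f (Complex x \<epsilon>)) 0 < \<eta>) (at_right 0)"
    proof eventually_elim
      case (elim \<epsilon>)
      have "poisson f (Complex x \<epsilon>) \<ge> 0"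
        unfolding poisson_def using f0 elim by (intro Bochner_Integration.integral_nonneg mult_nonneg_nonneg poisson_kernel_nonneg) auto
      then show ?case using bound[of \<epsilon>] elim ck by simp
    qed
  qed
qed

lemma poisson_summable_add: "poisson_summable f \<Longrightarrow> poisson_summable g \<Longrightarrow> poisson_summable (\<lambda>t. f t + g t)"
  by (auto simp: poisson_summable_def add_divide_distrib)

lemma poisson_summable_const: "poisson_summable (\<lambda>t. c)"
  using integrable_mult_right[OF integrable_inverse_one_plus_square, of c] by (simp add: poisson_summable_def)

lemma poisson_summable_bound:
  assumes "poisson_summable g" "f \<in> borel_measurable borel" "\<And>t. \<bar>f t\<bar> \<le> \<bar>g t\<bar>"
  shows "poisson_summable f"
  unfolding poisson_summable_def
proof
  show "integrable lborel (\<lambda>t. f t / (1 + t\<^sup>2))"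
  proof (rule Bochner_Integration.integrable_bound)
    show "integrable lborel (\<lambda>t. g t / (1 + t\<^sup>2))" using assms by (simp add: poisson_summable_def)
    show "AE t in lborel. norm (f t / (1 + t\<^sup>2)) \<le> norm (g t / (1 + t\<^sup>2))"
      using assms(3) by (auto simp: abs_divide intro!: divide_right_mono)
  qed (use assms in simp)
qed (use assms in simp)

lemma poisson_summable_abs: "poisson_summable f \<Longrightarrow> poisson_summable (\<lambda>t. \<bar>f t\<bar>)"
  by (rule poisson_summable_bound[of f]) (auto simp: poisson_summable_def)

lemma poisson_summable_dist:
  "poisson_summable f \<Longrightarrow> poisson_summable (\<lambda>t. \<bar>f t - c\<bar>)"
  using poisson_summable_abs[OF poisson_summable_add[OF _ poisson_summable_const[of "-c"]]] by simp

lemma poisson_mono: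
  assumes "poisson_summable f" "poisson_summable g" "\<And>t. f t \<le> g t" "Im z > 0"
  shows "poisson f z \<le> poisson g z"
  unfolding poisson_def using assms poisson_kernel_nonneg[OF assms(4)]
  by (intro integral_mono poisson_summable_integrable mult_left_mono) auto

lemma poisson_const: "Im z > 0 \<Longrightarrow> poisson (\<lambda>t. c) z = c"
  unfolding poisson_def using poisson_kernel_integral[of z] by simp

lemma poisson_add:
  "poisson_summable f \<Longrightarrow> poisson_summable g \<Longrightarrow> Im z > 0 \<Longrightarrow> poisson (\<lambda>t. f t + g t) z = poisson f z + poisson g z"
  unfolding poisson_def by (simp add: distrib_left poisson_summable_integrable)

text \<open>The subtracted value \<open>a x\<close> varies with \<open>x\<close>, so it is replaced
  by rational q with a rational tolerance e. The function \<open>f q e\<close> vanishes where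
  \<open>a\<close> is e-close to q, which is the situation of the preceding convergence lemma, and
  it exceeds \<open>\<bar>a t - a x\<bar>\<close> after adding \<open>2 * e\<close>. Only countably
  many pairs occur.\<close>

lemma poisson_lebesgue_point_AE:
  assumes a: "poisson_summable a"
  shows "AE x in lborel. ((\<lambda>\<epsilon>. poisson (\<lambda>t. \<bar>a t - a x\<bar>) (Complex x \<epsilon>)) \<longlongrightarrow> 0) (at_right 0)"
proof -
  have [measurable]: "a \<in> borel_measurable borel" using a by (simp add: poisson_summable_def)
  define f where "f q e t = max (\<bar>a t - q\<bar> - e) 0" for q e t
  have [measurable]: "f q e \<in> borel_measurable borel" for q e unfolding f_def[abs_def] by measurable
  have fs: "poisson_summable (f q e)" if "e > 0" for q e
    by (rule poisson_summable_bound[OF poisson_summable_dist[OF a, of q]]) (use that in \<open>auto simp: f_def\<close>)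
  have "AE x in lborel. \<forall>q\<in>\<rat>. \<forall>e\<in>\<rat> \<inter> {0<..}. x \<in> {x. \<bar>a x - q\<bar> \<le> e} \<longrightarrow> ((\<lambda>\<epsilon>. poisson (f q e) (Complex x \<epsilon>)) \<longlongrightarrow> 0) (at_right 0)"
  proof (intro AE_ball_countable[THEN iffD2] ballI)
    fix q e :: real assume "q \<in> \<rat>" and e: "e \<in> \<rat> \<inter> {0<..}"
    show "AE x in lborel. x \<in> {x. \<bar>a x - q\<bar> \<le> e} \<longrightarrow> ((\<lambda>\<epsilon>. poisson (f q e) (Complex x \<epsilon>)) \<longlongrightarrow> 0) (at_right 0)"
      using e by (intro poisson_tendsto_zero_AE fs) (auto simp: f_def)
  qed (auto intro: countable_rat)
  then show ?thesis
  proof (eventually_elim, intro tendstoI)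
    fix x \<eta> :: real
    assume *: "\<forall>q\<in>\<rat>. \<forall>e\<in>\<rat> \<inter> {0<..}. x \<in> {x. \<bar>a x - q\<bar> \<le> e} \<longrightarrow> ((\<lambda>\<epsilon>. poisson (f q e) (Complex x \<epsilon>)) \<longlongrightarrow> 0) (at_right 0)"
      and "\<eta> > 0"
    \<comment> \<open>The final estimate is \<open>3 * e\<close>: one \<open>e\<close> from the
      limit and \<open>2 * e\<close> from replacing \<open>a x\<close> by \<open>q\<close>.\<close>
    obtain e where e: "e \<in> \<rat>" "0 < e" "e < \<eta> / 4" using Rats_dense_in_real[of 0 "\<eta> / 4"] \<open>\<eta> > 0\<close> by auto
    obtain q where q: "q \<in> \<rat>" "a x - e < q" "q < a x + e" using Rats_dense_in_real[of "a x - e" "a x + e"] e by auto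
    have "((\<lambda>\<epsilon>. poisson (f q e) (Complex x \<epsilon>)) \<longlongrightarrow> 0) (at_right 0)"
      using *[rule_format, of q e] q e by (auto simp: abs_le_iff)
    then have "eventually (\<lambda>\<epsilon>. poisson (f q e) (Complex x \<epsilon>) < e) (at_right 0)"
      using e by (intro order_tendstoD) auto
    moreover have "eventually (\<lambda>\<epsilon>::real. \<epsilon> > 0) (at_right 0)" by (simp add: eventually_at_right_less)
    ultimately show "eventually (\<lambda>\<epsilon>. dist (poisson (\<lambda>t. \<bar>a t - a x\<bar>) (Complex x \<epsilon>)) 0 < \<eta>) (at_right 0)"
    proof eventually_elim
      case (elim \<epsilon>)
      have "poisson (\<lambda>t. \<bar>a t - a x\<bar>) (Complex x \<epsilon>) \<le> poisson (\<lambda>t. f q e t + 2 * e) (Complex x \<epsilon>)"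
      proof (intro poisson_mono poisson_summable_dist a poisson_summable_add fs poisson_summable_const)
        fix t
        show "\<bar>a t - a x\<bar> \<le> f q e t + 2 * e" using q e by (auto simp: f_def)
      qed (use e elim in auto)
      also have "\<dots> = poisson (f q e) (Complex x \<epsilon>) + 2 * e"
        using fs[of e q] e elim by (simp add: poisson_add poisson_summable_const poisson_const)
      finally have "poisson (\<lambda>t. \<bar>a t - a x\<bar>) (Complex x \<epsilon>) < \<eta>" using elim e by simp
      moreover have "poisson (\<lambda>t. \<bar>a t - a x\<bar>) (Complex x \<epsilon>) \<ge> 0"
        unfolding poisson_def using elim by (intro Bochner_Integration.integral_nonneg mult_nonneg_nonneg poisson_kernel_nonneg) auto
      ultimately show ?case by simp
    qed
  qed
qed

lemma poisson_tendsto_AE: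
  assumes a: "poisson_summable a"
  shows "AE x in lborel. ((\<lambda>\<epsilon>. poisson a (Complex x \<epsilon>)) \<longlongrightarrow> a x) (at_right 0)"
  using poisson_lebesgue_point_AE[OF a]
proof eventually_elim
  case (elim x)
  have "eventually (\<lambda>\<epsilon>. norm (poisson a (Complex x \<epsilon>) - a x) \<le> poisson (\<lambda>t. \<bar>a t - a x\<bar>) (Complex x \<epsilon>)) (at_right 0)"
    using eventually_at_right_less[of 0]
  proof eventually_elim
    case (elim \<epsilon>)
    have i: "Im (Complex x \<epsilon>) > 0" using elim by simp
    have "poisson a (Complex x \<epsilon>) - a x = (LINT t|lborel. poisson_kernel (Complex x \<epsilon>) t * (a t - a x))"
      using poisson_summable_integrable[OF a i] poisson_kernel_integral[OF i]
      by (simp add: poisson_def right_diff_distrib)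
    also have "norm \<dots> \<le> (LINT t|lborel. norm (poisson_kernel (Complex x \<epsilon>) t * (a t - a x)))"
      by (rule integral_norm_bound)
    also have "\<dots> = poisson (\<lambda>t. \<bar>a t - a x\<bar>) (Complex x \<epsilon>)"
      unfolding poisson_def using poisson_kernel_nonneg[OF i] by (simp add: abs_mult)
    finally show ?case .
  qed
  then have "((\<lambda>\<epsilon>. poisson a (Complex x \<epsilon>) - a x) \<longlongrightarrow> 0) (at_right 0)"
    by (rule Lim_null_comparison) (rule elim)
  then show ?case by (simp add: LIM_zero_iff)
qed

section \<open>Boundary functions of Hardy space functions\<close>

text \<open>Cauchy's theorem on a growing triangle, phrased with a primitive G on the convex domain.
  The integral over [-n, n] is G(n) - G(-n), and both values are compared with G(n \<i>) along
  segments of length at most 2 n, on which quadratic decay makes \<open>f\<close> of order 1 /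
  n^2.\<close>

lemma integrable_and_integral_real_line_zero:
  fixes f :: "complex \<Rightarrow> complex"
  assumes U: "open U" "convex U" "{z. Im z \<ge> 0} \<subseteq> U" and holo: "f holomorphic_on U"
    and decay: "\<And>z. Im z \<ge> 0 \<Longrightarrow> cmod z \<ge> R \<Longrightarrow> cmod (f z) \<le> C / (cmod z)\<^sup>2"
  shows "integrable lborel (\<lambda>t. f (of_real t))" "(LINT t|lborel. f (of_real t)) = 0"
proof -
  have realU: "complex_of_real t \<in> U" for t using U by auto
  have cont: "continuous_on A (\<lambda>t. f (complex_of_real t))" for A
    by (intro continuous_on_compose2[OF holomorphic_on_imp_continuous_on[OF holo]] continuous_intros)
       (use realU in auto)
  have [measurable]: "(\<lambda>t. f (complex_of_real t)) \<in> borel_measurable borel"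
    using cont by (rule borel_measurable_continuous_onI)
  define R1 where "R1 = max R 1"
  obtain B where B: "\<And>t. \<bar>t\<bar> \<le> R1 \<Longrightarrow> cmod (f (of_real t)) \<le> B"
  proof -
    have "compact ((\<lambda>t. f (complex_of_real t)) ` {-R1..R1})"
      using cont by (intro compact_continuous_image) auto
    then obtain B where "\<forall>x\<in>(\<lambda>t. f (complex_of_real t)) ` {-R1..R1}. norm x \<le> B"
      using compact_imp_bounded bounded_iff by blast
    then show ?thesis by (intro that[of B]) (auto simp: abs_le_iff)
  qed
  \<comment> \<open>The first entry covers the compact part; the second uses 1 / t^2 \<le> 2 / (1 +
    t^2) for \<bar>t\<bar> > 1, which is why \<open>R1\<close> is at least 1.\<close>
  define K where "K = max (\<bar>B\<bar> * (1 + R1\<^sup>2)) (2 * \<bar>C\<bar>)"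
  have fK: "cmod (f (of_real t)) \<le> K / (1 + t\<^sup>2)" for t
  proof (cases "\<bar>t\<bar> \<le> R1")
    case True
    then have "1 + t\<^sup>2 \<le> 1 + R1\<^sup>2" by (simp add: power2_le_iff_abs_le R1_def)
    then have "cmod (f (of_real t)) * (1 + t\<^sup>2) \<le> \<bar>B\<bar> * (1 + R1\<^sup>2)"
      using B[OF True] by (intro mult_mono) auto
    also have "\<dots> \<le> K" by (simp add: K_def)
    finally show ?thesis by (simp add: field_simps add_pos_nonneg)
  next
    case False
    then have t: "\<bar>t\<bar> \<ge> R" "\<bar>t\<bar> > 1" by (auto simp: R1_def)
    have t2: "t\<^sup>2 \<ge> 1" using t by (metis abs_square_le_1 le_cases abs_le_square_iff one_power2 abs_one less_imp_le)
    have "cmod (f (of_real t)) \<le> C / t\<^sup>2" using decay[of "of_real t"] t by simp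
    also have "\<dots> \<le> \<bar>C\<bar> / t\<^sup>2" by (intro divide_right_mono) auto
    also have "\<dots> \<le> 2 * \<bar>C\<bar> / (1 + t\<^sup>2)"
    proof -
      have "\<bar>C\<bar> * (1 + t\<^sup>2) \<le> \<bar>C\<bar> * (2 * t\<^sup>2)" using t2 by (intro mult_left_mono) auto
      moreover have "t\<^sup>2 > 0" "1 + t\<^sup>2 > 0" using t2 by linarith+
      ultimately show ?thesis by (simp add: field_simps)
    qed
    also have "\<dots> \<le> K / (1 + t\<^sup>2)" by (intro divide_right_mono) (auto simp: K_def)
    finally show ?thesis .
  qed
  have K0: "K \<ge> 0" by (auto simp: K_def)
  have Kint: "integrable lborel (\<lambda>t. K / (1 + t\<^sup>2))"
    using integrable_mult_right[OF integrable_inverse_one_plus_square, of K] by simp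
  show int: "integrable lborel (\<lambda>t. f (of_real t))"
  proof (rule Bochner_Integration.integrable_bound[OF Kint])
    show "AE t in lborel. norm (f (of_real t)) \<le> norm (K / (1 + t\<^sup>2))"
    proof (intro AE_I2)
      fix t
      show "norm (f (of_real t)) \<le> norm (K / (1 + t\<^sup>2))" using fK[of t] K0 by simp
    qed
  qed simp
  obtain G where G: "\<And>z. z \<in> U \<Longrightarrow> (G has_field_derivative f z) (at z within U)"
    using holomorphic_convex_primitive'[OF U(2,1) holo] by blast
  have lim1: "(\<lambda>n::nat. LINT t|lborel. indicator {-real n..real n} t *\<^sub>R f (of_real t)) \<longlonglongrightarrow> (LINT t|lborel. f (of_real t))"
  proof (rule integral_dominated_convergence[where w = "\<lambda>t. K / (1 + t\<^sup>2)"])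
    show "AE t in lborel. (\<lambda>n::nat. indicator {-real n..real n} t *\<^sub>R f (of_real t)) \<longlonglongrightarrow> f (of_real t)"
    proof (intro AE_I2)
      fix t :: real
      obtain N :: nat where N: "\<bar>t\<bar> \<le> N" using real_arch_simple by blast
      have "eventually (\<lambda>n::nat. indicator {-real n..real n} t *\<^sub>R f (of_real t) = f (of_real t)) sequentially"
        using eventually_ge_at_top[of N] by eventually_elim (use N in \<open>auto simp: indicator_def\<close>)
      then show "(\<lambda>n::nat. indicator {-real n..real n} t *\<^sub>R f (of_real t)) \<longlonglongrightarrow> f (of_real t)"
        by (rule tendsto_eventually)
    qed
    show "AE t in lborel. norm (indicator {-real n..real n} t *\<^sub>R f (of_real t)) \<le> K / (1 + t\<^sup>2)" for n :: nat
      using fK K0 by (intro AE_I2) (auto simp: indicator_def)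
  qed (use Kint in auto)
  have FTC: "(LINT t|lborel. indicator {-real n..real n} t *\<^sub>R f (of_real t)) = G (of_nat n) - G (- of_nat n)" for n :: nat
  proof -
    have "has_bochner_integral lborel (\<lambda>t. indicator {-real n..real n} t *\<^sub>R f (of_real t)) (G (of_real (real n)) - G (of_real (- real n)))"
    proof (rule has_bochner_integral_FTC_Icc)
      fix t :: real
      have "(G has_field_derivative f (of_real t)) (at (of_real t))"
        using G[OF realU[of t]] at_within_open[OF realU[of t] U(1)] by simp
      then have "((\<lambda>t. G (of_real t)) has_vector_derivative f (of_real t)) (at t)"
        by (rule has_vector_derivative_real_field)
      then show "((\<lambda>t. G (of_real t)) has_vector_derivative f (of_real t)) (at t within {- real n..real n})"
        by (rule has_vector_derivative_at_within)
    qed (use cont in auto)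
    then show ?thesis by (simp add: has_bochner_integral_iff)
  qed
  have seg: "cmod (G (\<sigma> * of_nat n) - G (\<i> * of_nat n)) \<le> 4 * \<bar>C\<bar> / real n"
    if n: "real n \<ge> 2 * R" "n > 0" and \<sigma>: "\<sigma> = 1 \<or> \<sigma> = -1" for n :: nat and \<sigma> :: complex
  proof -
    let ?S = "closed_segment (\<sigma> * of_nat n) (\<i> * of_nat n)"
    have sub: "?S \<subseteq> {z. Im z \<ge> 0}"
      using \<sigma> by (intro closed_segment_subset convex_halfspace_Im_ge) auto
    \<comment> \<open>The point of the segment closest to the origin is its midpoint, at distance n
      / sqrt 2. With \<open>real n \<ge> 2 * R\<close> the whole segment lies in the region of
      decay.\<close>
    have far: "(cmod z)\<^sup>2 \<ge> (real n)\<^sup>2 / 2" if zS: "z \<in> ?S" for z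
    proof -
      obtain u where u: "z = (1 - u) *\<^sub>R (\<sigma> * of_nat n) + u *\<^sub>R (\<i> * of_nat n)"
        using zS unfolding closed_segment_def by blast
      have "(cmod z)\<^sup>2 = (real n)\<^sup>2 * ((1 - u)\<^sup>2 + u\<^sup>2)"
        using \<sigma> unfolding u cmod_power2 by (auto simp: power2_eq_square algebra_simps)
      also have "(1 - u)\<^sup>2 + u\<^sup>2 \<ge> 1 / 2"
        using zero_le_power2[of "2 * u - 1"] by (simp add: power2_eq_square algebra_simps)
      then have "(real n)\<^sup>2 * ((1 - u)\<^sup>2 + u\<^sup>2) \<ge> (real n)\<^sup>2 * (1 / 2)" by (intro mult_left_mono) auto
      finally show ?thesis by simp
    qed
    have bd: "cmod (f z) \<le> 2 * \<bar>C\<bar> / (real n)\<^sup>2" if "z \<in> ?S" for z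
    proof -
      have "(real n / 2)\<^sup>2 \<le> (real n)\<^sup>2 / 2" by (simp add: power2_eq_square)
      also have "\<dots> \<le> (cmod z)\<^sup>2" by (rule far[OF that])
      finally have "real n / 2 \<le> cmod z" by (rule power2_le_imp_le) simp
      then have "cmod z \<ge> R" using n by linarith
      then have "cmod (f z) \<le> C / (cmod z)\<^sup>2" using decay[of z] that sub by auto
      also have "\<dots> \<le> \<bar>C\<bar> / (cmod z)\<^sup>2" by (intro divide_right_mono) auto
      also have "\<dots> \<le> \<bar>C\<bar> / ((real n)\<^sup>2 / 2)" using far[OF that] n
        by (intro divide_left_mono mult_pos_pos) (auto intro: less_le_trans[OF _ far[OF that]])
      finally show ?thesis by (simp add: mult.commute)
    qed
    have "cmod (G (\<sigma> * of_nat n) - G (\<i> * of_nat n)) \<le> 2 * \<bar>C\<bar> / (real n)\<^sup>2 * cmod (\<sigma> * of_nat n - \<i> * of_nat n)"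
    proof (rule field_differentiable_bound[where S = ?S])
      fix z assume "z \<in> ?S"
      then show "(G has_field_derivative f z) (at z within ?S)"
        using sub U(3) by (intro has_field_derivative_subset[OF G]) auto
    qed (use bd in auto)
    also have "cmod (\<sigma> * of_nat n - \<i> * of_nat n) \<le> 2 * real n"
      using norm_triangle_ineq4[of "\<sigma> * of_nat n" "\<i> * of_nat n"] \<sigma> by (auto simp: norm_mult)
    then have "2 * \<bar>C\<bar> / (real n)\<^sup>2 * cmod (\<sigma> * of_nat n - \<i> * of_nat n) \<le> 2 * \<bar>C\<bar> / (real n)\<^sup>2 * (2 * real n)"
      by (intro mult_left_mono) auto
    also have "\<dots> = 4 * \<bar>C\<bar> / real n" using n by (simp add: power2_eq_square)
    finally show ?thesis .
  qed
  have lim2: "(\<lambda>n::nat. G (of_nat n) - G (- of_nat n)) \<longlonglongrightarrow> 0"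
  proof (rule Lim_null_comparison)
    obtain N :: nat where N: "2 * R \<le> real N" using real_arch_simple by blast
    show "eventually (\<lambda>n::nat. norm (G (of_nat n) - G (- of_nat n)) \<le> 8 * \<bar>C\<bar> / real n) sequentially"
      using eventually_ge_at_top[of "max N 1"]
    proof eventually_elim
      case (elim n)
      have "2 * R \<le> real n" "n > 0" using elim N by auto
      from seg[OF this, of 1] seg[OF this, of "-1"]
      have "cmod (G (of_nat n) - G (\<i> * of_nat n)) \<le> 4 * \<bar>C\<bar> / real n" "cmod (G (- of_nat n) - G (\<i> * of_nat n)) \<le> 4 * \<bar>C\<bar> / real n"
        by simp_all
      moreover have "G (of_nat n) - G (- of_nat n) = (G (of_nat n) - G (\<i> * of_nat n)) - (G (- of_nat n) - G (\<i> * of_nat n))" by simp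
      ultimately show ?case using norm_triangle_ineq4[of "G (of_nat n) - G (\<i> * of_nat n)" "G (- of_nat n) - G (\<i> * of_nat n)"] by simp
    qed
    show "(\<lambda>n::nat. 8 * \<bar>C\<bar> / real n) \<longlonglongrightarrow> 0"
      by (intro tendsto_divide_0[OF tendsto_const] filterlim_at_top_imp_at_infinity filterlim_real_sequentially)
  qed
  show "(LINT t|lborel. f (of_real t)) = 0"
    using LIMSEQ_unique[OF lim1] lim2 unfolding FTC by blast
qed

lemma poisson_kernel_complex:
  assumes "Im z > 0"
  shows "1 / (of_real t - z) - 1 / (of_real t - cnj z) = 2 * pi * \<i> * of_real (poisson_kernel z t)"
proof -
  have nz: "of_real t - z \<noteq> 0" "of_real t - cnj z \<noteq> 0" using assms by (auto simp: complex_eq_iff)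
  have prod: "(of_real t - z) * (of_real t - cnj z) = of_real ((t - Re z)\<^sup>2 + (Im z)\<^sup>2)"
    by (simp add: complex_eq_iff power2_eq_square algebra_simps)
  have "1 / (of_real t - z) - 1 / (of_real t - cnj z) = (z - cnj z) / ((of_real t - z) * (of_real t - cnj z))"
    using nz by (simp add: field_simps)
  also have "\<dots> = 2 * \<i> * of_real (Im z) / of_real ((t - Re z)\<^sup>2 + (Im z)\<^sup>2)"
    unfolding prod by (simp add: complex_eq_iff)
  also have "\<dots> = 2 * pi * \<i> * of_real (poisson_kernel z t)"
    by (simp add: poisson_kernel_def)
  finally show ?thesis .
qed

text \<open>The Poisson kernel is, up to a constant, the difference of the Cauchy kernels at
  \<open>z\<close> and \<open>cnj z\<close>. Subtracting the value at \<open>z\<close> removes the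
  pole there, the other pole lies below the domain, and the difference of the kernels decays
  quadratically, so the integral over the line vanishes.\<close>

lemma poisson_formula_shifted:
  assumes holo: "g holomorphic_on {z. Im z > 0}" and "\<eta> > 0" "Im z > 0"
    and bdd: "\<And>w. Im w \<ge> \<eta> \<Longrightarrow> cmod (g w) \<le> M"
  shows "integrable lborel (\<lambda>t. of_real (poisson_kernel z t) * g (Complex t \<eta>))"
    and "(LINT t|lborel. of_real (poisson_kernel z t) * g (Complex t \<eta>)) = g (z + \<i> * of_real \<eta>)"
proof -
  define h where "h w = g (w + \<i> * of_real \<eta>)" for w
  \<comment> \<open>Staying above -\<eta> keeps \<open>h\<close> holomorphic, staying above
    -\<open>Im z\<close> excludes \<open>cnj z\<close>.\<close>
  define U where "U = {w. Im w > - min \<eta> (Im z)}"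
  have U: "open U" "convex U" "{z. Im z \<ge> 0} \<subseteq> U" "z \<in> U"
    using assms by (auto simp: U_def open_halfspace_Im_gt convex_halfspace_Im_gt)
  have hU: "h holomorphic_on U"
    unfolding h_def
    by (intro holomorphic_on_compose_gen[OF _ holo, unfolded o_def] holomorphic_intros) (auto simp: U_def)
  define q where "q w = (if w = z then deriv h z else (h w - h z) / (w - z))" for w
  have qU: "q holomorphic_on U"
    unfolding q_def by (intro pole_lemma hU) (use U interior_open in auto)
  define f where "f w = q w * ((z - cnj z) / (w - cnj z))" for w
  have fU: "f holomorphic_on U"
    unfolding f_def by (intro holomorphic_intros qU) (use assms in \<open>auto simp: U_def\<close>)
  have ft: "f (of_real t) = 2 * pi * \<i> * (of_real (poisson_kernel z t) * (g (Complex t \<eta>) - h z))" for t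
  proof -
    have nz: "of_real t \<noteq> z" "of_real t \<noteq> cnj z" using assms by (auto simp: complex_eq_iff)
    have "f (of_real t) = (h (of_real t) - h z) * (1 / (of_real t - z) - 1 / (of_real t - cnj z))"
      using nz by (simp add: f_def q_def field_simps)
    also have "h (of_real t) = g (Complex t \<eta>)" by (simp add: h_def Complex_eq)
    finally show ?thesis by (simp add: poisson_kernel_complex[OF assms(3)])
  qed
  have M: "cmod (h w) \<le> M" if "Im w \<ge> 0" for w using bdd[of "w + \<i> * of_real \<eta>"] that by (simp add: h_def)
  then have "M \<ge> 0" using norm_ge_zero order_trans[of 0 "cmod (h z)" M] assms by auto
  \<comment> \<open>Numerator at most \<open>2 * M\<close> times \<open>2 * Im z\<close>,
    denominator at least \<open>(cmod w)\<^sup>2 / 4\<close>; hence the factor 16.\<close>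
  have decay: "cmod (f w) \<le> 16 * M * Im z / (cmod w)\<^sup>2" if "Im w \<ge> 0" "cmod w \<ge> 2 * cmod z + 1" for w
  proof -
    have "cmod z < cmod w" using that norm_ge_zero[of z] by linarith
    then have "w \<noteq> z" by auto
    have a: "cmod (w - z) \<ge> cmod w / 2" using norm_triangle_ineq2[of w z] that by simp
    have b: "cmod (w - cnj z) \<ge> cmod w / 2" using norm_triangle_ineq2[of w "cnj z"] that by simp
    have w0: "cmod w > 0" using that norm_ge_zero[of z] by linarith
    have "cmod (h w - h z) \<le> 2 * M"
      using norm_triangle_ineq4[of "h w" "h z"] M[of w] M[of z] that assms by auto
    moreover have "cmod (z - cnj z) = 2 * Im z" using assms by (simp add: complex_diff_cnj norm_mult)
    ultimately have num: "cmod (h w - h z) * cmod (z - cnj z) \<le> 4 * M * Im z"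
      using assms mult_right_mono[of "cmod (h w - h z)" "2 * M" "2 * Im z"] by simp
    have den: "cmod (w - z) * cmod (w - cnj z) \<ge> (cmod w)\<^sup>2 / 4"
      using mult_mono[OF a b] by (simp add: power2_eq_square)
    have "cmod (f w) = cmod (h w - h z) * cmod (z - cnj z) / (cmod (w - z) * cmod (w - cnj z))"
      using \<open>w \<noteq> z\<close> by (simp add: f_def q_def norm_mult norm_divide)
    also have "\<dots> \<le> (4 * M * Im z) / ((cmod w)\<^sup>2 / 4)"
      using num den w0 \<open>M \<ge> 0\<close> assms by (intro frac_le) auto
    finally show ?thesis by simp
  qed
  have z: "integrable lborel (\<lambda>t. f (of_real t))" "(LINT t|lborel. f (of_real t)) = 0"
    using integrable_and_integral_real_line_zero[OF U(1-3) fU, of "2 * cmod z + 1" "16 * M * Im z"] decay by auto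
  have int1: "integrable lborel (\<lambda>t. of_real (poisson_kernel z t) * (g (Complex t \<eta>) - h z))"
  proof -
    have "integrable lborel (\<lambda>t. 1 / (2 * pi * \<i>) * f (of_real t))" by (intro integrable_mult_right z)
    moreover have "1 / (2 * pi * \<i>) * f (of_real t) = of_real (poisson_kernel z t) * (g (Complex t \<eta>) - h z)" for t
      unfolding ft by simp
    ultimately show ?thesis by (simp only:)
  qed
  have pk: "integrable lborel (\<lambda>t. complex_of_real (poisson_kernel z t))" "(LINT t|lborel. complex_of_real (poisson_kernel z t)) = 1"
    using poisson_kernel_integral[OF assms(3)] by (simp_all add: integral_complex_of_real del: integral_of_real)
  have int2: "integrable lborel (\<lambda>t. of_real (poisson_kernel z t) * h z)" using pk by simp
  show "integrable lborel (\<lambda>t. of_real (poisson_kernel z t) * g (Complex t \<eta>))"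
    using Bochner_Integration.integrable_add[OF int1 int2] by (simp add: algebra_simps)
  have "(LINT t|lborel. of_real (poisson_kernel z t) * g (Complex t \<eta>))
      = (LINT t|lborel. of_real (poisson_kernel z t) * (g (Complex t \<eta>) - h z)) + (LINT t|lborel. of_real (poisson_kernel z t) * h z)"
    by (subst Bochner_Integration.integral_add[symmetric, OF int1 int2]) (simp add: algebra_simps)
  also have "(LINT t|lborel. of_real (poisson_kernel z t) * (g (Complex t \<eta>) - h z)) = 0"
    using z(2) unfolding ft by simp
  also have "(LINT t|lborel. of_real (poisson_kernel z t) * h z) = h z" using pk by simp
  finally show "(LINT t|lborel. of_real (poisson_kernel z t) * g (Complex t \<eta>)) = g (z + \<i> * of_real \<eta>)"
    by (simp add: h_def)
qed

lemma holomorphic_line_measurable: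
  assumes "g holomorphic_on {z. Im z > 0}" "\<eta> > 0"
  shows "(\<lambda>t. g (Complex t \<eta>)) \<in> borel_measurable borel"
proof (intro borel_measurable_continuous_onI continuous_on_compose2[OF holomorphic_on_imp_continuous_on[OF assms(1)]])
  show "continuous_on UNIV (\<lambda>t. Complex t \<eta>)" by (simp add: Complex_eq continuous_intros)
qed (use assms in auto)

lemma poisson_formula_Re_Im:
  assumes holo: "g holomorphic_on {z. Im z > 0}" and "\<eta> > 0" "Im z > 0"
    and bdd: "\<And>w. Im w \<ge> \<eta> \<Longrightarrow> cmod (g w) \<le> M"
  shows "poisson (\<lambda>t. Re (g (Complex t \<eta>))) z = Re (g (z + \<i> * of_real \<eta>))"
    and "poisson (\<lambda>t. Im (g (Complex t \<eta>))) z = Im (g (z + \<i> * of_real \<eta>))"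
proof -
  have pf: "integrable lborel (\<lambda>t. of_real (poisson_kernel z t) * g (Complex t \<eta>))"
    "(LINT t|lborel. of_real (poisson_kernel z t) * g (Complex t \<eta>)) = g (z + \<i> * of_real \<eta>)"
    using poisson_formula_shifted[of g \<eta> z M] assms by auto
  show "poisson (\<lambda>t. Re (g (Complex t \<eta>))) z = Re (g (z + \<i> * of_real \<eta>))"
    unfolding poisson_def pf(2)[symmetric] integral_Re[OF pf(1), symmetric] by simp
  show "poisson (\<lambda>t. Im (g (Complex t \<eta>))) z = Im (g (z + \<i> * of_real \<eta>))"
    unfolding poisson_def pf(2)[symmetric] integral_Im[OF pf(1), symmetric] by simp
qed

section \<open>Contraction in L2 and self-adjointness of Poisson integration\<close>

lemma poisson_square_le:
  assumes "L2_fun f" "Im z > 0"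
  shows "(poisson f z)\<^sup>2 \<le> poisson (\<lambda>t. (f t)\<^sup>2) z" "poisson (\<lambda>t. (f t)\<^sup>2) z \<le> 1 / (pi * Im z) * (LINT t|lborel. (f t)\<^sup>2)"
    "integrable lborel (\<lambda>t. poisson_kernel z t * (f t)\<^sup>2)"
proof -
  have [measurable]: "f \<in> borel_measurable borel" using assms by (simp add: L2_fun_def)
  have f2: "integrable lborel (\<lambda>t. (f t)\<^sup>2)" using assms by (simp add: L2_fun_def)
  have le: "poisson_kernel z t * (f t)\<^sup>2 \<le> 1 / (pi * Im z) * (f t)\<^sup>2" for t
    using poisson_kernel_le[OF assms(2)] by (intro mult_right_mono) auto
  have f2': "integrable lborel (\<lambda>t. 1 / (pi * Im z) * (f t)\<^sup>2)" by (intro integrable_mult_right f2)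
  show i2: "integrable lborel (\<lambda>t. poisson_kernel z t * (f t)\<^sup>2)"
    using le poisson_kernel_nonneg[OF assms(2)]
    by (intro Bochner_Integration.integrable_bound[OF f2']) (auto intro!: AE_I2 order_trans[OF le abs_ge_self] simp del: times_divide_eq_left)
  have "poisson (\<lambda>t. (f t)\<^sup>2) z \<le> (LINT t|lborel. 1 / (pi * Im z) * (f t)\<^sup>2)"
    unfolding poisson_def by (intro integral_mono i2 f2' le)
  then show "poisson (\<lambda>t. (f t)\<^sup>2) z \<le> 1 / (pi * Im z) * (LINT t|lborel. (f t)\<^sup>2)" by simp
  let ?c = "poisson f z"
  have i1: "integrable lborel (\<lambda>t. poisson_kernel z t * f t)"
    by (intro poisson_summable_integrable L2_fun_poisson_summable assms)
  note pk = poisson_kernel_integral[OF assms(2)]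
  \<comment> \<open>The first inequality is the nonnegativity of the variance of \<open>f\<close>
    under the probability density \<open>poisson_kernel z\<close>.\<close>
  have "0 \<le> (LINT t|lborel. poisson_kernel z t * (f t - ?c)\<^sup>2)"
    using poisson_kernel_nonneg[OF assms(2)] by (intro Bochner_Integration.integral_nonneg) auto
  also have "\<dots> = (LINT t|lborel. poisson_kernel z t * (f t)\<^sup>2 + (- 2 * ?c) * (poisson_kernel z t * f t) + ?c\<^sup>2 * poisson_kernel z t)"
    by (intro Bochner_Integration.integral_cong) (auto simp: power2_eq_square algebra_simps)
  also have "\<dots> = poisson (\<lambda>t. (f t)\<^sup>2) z + (- 2 * ?c) * ?c + ?c\<^sup>2"
    using i1 i2 pk by (simp add: poisson_def)
  finally show "?c\<^sup>2 \<le> poisson (\<lambda>t. (f t)\<^sup>2) z" by (simp add: power2_eq_square)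
qed

lemma poisson_kernel_measurable_pair [measurable]:
  "(\<lambda>p. poisson_kernel (Complex (fst p) e) (snd p)) \<in> borel_measurable (borel \<Otimes>\<^sub>M borel)"
  unfolding poisson_kernel_def complex.sel by measurable

text \<open>The kernel is symmetric in \<open>x\<close> and \<open>t\<close>, hence also a
  probability density in \<open>x\<close>; Tonelli then preserves total mass.\<close>

lemma poisson_nn_integral_line:
  assumes [measurable]: "f \<in> borel_measurable borel" and "e > 0"
  shows "(\<integral>\<^sup>+x. \<integral>\<^sup>+t. ennreal (poisson_kernel (Complex x e) t) * f t \<partial>lborel \<partial>lborel) = (\<integral>\<^sup>+t. f t \<partial>lborel)"
proof -
  have [measurable]: "(\<lambda>(x, t). ennreal (poisson_kernel (Complex x e) t) * f t) \<in> borel_measurable (lborel \<Otimes>\<^sub>M lborel)"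
    by (simp add: case_prod_beta' cong: measurable_cong_sets)
  have "(\<integral>\<^sup>+x. \<integral>\<^sup>+t. ennreal (poisson_kernel (Complex x e) t) * f t \<partial>lborel \<partial>lborel)
     = (\<integral>\<^sup>+t. \<integral>\<^sup>+x. ennreal (poisson_kernel (Complex x e) t) * f t \<partial>lborel \<partial>lborel)"
    by (rule lborel_pair.Fubini') measurable
  also have "\<dots> = (\<integral>\<^sup>+t. (\<integral>\<^sup>+x. ennreal (poisson_kernel (Complex t e) x) \<partial>lborel) * f t \<partial>lborel)"
    by (intro nn_integral_cong) (subst nn_integral_multc, simp_all add: poisson_kernel_swap[of _ e])
  also have "\<dots> = (\<integral>\<^sup>+t. f t \<partial>lborel)" using assms(2) by (simp add: poisson_kernel_nn_integral)
  finally show ?thesis .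
qed

lemma poisson_square_nn_integral_le:
  assumes "L2_fun f" "e > 0"
  shows "(\<integral>\<^sup>+x. ennreal ((poisson f (Complex x e))\<^sup>2) \<partial>lborel) \<le> (\<integral>\<^sup>+x. ennreal ((f x)\<^sup>2) \<partial>lborel)"
proof -
  have [measurable]: "f \<in> borel_measurable borel" using assms by (simp add: L2_fun_def)
  have "(\<integral>\<^sup>+x. ennreal ((poisson f (Complex x e))\<^sup>2) \<partial>lborel) \<le> (\<integral>\<^sup>+x. \<integral>\<^sup>+t. ennreal (poisson_kernel (Complex x e) t) * ennreal ((f t)\<^sup>2) \<partial>lborel \<partial>lborel)"
  proof (intro nn_integral_mono)
    fix x
    have i: "Im (Complex x e) > 0" using assms by simp
    have "ennreal ((poisson f (Complex x e))\<^sup>2) \<le> ennreal (poisson (\<lambda>t. (f t)\<^sup>2) (Complex x e))"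
      by (intro ennreal_leI poisson_square_le assms i)
    also have "\<dots> = (\<integral>\<^sup>+t. ennreal (poisson_kernel (Complex x e) t * (f t)\<^sup>2) \<partial>lborel)"
      unfolding poisson_def using poisson_kernel_nonneg[OF i]
      by (intro nn_integral_eq_integral[symmetric] poisson_square_le assms i) auto
    also have "\<dots> = (\<integral>\<^sup>+t. ennreal (poisson_kernel (Complex x e) t) * ennreal ((f t)\<^sup>2) \<partial>lborel)"
      using poisson_kernel_nonneg[OF i] by (intro nn_integral_cong ennreal_mult) auto
    finally show "ennreal ((poisson f (Complex x e))\<^sup>2) \<le> (\<integral>\<^sup>+t. ennreal (poisson_kernel (Complex x e) t) * ennreal ((f t)\<^sup>2) \<partial>lborel)" .
  qed
  also have "\<dots> = (\<integral>\<^sup>+t. ennreal ((f t)\<^sup>2) \<partial>lborel)" using assms by (intro poisson_nn_integral_line) auto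
  finally show ?thesis .
qed

lemma poisson_square_integral_le:
  assumes "L2_fun f" "e > 0" "integrable lborel (\<lambda>x. (poisson f (Complex x e))\<^sup>2)"
  shows "(LINT x|lborel. (poisson f (Complex x e))\<^sup>2) \<le> (LINT x|lborel. (f x)\<^sup>2)"
proof -
  have f2: "integrable lborel (\<lambda>t. (f t)\<^sup>2)" using assms by (simp add: L2_fun_def)
  have "ennreal (LINT x|lborel. (poisson f (Complex x e))\<^sup>2) = (\<integral>\<^sup>+x. ennreal ((poisson f (Complex x e))\<^sup>2) \<partial>lborel)"
    using assms by (subst nn_integral_eq_integral) auto
  also have "\<dots> \<le> (\<integral>\<^sup>+t. ennreal ((f t)\<^sup>2) \<partial>lborel)"
    by (rule poisson_square_nn_integral_le[OF assms(1,2)])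
  also have "\<dots> = ennreal (LINT t|lborel. (f t)\<^sup>2)" using f2 by (intro nn_integral_eq_integral) auto
  finally show ?thesis by (subst (asm) ennreal_le_iff) auto
qed

text \<open>Symmetry of the kernel and Fubini. Joint integrability comes from bounding
  \<open>\<bar>f t * h x\<bar>\<close> by the sum of squares: each square is integrated over the
  line first in the variable that it does not contain.\<close>

lemma poisson_selfadjoint:
  assumes f: "L2_fun f" and h: "L2_fun h" and e: "e > 0"
  shows "(LINT x|lborel. poisson f (Complex x e) * h x) = (LINT t|lborel. f t * poisson h (Complex t e))"
proof -
  have [measurable]: "f \<in> borel_measurable borel" "h \<in> borel_measurable borel" using f h by (auto simp: L2_fun_def)
  have pk: "poisson_kernel (Complex x e) t \<ge> 0" for x t using e by (intro poisson_kernel_nonneg) simp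
  have mP [measurable]: "(\<lambda>p. poisson_kernel (Complex (fst p) e) (snd p)) \<in> borel_measurable (lborel \<Otimes>\<^sub>M lborel)"
    by (simp cong: measurable_cong_sets)
  have int1: "integrable (lborel \<Otimes>\<^sub>M lborel) (\<lambda>p. poisson_kernel (Complex (fst p) e) (snd p) * (f (snd p))\<^sup>2)"
    if f: "L2_fun f" for f
  proof (rule integrableI_bounded)
    have [measurable]: "f \<in> borel_measurable borel" using f by (auto simp: L2_fun_def)
    show "(\<lambda>p. poisson_kernel (Complex (fst p) e) (snd p) * (f (snd p))\<^sup>2) \<in> borel_measurable (lborel \<Otimes>\<^sub>M lborel)"
      by measurable
    have "(\<integral>\<^sup>+p. norm (poisson_kernel (Complex (fst p) e) (snd p) * (f (snd p))\<^sup>2) \<partial>(lborel \<Otimes>\<^sub>M lborel))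
       = (\<integral>\<^sup>+x. \<integral>\<^sup>+t. norm (poisson_kernel (Complex x e) t * (f t)\<^sup>2) \<partial>lborel \<partial>lborel)"
      by (subst lborel.nn_integral_fst[symmetric]) auto
    also have "\<dots> = (\<integral>\<^sup>+x. \<integral>\<^sup>+t. ennreal (poisson_kernel (Complex x e) t) * ennreal ((f t)\<^sup>2) \<partial>lborel \<partial>lborel)"
      using pk by (intro nn_integral_cong) (auto simp: ennreal_mult abs_mult)
    also have "\<dots> = (\<integral>\<^sup>+t. ennreal ((f t)\<^sup>2) \<partial>lborel)" using e by (intro poisson_nn_integral_line) auto
    also have "\<dots> < \<infinity>" using f by (simp add: L2_fun_def nn_integral_eq_integral)
    finally show "(\<integral>\<^sup>+p. norm (poisson_kernel (Complex (fst p) e) (snd p) * (f (snd p))\<^sup>2) \<partial>(lborel \<Otimes>\<^sub>M lborel)) < \<infinity>" .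
  qed
  have int2: "integrable (lborel \<Otimes>\<^sub>M lborel) (\<lambda>p. poisson_kernel (Complex (fst p) e) (snd p) * (h (fst p))\<^sup>2)"
    using lborel_pair.integrable_product_swap[OF int1[OF h]] by (simp add: case_prod_beta' poisson_kernel_swap[of _ e])
  have int: "integrable (lborel \<Otimes>\<^sub>M lborel) (\<lambda>(x, t). poisson_kernel (Complex x e) t * f t * h x)"
  proof (rule Bochner_Integration.integrable_bound[OF Bochner_Integration.integrable_add[OF int1[OF f] int2]])
    have "poisson_kernel (Complex x e) t * \<bar>f t * h x\<bar> \<le> poisson_kernel (Complex x e) t * ((f t)\<^sup>2 + (h x)\<^sup>2)" for x t
      using pk abs_mult_le_sum_squares by (intro mult_left_mono)
    then show "AE p in lborel \<Otimes>\<^sub>M lborel. norm (case p of (x, t) \<Rightarrow> poisson_kernel (Complex x e) t * f t * h x)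
      \<le> norm (poisson_kernel (Complex (fst p) e) (snd p) * (f (snd p))\<^sup>2 + poisson_kernel (Complex (fst p) e) (snd p) * (h (fst p))\<^sup>2)"
      using pk by (intro AE_I2) (auto simp: abs_mult distrib_left mult.assoc intro!: order_trans[OF _ abs_ge_self])
    show "(\<lambda>(x, t). poisson_kernel (Complex x e) t * f t * h x) \<in> borel_measurable (lborel \<Otimes>\<^sub>M lborel)"
      by (simp add: case_prod_beta')
  qed
  have "(LINT x|lborel. poisson f (Complex x e) * h x) = (LINT x|lborel. LINT t|lborel. poisson_kernel (Complex x e) t * f t * h x)"
    unfolding poisson_def by simp
  also have "\<dots> = (LINT t|lborel. LINT x|lborel. poisson_kernel (Complex x e) t * f t * h x)"
    by (rule lborel_pair.Fubini_integral[OF int, symmetric])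
  also have "\<dots> = (LINT t|lborel. LINT x|lborel. f t * (poisson_kernel (Complex t e) x * h x))"
    by (simp add: poisson_kernel_swap[of _ e] ac_simps)
  also have "\<dots> = (LINT t|lborel. f t * poisson h (Complex t e))"
    unfolding poisson_def by simp
  finally show ?thesis .
qed

lemma L2_fun_diff:
  assumes "L2_fun f" "L2_fun g" shows "L2_fun (\<lambda>x. f x - g x)"
proof -
  have [measurable]: "f \<in> borel_measurable borel" "g \<in> borel_measurable borel" using assms by (auto simp: L2_fun_def)
  have "integrable lborel (\<lambda>x. (f x)\<^sup>2 + (g x)\<^sup>2 - 2 * (f x * g x))"
    using assms by (intro Bochner_Integration.integrable_add Bochner_Integration.integrable_diff integrable_mult_right integrable_mult_of_squares) (auto simp: L2_fun_def)
  then show ?thesis by (simp add: L2_fun_def power2_diff mult.assoc)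
qed

lemma integral_power2_diff:
  assumes "L2_fun f" "L2_fun g"
  shows "(LINT x|lborel. (f x - g x)\<^sup>2) = (LINT x|lborel. (f x)\<^sup>2) + (LINT x|lborel. (g x)\<^sup>2) - 2 * (LINT x|lborel. f x * g x)"
proof -
  have [measurable]: "f \<in> borel_measurable borel" "g \<in> borel_measurable borel" using assms by (auto simp: L2_fun_def)
  have "(LINT x|lborel. (f x - g x)\<^sup>2) = (LINT x|lborel. (f x)\<^sup>2 + (g x)\<^sup>2 - 2 * (f x * g x))"
    by (simp add: power2_diff mult.assoc)
  then show ?thesis using assms
    by (subst (asm) Bochner_Integration.integral_diff) (auto simp: L2_fun_def integrable_mult_of_squares)
qed

lemma poisson_diff:
  "poisson_summable f \<Longrightarrow> poisson_summable g \<Longrightarrow> Im z > 0 \<Longrightarrow> poisson (\<lambda>t. f t - g t) z = poisson f z - poisson g z"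
  unfolding poisson_def by (simp add: right_diff_distrib poisson_summable_integrable)

text \<open>The inner product of \<open>u\<^sub>\<epsilon>\<close> and \<open>u\<^sub>\<delta>\<close> depends on \<open>\<epsilon> + \<delta>\<close> only, which makes
  \<open>u\<^sub>\<epsilon>\<close> an \<open>L\<^sup>2\<close> Cauchy family as \<open>\<epsilon> \<rightarrow> 0\<close>.\<close>

lemma poisson_semigroup_boundary_function:
  fixes u :: "complex \<Rightarrow> real"
  assumes L2: "\<And>\<epsilon>. \<epsilon> > 0 \<Longrightarrow> L2_fun (\<lambda>x. u (Complex x \<epsilon>))"
    and bound: "\<And>\<epsilon>. \<epsilon> > 0 \<Longrightarrow> (LINT x|lborel. (u (Complex x \<epsilon>))\<^sup>2) \<le> M"
    and semi: "\<And>\<eta> z. \<eta> > 0 \<Longrightarrow> Im z > 0 \<Longrightarrow> poisson (\<lambda>x. u (Complex x \<eta>)) z = u (z + \<i> * of_real \<eta>)"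
    and cont: "continuous_on {z. Im z > 0} u"
  obtains a where "L2_fun a" "\<And>z. Im z > 0 \<Longrightarrow> u z = poisson a z"
proof -
  define U where "U \<epsilon> x = u (Complex x \<epsilon>)" for \<epsilon> x
  define s where "s \<epsilon> = (LINT x|lborel. (U \<epsilon> x)\<^sup>2)" for \<epsilon>
  have UL2: "L2_fun (U \<epsilon>)" if "\<epsilon> > 0" for \<epsilon> using L2[OF that] by (simp add: U_def[abs_def])
  have PU: "poisson (U \<eta>) (Complex x a) = U (\<eta> + a) x" if "\<eta> > 0" "a > 0" for \<eta> a x
    using semi[of \<eta> "Complex x a"] that by (simp add: U_def[abs_def] Complex_eq algebra_simps)
  have sM: "s \<epsilon> \<le> M" if "\<epsilon> > 0" for \<epsilon> using bound[OF that] by (simp add: s_def U_def)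
  have anti: "s \<delta> \<le> s \<epsilon>" if "0 < \<epsilon>" "\<epsilon> \<le> \<delta>" for \<epsilon> \<delta>
  proof (cases "\<epsilon> = \<delta>")
    case False
    have "(\<lambda>x. poisson (U \<epsilon>) (Complex x (\<delta> - \<epsilon>))) = U \<delta>" using PU[of \<epsilon> "\<delta> - \<epsilon>"] that False by auto
    then show ?thesis
      using poisson_square_integral_le[OF UL2[of \<epsilon>], of "\<delta> - \<epsilon>"] UL2[of \<delta>] that False
      by (simp add: s_def L2_fun_def fun_eq_iff)
  qed simp
  have ip': "(LINT x|lborel. U \<epsilon> x * U \<delta> x) = s ((\<epsilon> + \<delta>) / 2)" if "0 < \<epsilon>" "\<epsilon> < \<delta>" for \<epsilon> \<delta>
  proof -
    \<comment> \<open>Self-adjointness moves half of the height difference from one factor to the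
      other, so that both arrive at the mean height.\<close>
    let ?a = "(\<delta> - \<epsilon>) / 2"
    have a: "?a > 0" "\<epsilon> + ?a = (\<epsilon> + \<delta>) / 2" "(\<epsilon> + \<delta>) / 2 + ?a = \<delta>" using that by (auto simp: field_simps)
    have "s ((\<epsilon> + \<delta>) / 2) = (LINT x|lborel. poisson (U \<epsilon>) (Complex x ?a) * U ((\<epsilon> + \<delta>) / 2) x)"
      using PU[of \<epsilon> ?a] that a by (simp add: s_def power2_eq_square)
    also have "\<dots> = (LINT x|lborel. U \<epsilon> x * poisson (U ((\<epsilon> + \<delta>) / 2)) (Complex x ?a))"
      using that a by (intro poisson_selfadjoint UL2) auto
    also have "\<dots> = (LINT x|lborel. U \<epsilon> x * U \<delta> x)"
    proof -
      have "(\<epsilon> + \<delta>) / 2 > 0" using that by simp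
      from PU[OF this a(1)] show ?thesis unfolding a(3) by simp
    qed
    finally show ?thesis by simp
  qed
  have ip: "(LINT x|lborel. U \<epsilon> x * U \<delta> x) = s ((\<epsilon> + \<delta>) / 2)" if "0 < \<epsilon>" "0 < \<delta>" for \<epsilon> \<delta>
  proof (cases \<epsilon> \<delta> rule: linorder_cases)
    case equal
    then show ?thesis by (simp add: s_def power2_eq_square)
  next
    case greater
    then show ?thesis using ip'[of \<delta> \<epsilon>] that by (simp add: mult.commute add.commute)
  qed (use ip' that in auto)
  have cauchy: "\<exists>\<eta>>0. \<forall>\<epsilon> \<delta>. 0 < \<epsilon> \<and> \<epsilon> \<le> \<eta> \<and> 0 < \<delta> \<and> \<delta> \<le> \<eta> \<longrightarrow> (LINT x|lborel. (U \<epsilon> x - U \<delta> x)\<^sup>2) \<le> \<rho>"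
    if \<rho>: "\<rho> > 0" for \<rho>
  proof -
    \<comment> \<open>By monotonicity \<open>L\<close> is the limit of \<open>s\<close> at 0.
      Expanding the square gives at most 2 L - 2 (L - \<rho> / 2) = \<rho>, because the mean height
      is again at most \<open>\<eta>\<close>.\<close>
    define L where "L = (SUP \<epsilon>\<in>{0<..}. s \<epsilon>)"
    have bdd: "bdd_above (s ` {0<..})" using sM by (auto simp: bdd_above_def)
    have sL: "s \<epsilon> \<le> L" if "\<epsilon> > 0" for \<epsilon> unfolding L_def using bdd that by (intro cSUP_upper) auto
    obtain \<eta> where \<eta>: "\<eta> > 0" "s \<eta> > L - \<rho> / 2"
      using less_cSUP_iff[of "{0<..}" s "L - \<rho> / 2"] bdd \<rho> by (auto simp: L_def)
    show ?thesis
    proof (intro exI[of _ \<eta>] conjI allI impI \<eta>)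
      fix \<epsilon> \<delta> assume *: "0 < \<epsilon> \<and> \<epsilon> \<le> \<eta> \<and> 0 < \<delta> \<and> \<delta> \<le> \<eta>"
      have "(LINT x|lborel. (U \<epsilon> x - U \<delta> x)\<^sup>2) = s \<epsilon> + s \<delta> - 2 * s ((\<epsilon> + \<delta>) / 2)"
        using integral_power2_diff[OF UL2 UL2, of \<epsilon> \<delta>] ip[of \<epsilon> \<delta>] * by (simp add: s_def)
      moreover have "s ((\<epsilon> + \<delta>) / 2) \<ge> s \<eta>" using * by (intro anti) auto
      ultimately show "(LINT x|lborel. (U \<epsilon> x - U \<delta> x)\<^sup>2) \<le> \<rho>" using \<eta> sL[of \<epsilon>] sL[of \<delta>] * by linarith
    qed
  qed
  define V where "V n = U (1 / (real n + 1))" for n :: nat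
  have VL2: "L2_fun (V n)" for n unfolding V_def by (intro UL2) simp
  have Vm [measurable]: "V n \<in> borel_measurable borel" for n using VL2 by (simp add: L2_fun_def)
  have Vcauchy: "\<exists>N. \<forall>i\<ge>N. \<forall>j\<ge>N. (LINT x|lborel. (V i x - V j x)\<^sup>2) \<le> \<rho>" if \<rho>: "\<rho> > 0" for \<rho>
  proof -
    obtain \<eta> where \<eta>: "\<eta> > 0" "\<And>\<epsilon> \<delta>. 0 < \<epsilon> \<Longrightarrow> \<epsilon> \<le> \<eta> \<Longrightarrow> 0 < \<delta> \<Longrightarrow> \<delta> \<le> \<eta> \<Longrightarrow> (LINT x|lborel. (U \<epsilon> x - U \<delta> x)\<^sup>2) \<le> \<rho>"
      using cauchy[OF \<rho>] by blast
    obtain N :: nat where N: "1 / \<eta> \<le> N" using real_arch_simple by blast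
    have "1 / (real i + 1) \<le> \<eta>" if "i \<ge> N" for i
    proof -
      have "1 / \<eta> \<le> real i + 1" using N that by linarith
      then show ?thesis using \<open>\<eta> > 0\<close> by (simp add: field_simps)
    qed
    then show ?thesis unfolding V_def by (intro exI[of _ N]) (auto intro!: \<eta>)
  qed
  \<comment> \<open>The subsequence theorem works in L1. Multiplying by
    \<open>1 / (1 + x\<^sup>2)\<close>, which is pi times the Poisson kernel at \<i>, turns L2
    closeness into L1 closeness; the bound \<open>e\<^sup>2 / (4 * pi)\<close> is what yields
    \<open>e / 2\<close> after taking the root.\<close>
  have wcauchy: "\<exists>N. \<forall>i\<ge>N. \<forall>j\<ge>N. (LINT x|lborel. norm (V i x / (1 + x\<^sup>2) - V j x / (1 + x\<^sup>2))) < e" if e0: "e > 0" for e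
  proof -
    obtain N where N: "\<And>i j. i \<ge> N \<Longrightarrow> j \<ge> N \<Longrightarrow> (LINT x|lborel. (V i x - V j x)\<^sup>2) \<le> e\<^sup>2 / (4 * pi)"
      using Vcauchy[of "e\<^sup>2 / (4 * pi)"] e0 by auto
    have "(LINT x|lborel. norm (V i x / (1 + x\<^sup>2) - V j x / (1 + x\<^sup>2))) < e" if ij: "i \<ge> N" "j \<ge> N" for i j
    proof -
      let ?d = "\<lambda>x. \<bar>V i x - V j x\<bar>"
      have d: "L2_fun ?d" using L2_fun_diff[OF VL2 VL2, of i j] by (simp add: L2_fun_def)
      have "(LINT x|lborel. norm (V i x / (1 + x\<^sup>2) - V j x / (1 + x\<^sup>2))) = (LINT x|lborel. pi * (poisson_kernel \<i> x * ?d x))"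
        by (intro Bochner_Integration.integral_cong) (auto simp: poisson_kernel_def add.commute simp flip: diff_divide_distrib)
      also have "\<dots> = pi * poisson ?d \<i>" by (simp add: poisson_def)
      finally have eq: "(LINT x|lborel. norm (V i x / (1 + x\<^sup>2) - V j x / (1 + x\<^sup>2))) = pi * poisson ?d \<i>" .
      have "(poisson ?d \<i>)\<^sup>2 \<le> 1 / (pi * Im \<i>) * (LINT t|lborel. (?d t)\<^sup>2)"
      proof -
        have "0 < Im \<i>" by simp
        from poisson_square_le(1,2)[OF d this] show ?thesis by (rule order_trans)
      qed
      also have "\<dots> \<le> 1 / (pi * Im \<i>) * (e\<^sup>2 / (4 * pi))" using N[OF ij] by (intro mult_left_mono) auto
      also have "\<dots> = (e / (2 * pi))\<^sup>2" by (simp add: power2_eq_square)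
      finally have "(poisson ?d \<i>)\<^sup>2 \<le> (e / (2 * pi))\<^sup>2" .
      moreover have "0 \<le> e / (2 * pi)" using e0 by simp
      ultimately have "poisson ?d \<i> \<le> e / (2 * pi)" by (rule power2_le_imp_le)
      then have "pi * poisson ?d \<i> \<le> pi * (e / (2 * pi))" by (intro mult_left_mono) auto
      then show ?thesis unfolding eq using e0 by simp
    qed
    then show ?thesis by blast
  qed
  have wint: "integrable lborel (\<lambda>x. V n x / (1 + x\<^sup>2))" for n
    using L2_fun_poisson_summable[OF VL2] by (simp add: poisson_summable_def)
  obtain r where r: "strict_mono r" "AE x in lborel. Cauchy (\<lambda>i. V (r i) x / (1 + x\<^sup>2))"
    using cauchy_L1_AE_cauchy_subseq[of lborel "\<lambda>n x. V n x / (1 + x\<^sup>2)", OF wint wcauchy] by blast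
  define a where "a x = lim (\<lambda>i. V (r i) x)" for x
  have am [measurable]: "a \<in> borel_measurable borel" unfolding a_def[abs_def] by measurable
  have Va: "AE x in lborel. (\<lambda>i. V (r i) x) \<longlonglongrightarrow> a x"
    using r(2)
  proof eventually_elim
    case (elim x)
    then have "convergent (\<lambda>i. V (r i) x / (1 + x\<^sup>2))" by (simp add: Cauchy_convergent_iff)
    then obtain l where "(\<lambda>i. V (r i) x / (1 + x\<^sup>2)) \<longlonglongrightarrow> l" by (auto simp: convergent_def)
    then have "(\<lambda>i. V (r i) x / (1 + x\<^sup>2) * (1 + x\<^sup>2)) \<longlonglongrightarrow> l * (1 + x\<^sup>2)" by (intro tendsto_intros)
    moreover have "1 + x\<^sup>2 \<noteq> 0" by (simp add: add_nonneg_eq_0_iff)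
    ultimately have "convergent (\<lambda>i. V (r i) x)" by (auto simp: convergent_def)
    then show ?case by (simp add: a_def convergent_LIMSEQ_iff)
  qed
  have close: "\<exists>N. \<forall>n\<ge>N. (\<integral>\<^sup>+x. ennreal ((V n x - a x)\<^sup>2) \<partial>lborel) \<le> ennreal \<rho>" if \<rho>: "\<rho> > 0" for \<rho>
  proof -
    obtain N where N: "\<And>i j. i \<ge> N \<Longrightarrow> j \<ge> N \<Longrightarrow> (LINT x|lborel. (V i x - V j x)\<^sup>2) \<le> \<rho>"
      using Vcauchy[OF \<rho>] by blast
    have "(\<integral>\<^sup>+x. ennreal ((V n x - a x)\<^sup>2) \<partial>lborel) \<le> ennreal \<rho>" if "n \<ge> N" for n
    proof -
      \<comment> \<open>Fatou along the subsequence turns the Cauchy estimate into a distance to the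
        pointwise limit.\<close>
      have "(\<integral>\<^sup>+x. ennreal ((V n x - a x)\<^sup>2) \<partial>lborel) = (\<integral>\<^sup>+x. liminf (\<lambda>i. ennreal ((V n x - V (r i) x)\<^sup>2)) \<partial>lborel)"
      proof (intro nn_integral_cong_AE)
        show "AE x in lborel. ennreal ((V n x - a x)\<^sup>2) = liminf (\<lambda>i. ennreal ((V n x - V (r i) x)\<^sup>2))"
          using Va
        proof eventually_elim
          case (elim x)
          then have "(\<lambda>i. ennreal ((V n x - V (r i) x)\<^sup>2)) \<longlonglongrightarrow> ennreal ((V n x - a x)\<^sup>2)"
            by (intro tendsto_intros)
          then show ?case using lim_imp_Liminf[OF sequentially_bot] by metis
        qed
      qed
      also have "\<dots> \<le> liminf (\<lambda>i. \<integral>\<^sup>+x. ennreal ((V n x - V (r i) x)\<^sup>2) \<partial>lborel)"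
        by (intro nn_integral_liminf) measurable
      also have "\<dots> \<le> limsup (\<lambda>i. \<integral>\<^sup>+x. ennreal ((V n x - V (r i) x)\<^sup>2) \<partial>lborel)"
        by (intro Liminf_le_Limsup) simp
      also have "\<dots> \<le> ennreal \<rho>"
      proof (intro Limsup_bounded)
        show "eventually (\<lambda>i. (\<integral>\<^sup>+x. ennreal ((V n x - V (r i) x)\<^sup>2) \<partial>lborel) \<le> ennreal \<rho>) sequentially"
          using eventually_ge_at_top[of N]
        proof eventually_elim
          case (elim i)
          then have "r i \<ge> N" using seq_suble[OF r(1), of i] by linarith
          then have "(LINT x|lborel. (V n x - V (r i) x)\<^sup>2) \<le> \<rho>" using N that by auto
          then show ?case using L2_fun_diff[OF VL2 VL2, of n "r i"]
            by (subst nn_integral_eq_integral) (auto simp: L2_fun_def intro: ennreal_leI)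
        qed
      qed
      finally show ?thesis .
    qed
    then show ?thesis by blast
  qed
  have diffL2: "L2_fun (\<lambda>x. V n x - a x)" if "(\<integral>\<^sup>+x. ennreal ((V n x - a x)\<^sup>2) \<partial>lborel) \<le> ennreal \<rho>" for n \<rho>
    unfolding L2_fun_def using that
    by (auto intro!: integrableI_bounded intro: le_less_trans)
  have aL2: "L2_fun a"
  proof -
    obtain N where "(\<integral>\<^sup>+x. ennreal ((V N x - a x)\<^sup>2) \<partial>lborel) \<le> ennreal 1" using close[of 1] by auto
    from L2_fun_diff[OF VL2[of N] diffL2[OF this]] show ?thesis by simp
  qed
  have "u z = poisson a z" if z: "Im z > 0" for z
  proof -
    have "(\<lambda>n. u (z + \<i> * of_real (1 / (real n + 1)))) \<longlonglongrightarrow> u z"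
    proof (rule continuous_on_tendsto_compose[OF cont])
      have "(\<lambda>n. 1 / (real n + 1)) \<longlonglongrightarrow> 0" by real_asymp
      then have "(\<lambda>n. z + \<i> * of_real (1 / (real n + 1))) \<longlonglongrightarrow> z + \<i> * of_real 0" by (intro tendsto_intros)
      then show "(\<lambda>n. z + \<i> * of_real (1 / (real n + 1))) \<longlonglongrightarrow> z" by simp
    qed (use z in \<open>auto simp: add_pos_nonneg\<close>)
    moreover have "u (z + \<i> * of_real (1 / (real n + 1))) = poisson (V n) z" for n
      using semi[of "1 / (real n + 1)" z] z by (simp add: V_def U_def[abs_def])
    ultimately have 1: "(\<lambda>n. poisson (V n) z) \<longlonglongrightarrow> u z" by simp
    have "(\<lambda>n. poisson (V n) z) \<longlonglongrightarrow> poisson a z"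
    proof (rule LIMSEQ_I)
      fix e :: real assume "e > 0"
      \<comment> \<open>The maximum \<open>1 / (pi * Im z)\<close> of the kernel turns this into
        \<open>(e / 2)\<^sup>2\<close>.\<close>
      define \<rho> where "\<rho> = e\<^sup>2 * (pi * Im z) / 4"
      have "\<rho> > 0" using \<open>e > 0\<close> z by (simp add: \<rho>_def)
      then obtain N where N: "\<And>n. n \<ge> N \<Longrightarrow> (\<integral>\<^sup>+x. ennreal ((V n x - a x)\<^sup>2) \<partial>lborel) \<le> ennreal \<rho>" using close by blast
      have "norm (poisson (V n) z - poisson a z) < e" if "n \<ge> N" for n
      proof -
        note d = diffL2[OF N[OF that]]
        have "(LINT x|lborel. (V n x - a x)\<^sup>2) \<le> \<rho>"
          using N[OF that] d \<open>\<rho> > 0\<close> by (subst (asm) nn_integral_eq_integral) (auto simp: L2_fun_def)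
        then have "1 / (pi * Im z) * (LINT x|lborel. (V n x - a x)\<^sup>2) \<le> 1 / (pi * Im z) * \<rho>"
          using z by (intro mult_left_mono) auto
        also have "\<dots> = (e / 2)\<^sup>2" using z by (simp add: \<rho>_def power2_eq_square)
        finally have "(poisson (\<lambda>x. V n x - a x) z)\<^sup>2 \<le> (e / 2)\<^sup>2" using poisson_square_le[OF d z] by linarith
        then have "\<bar>poisson (\<lambda>x. V n x - a x) z\<bar> \<le> e / 2" using \<open>e > 0\<close> by (simp add: power2_le_iff_abs_le)
        moreover have "poisson (\<lambda>x. V n x - a x) z = poisson (V n) z - poisson a z"
          by (intro poisson_diff L2_fun_poisson_summable VL2 aL2 z)
        ultimately show ?thesis using \<open>e > 0\<close> by simp
      qed
      then show "\<exists>no. \<forall>n\<ge>no. norm (poisson (V n) z - poisson a z) < e" by blast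
    qed
    with 1 show ?thesis by (rule LIMSEQ_unique)
  qed
  with aL2 show thesis by (rule that)
qed

text \<open>The bound in \<open>bdd\<close> may blow up as \<eta> tends to 0, as it does for Cauchy
  transforms; it only serves the Poisson formula started at height \<eta>. The uniform control is
  the one of the square integrals.\<close>

lemma hardy_boundary_functions:
  assumes holo: "F holomorphic_on {z. Im z > 0}"
    and bdd: "\<And>\<eta>. \<eta> > 0 \<Longrightarrow> \<exists>B. \<forall>z. Im z \<ge> \<eta> \<longrightarrow> cmod (F z) \<le> B"
    and int: "\<And>\<epsilon>. \<epsilon> > 0 \<Longrightarrow> integrable lborel (\<lambda>x. (cmod (F (Complex x \<epsilon>)))\<^sup>2)"
    and bound: "\<And>\<epsilon>. \<epsilon> > 0 \<Longrightarrow> (LINT x|lborel. (cmod (F (Complex x \<epsilon>)))\<^sup>2) \<le> M"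
  obtains a b where "L2_fun a" "L2_fun b" "\<And>z. Im z > 0 \<Longrightarrow> F z = Complex (poisson a z) (poisson b z)"
proof -
  have contF: "continuous_on {z. Im z > 0} F" using holo by (rule holomorphic_on_imp_continuous_on)
  have meas [measurable]: "(\<lambda>x. F (Complex x \<epsilon>)) \<in> borel_measurable borel" if "\<epsilon> > 0" for \<epsilon>
    using holomorphic_line_measurable[OF holo that] .
  have part: "L2_fun (\<lambda>x. p (F (Complex x \<epsilon>)))" "(LINT x|lborel. (p (F (Complex x \<epsilon>)))\<^sup>2) \<le> M"
    if "\<epsilon> > 0" and p: "p \<in> borel_measurable borel" "\<And>z. (p z)\<^sup>2 \<le> (cmod z)\<^sup>2" for \<epsilon> and p :: "complex \<Rightarrow> real"
  proof -
    have [measurable]: "(\<lambda>x. p (F (Complex x \<epsilon>))) \<in> borel_measurable borel"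
      using measurable_compose[OF meas[OF that(1)] p(1)] .
    have i: "integrable lborel (\<lambda>x. (p (F (Complex x \<epsilon>)))\<^sup>2)"
      using p(2) by (intro Bochner_Integration.integrable_bound[OF int[OF that(1)]]) auto
    then show "L2_fun (\<lambda>x. p (F (Complex x \<epsilon>)))" by (simp add: L2_fun_def)
    have "(LINT x|lborel. (p (F (Complex x \<epsilon>)))\<^sup>2) \<le> (LINT x|lborel. (cmod (F (Complex x \<epsilon>)))\<^sup>2)"
      using p(2) by (intro integral_mono i int that(1))
    with bound[OF that(1)] show "(LINT x|lborel. (p (F (Complex x \<epsilon>)))\<^sup>2) \<le> M" by linarith
  qed
  have Re: "(Re z)\<^sup>2 \<le> (cmod z)\<^sup>2" and Im: "(Im z)\<^sup>2 \<le> (cmod z)\<^sup>2" for z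
    by (auto simp: cmod_power2)
  obtain a where a: "L2_fun a" "\<And>z. Im z > 0 \<Longrightarrow> Re (F z) = poisson a z"
  proof (rule poisson_semigroup_boundary_function[of "\<lambda>z. Re (F z)" M])
    show "poisson (\<lambda>x. Re (F (Complex x \<eta>))) z = Re (F (z + \<i> * of_real \<eta>))" if "\<eta> > 0" "Im z > 0" for \<eta> z
      using bdd[OF that(1)] poisson_formula_Re_Im(1)[OF holo that] by blast
  qed (use part[of _ Re] Re contF in \<open>auto intro!: continuous_intros\<close>)
  obtain b where b: "L2_fun b" "\<And>z. Im z > 0 \<Longrightarrow> Im (F z) = poisson b z"
  proof (rule poisson_semigroup_boundary_function[of "\<lambda>z. Im (F z)" M])
    show "poisson (\<lambda>x. Im (F (Complex x \<eta>))) z = Im (F (z + \<i> * of_real \<eta>))" if "\<eta> > 0" "Im z > 0" for \<eta> z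
      using bdd[OF that(1)] poisson_formula_Re_Im(2)[OF holo that] by blast
  qed (use part[of _ Im] Im contF in \<open>auto intro!: continuous_intros\<close>)
  show thesis by (rule that[OF a(1) b(1)]) (simp add: complex_eq_iff a(2) b(2))
qed

section \<open>Boundary values of singular Herglotz functions\<close>

text \<open>The difference quotient of the kernel is 1 / ((s - v) (s - w)). For v within
  \<open>Im w / 2\<close> of \<open>w\<close>, the first factor is at most \<open>2 / Im w\<close>,
  so dominated convergence differentiates under the integral. Needed both for the representing
  measure and for L2 densities on \<open>lborel\<close>.\<close>

lemma cauchy_transform_holomorphic:
  fixes h :: "real \<Rightarrow> real"
  assumes sets: "sets M = sets borel"
    and int: "\<And>w. Im w > 0 \<Longrightarrow> integrable M (\<lambda>s. of_real (h s) / (of_real s - w))"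
  shows "(\<lambda>w. LINT s|M. of_real (h s) / (of_real s - w)) holomorphic_on {w. Im w > 0}"
proof (rule holomorphic_onI)
  fix w assume "w \<in> {w. Im w > 0}"
  then have w: "Im w > 0" by simp
  note measurable_cong_sets[OF sets refl, simp]
  let ?C = "\<lambda>w. LINT s|M. of_real (h s) / (of_real s - w)"
  let ?B = "ball w (Im w / 2)"
  have far: "Im w \<le> cmod (of_real s - w)" for s
    using abs_Im_le_cmod[of "of_real s - w"] w by simp
  have near: "cmod (of_real s - w) / 2 \<le> cmod (of_real s - v)" if "v \<in> ?B" for s v
  proof -
    have "cmod (v - w) \<le> cmod (of_real s - w) / 2" using that far[of s] by (simp add: dist_norm norm_minus_commute)
    moreover have "cmod (of_real s - w) \<le> cmod (of_real s - v) + cmod (v - w)"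
      using norm_triangle_ineq[of "of_real s - v" "v - w"] by simp
    ultimately show ?thesis by simp
  qed
  \<comment> \<open>Multiplying the integrable quotient by its denominator recovers
    \<open>h\<close>, so its measurability comes from \<open>int\<close>.\<close>
  have hm [measurable]: "h \<in> borel_measurable M"
  proof -
    have "(\<lambda>s. of_real (h s) / (of_real s - w)) \<in> borel_measurable M" using int[OF w] by (rule borel_measurable_integrable)
    then have "(\<lambda>s. of_real (h s) / (of_real s - w) * (of_real s - w)) \<in> borel_measurable M"
      by (rule borel_measurable_times) simp
    moreover have "of_real (h s) / (of_real s - w) * (of_real s - w) = of_real (h s)" for s
      using w by (subst nonzero_eq_divide_eq[symmetric]) (auto simp: complex_eq_iff)
    ultimately have "(\<lambda>s. complex_of_real (h s)) \<in> borel_measurable M" by (simp only:)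
    then have "(\<lambda>s. Re (complex_of_real (h s))) \<in> borel_measurable M" by measurable
    then show ?thesis by simp
  qed
  have hb [measurable]: "h \<in> borel_measurable borel" using hm by simp
  have inB: "Im v > 0" if "v \<in> ?B" for v
  proof -
    have "\<bar>Im (v - w)\<bar> < Im w / 2" using that abs_Im_le_cmod[of "v - w"] by (simp add: dist_norm norm_minus_commute)
    then have "- (Im w / 2) < Im (v - w)" by linarith
    then show ?thesis using w by simp
  qed
  have "(?C has_field_derivative (LINT s|M. of_real (h s) / (of_real s - w)\<^sup>2)) (at w within ?B)"
    unfolding has_field_derivative_iff tendsto_at_iff_sequentially o_def
  proof (intro allI impI)
    fix X :: "nat \<Rightarrow> complex" assume X: "\<forall>i. X i \<in> ?B - {w}" "X \<longlonglongrightarrow> w"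
    have Xi: "X i \<in> ?B" "X i \<noteq> w" for i using X by auto
    have "(?C (X i) - ?C w) / (X i - w) = (LINT s|M. of_real (h s) / ((of_real s - X i) * (of_real s - w)))" for i
    proof -
      have "(?C (X i) - ?C w) / (X i - w) = (LINT s|M. of_real (h s) / (of_real s - X i) - of_real (h s) / (of_real s - w)) / (X i - w)"
        using int[OF w] int[OF inB[OF Xi(1)[of i]]] by simp
      also have "\<dots> = (LINT s|M. (of_real (h s) / (of_real s - X i) - of_real (h s) / (of_real s - w)) / (X i - w))" by simp
      also have "\<dots> = (LINT s|M. of_real (h s) / ((of_real s - X i) * (of_real s - w)))"
      proof (intro Bochner_Integration.integral_cong refl)
        fix s
        have "of_real s \<noteq> v" if "Im v > 0" for v using that by auto
        from this[OF w] this[OF inB[OF Xi(1)[of i]]] have "of_real s \<noteq> w" "of_real s \<noteq> X i" .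
        then show "(of_real (h s) / (of_real s - X i) - of_real (h s) / (of_real s - w)) / (X i - w) = of_real (h s) / ((of_real s - X i) * (of_real s - w))"
          using Xi(2)[of i] by (simp add: divide_simps) (simp add: algebra_simps)
      qed
      finally show ?thesis .
    qed
    moreover have "(\<lambda>i. LINT s|M. of_real (h s) / ((of_real s - X i) * (of_real s - w))) \<longlonglongrightarrow> (LINT s|M. of_real (h s) / (of_real s - w)\<^sup>2)"
    proof (rule integral_dominated_convergence[where w = "\<lambda>s. 2 / Im w * cmod (of_real (h s) / (of_real s - w))"])
      show "integrable M (\<lambda>s. 2 / Im w * cmod (of_real (h s) / (of_real s - w)))"
        using int[OF w] by (intro integrable_mult_right integrable_norm)
      show "AE s in M. (\<lambda>i. of_real (h s) / ((of_real s - X i) * (of_real s - w))) \<longlonglongrightarrow> of_real (h s) / (of_real s - w)\<^sup>2"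
      proof (intro AE_I2)
        fix s
        have "of_real s \<noteq> w" using w by auto
        then show "(\<lambda>i. of_real (h s) / ((of_real s - X i) * (of_real s - w))) \<longlonglongrightarrow> of_real (h s) / (of_real s - w)\<^sup>2"
          unfolding power2_eq_square by (intro tendsto_intros X) auto
      qed
      show "AE s in M. norm (of_real (h s) / ((of_real s - X i) * (of_real s - w))) \<le> 2 / Im w * cmod (of_real (h s) / (of_real s - w))" for i
      proof (intro AE_I2)
        fix s
        have "Im w / 2 \<le> cmod (of_real s - X i)" using near[OF Xi(1)[of i], of s] far[of s] by linarith
        then have "cmod (of_real (h s) / (of_real s - w)) / cmod (of_real s - X i) \<le> cmod (of_real (h s) / (of_real s - w)) / (Im w / 2)"
          using w by (intro divide_left_mono mult_pos_pos) auto
        then show "norm (of_real (h s) / ((of_real s - X i) * (of_real s - w))) \<le> 2 / Im w * cmod (of_real (h s) / (of_real s - w))"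
          by (simp add: norm_divide norm_mult ac_simps)
      qed
    qed (unfold measurable_cong_sets[OF sets refl], measurable)
    ultimately show "(\<lambda>i. (?C (X i) - ?C w) / (X i - w)) \<longlonglongrightarrow> (LINT s|M. of_real (h s) / (of_real s - w)\<^sup>2)" by simp
  qed
  then have "(?C has_field_derivative (LINT s|M. of_real (h s) / (of_real s - w)\<^sup>2)) (at w)"
    using w at_within_open[of w ?B] by simp
  then show "?C field_differentiable at w within {w. Im w > 0}"
    by (auto simp: field_differentiable_def intro: has_field_derivative_at_within)
qed

text \<open>Here \<nu> is \<mu> with density \<open>1 / (1 + s\<^sup>2)\<close>, a finite measure.
  The factor is absorbed by the kernel: \<open>(1 + s * w) / (s - w)\<close> divided by
  \<open>1 + s\<^sup>2\<close> is \<open>1 / (s - w) - s / (1 + s\<^sup>2)\<close>. The null set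
  \<open>N\<close> carries \<nu>.\<close>

locale singular_nevanlinna =
  fixes \<beta> \<gamma> :: real and \<nu> :: "real measure" and N :: "real set" and \<phi> :: "complex \<Rightarrow> complex"
  assumes beta_pos: "\<beta> > 0" and sets_nu: "sets \<nu> = sets borel" and finite_nu: "finite_measure \<nu>"
    and N: "N \<in> sets borel" "emeasure lborel N = 0" "emeasure \<nu> (- N) = 0"
    and phi_eq: "\<And>w. Im w > 0 \<Longrightarrow> \<phi> w = of_real \<beta> * w + of_real \<gamma> + (LINT s|\<nu>. (1 + of_real s * w) / (of_real s - w))"

lemma singular_herglotz_nevanlinna:
  assumes "singular_herglotz \<beta> \<phi>"
  shows "\<exists>\<gamma> \<nu> N. singular_nevanlinna \<beta> \<gamma> \<nu> N \<phi>"
proof -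
  obtain \<gamma> :: real and \<mu> :: "real measure" where \<beta>: "\<beta> > 0" and \<mu>: "sets \<mu> = sets borel" "lebesgue_singular \<mu>"
    and int: "integrable \<mu> (\<lambda>s. 1 / (1 + s\<^sup>2))"
    and \<phi>: "\<And>w. Im w > 0 \<Longrightarrow> \<phi> w = of_real \<beta> * w + of_real \<gamma> + (LINT s|\<mu>. 1 / (of_real s - w) - of_real (s / (1 + s\<^sup>2)))"
    using assms unfolding singular_herglotz_def by blast
  obtain N where N: "N \<in> sets borel" "emeasure lborel N = 0" "emeasure \<mu> (- N) = 0"
    using \<mu>(2) unfolding lebesgue_singular_def by blast
  note measurable_cong_sets[OF \<mu>(1) refl, simp]
  define \<nu> where "\<nu> = density \<mu> (\<lambda>s. ennreal (1 / (1 + s\<^sup>2)))"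
  have "singular_nevanlinna \<beta> \<gamma> \<nu> N \<phi>"
  proof (rule singular_nevanlinna.intro)
    show "\<beta> > 0" by fact
    show "sets \<nu> = sets borel" by (simp add: \<nu>_def \<mu>)
    show "finite_measure \<nu>"
    proof
      have "emeasure \<nu> (space \<nu>) = (\<integral>\<^sup>+s. ennreal (1 / (1 + s\<^sup>2)) \<partial>\<mu>)"
        by (simp add: \<nu>_def emeasure_density)
      also have "\<dots> < \<infinity>" using int by (subst nn_integral_eq_integral) auto
      finally show "emeasure \<nu> (space \<nu>) \<noteq> \<infinity>" by simp
    qed
    show "N \<in> sets borel" "emeasure lborel N = 0" by fact+
    have "- N \<in> null_sets \<mu>" using N by (intro null_setsI) (auto simp: \<mu>)
    then have "AE s in \<mu>. s \<notin> - N" by (rule AE_not_in)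
    then have "(\<integral>\<^sup>+s. ennreal (1 / (1 + s\<^sup>2)) * indicator (- N) s \<partial>\<mu>) = (\<integral>\<^sup>+s. 0 \<partial>\<mu>)"
      by (intro nn_integral_cong_AE) (auto elim!: eventually_mono)
    then show "emeasure \<nu> (- N) = 0" using N by (simp add: \<nu>_def emeasure_density \<mu>)
    fix w assume w: "Im w > 0"
    have "(LINT s|\<nu>. (1 + of_real s * w) / (of_real s - w)) = (LINT s|\<mu>. (1 / (1 + s\<^sup>2)) *\<^sub>R ((1 + of_real s * w) / (of_real s - w)))"
      unfolding \<nu>_def by (subst integral_density) (auto intro!: AE_I2)
    also have "\<dots> = (LINT s|\<mu>. 1 / (of_real s - w) - of_real (s / (1 + s\<^sup>2)))"
    proof (intro Bochner_Integration.integral_cong refl)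
      fix s :: real
      have "of_real s - w \<noteq> 0" using w by auto
      moreover have "1 + (complex_of_real s)\<^sup>2 \<noteq> 0"
        by (metis add_nonneg_eq_0_iff of_real_1 of_real_add of_real_eq_0_iff of_real_power zero_le_one zero_le_power2 zero_neq_one)
      ultimately show "(1 / (1 + s\<^sup>2)) *\<^sub>R ((1 + of_real s * w) / (of_real s - w)) = 1 / (of_real s - w) - of_real (s / (1 + s\<^sup>2))"
        unfolding scaleR_conv_of_real of_real_divide of_real_add of_real_power of_real_1
        by (simp add: divide_simps) (simp add: power2_eq_square algebra_simps)
    qed
    finally show "\<phi> w = of_real \<beta> * w + of_real \<gamma> + (LINT s|\<nu>. (1 + of_real s * w) / (of_real s - w))"
      using \<phi>[OF w] by simp
  qed
  then show ?thesis by blast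
qed

text \<open>The exponential determines \<phi> up to a multiple of 2 pi, and continuity along the
  vertical ray prevents this multiple from jumping. Unimodularity of the limit makes the logarithm
  finite and the resulting boundary value real.\<close>

lemma boundary_value_of_exp_limit:
  assumes cont: "continuous_on {z. Im z > 0} \<phi>"
    and lim: "((\<lambda>\<epsilon>. exp (\<i> * \<phi> (Complex y \<epsilon>))) \<longlongrightarrow> \<zeta>) (at_right 0)" and "cmod \<zeta> = 1"
  shows "\<exists>r. has_boundary_value \<phi> y r"
proof -
  obtain \<theta> where \<theta>: "\<zeta> = exp (\<i> * of_real \<theta>)"
    using \<open>cmod \<zeta> = 1\<close> by (metis complex_norm_eq_1_exp)
  \<comment> \<open>Rotating the limit to 1 keeps the exponential off the branch cut of
    \<open>Ln\<close> for small heights.\<close>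
  define p where "p \<epsilon> = \<phi> (Complex y \<epsilon>) - of_real \<theta>" for \<epsilon>
  have "((\<lambda>\<epsilon>. exp (\<i> * \<phi> (Complex y \<epsilon>)) / \<zeta>) \<longlongrightarrow> \<zeta> / \<zeta>) (at_right 0)"
    using \<theta> by (intro tendsto_intros lim) auto
  then have p1: "((\<lambda>\<epsilon>. exp (\<i> * p \<epsilon>)) \<longlongrightarrow> 1) (at_right 0)"
    using \<theta> by (simp add: p_def exp_diff right_diff_distrib)
  then have "eventually (\<lambda>\<epsilon>. dist (exp (\<i> * p \<epsilon>)) 1 < 1) (at_right 0)" by (rule tendstoD) simp
  then obtain \<epsilon>0 where \<epsilon>0: "\<epsilon>0 > 0" "\<And>\<epsilon>. 0 < \<epsilon> \<Longrightarrow> \<epsilon> < \<epsilon>0 \<Longrightarrow> dist (exp (\<i> * p \<epsilon>)) 1 < 1"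
    by (auto simp: eventually_at_right_field)
  have Re: "Re (exp (\<i> * p \<epsilon>)) > 0" if "0 < \<epsilon>" "\<epsilon> < \<epsilon>0" for \<epsilon>
    using \<epsilon>0(2)[OF that] abs_Re_le_cmod[of "exp (\<i> * p \<epsilon>) - 1"] by (simp add: dist_norm)
  define L where "L \<epsilon> = - \<i> * Ln (exp (\<i> * p \<epsilon>))" for \<epsilon>
  have contp: "continuous_on {0<..<\<epsilon>0} p"
    unfolding p_def Complex_eq
    by (intro continuous_intros continuous_on_compose2[OF cont]) auto
  have notneg: "exp (\<i> * p \<epsilon>) \<notin> \<real>\<^sub>\<le>\<^sub>0" if "\<epsilon> \<in> {0<..<\<epsilon>0}" for \<epsilon>
    using Re[of \<epsilon>] that by (auto simp: complex_nonpos_Reals_iff)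
  have contd: "continuous_on {0<..<\<epsilon>0} (\<lambda>\<epsilon>. p \<epsilon> - L \<epsilon>)"
    unfolding L_def using notneg by (intro continuous_intros contp) auto
  have int: "\<exists>n::int. p \<epsilon> - L \<epsilon> = of_int (2 * n) * of_real pi" for \<epsilon>
  proof -
    have "exp (Ln (exp (\<i> * p \<epsilon>))) = exp (\<i> * p \<epsilon>)" by (intro exp_Ln) simp
    then obtain n :: int where "\<i> * p \<epsilon> = Ln (exp (\<i> * p \<epsilon>)) + (of_int (2 * n) * pi) * \<i>"
      using exp_eq[of "\<i> * p \<epsilon>" "Ln (exp (\<i> * p \<epsilon>))"] by auto
    then have "- \<i> * (\<i> * p \<epsilon>) = - \<i> * (Ln (exp (\<i> * p \<epsilon>)) + (of_int (2 * n) * pi) * \<i>)" by simp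
    then have "p \<epsilon> = L \<epsilon> + of_int (2 * n) * of_real pi" by (simp add: L_def algebra_simps)
    then show ?thesis by auto
  qed
  \<comment> \<open>A continuous function on an interval with values in the discrete set 2 pi \<int>
    is constant.\<close>
  have "(\<lambda>\<epsilon>. p \<epsilon> - L \<epsilon>) constant_on {0<..<\<epsilon>0}"
  proof (rule continuous_discrete_range_constant[OF _ contd])
    fix \<epsilon> assume "\<epsilon> \<in> {0<..<\<epsilon>0}"
    have "1 \<le> norm (p \<delta> - L \<delta> - (p \<epsilon> - L \<epsilon>))" if ne: "p \<delta> - L \<delta> \<noteq> p \<epsilon> - L \<epsilon>" for \<delta>
    proof -
      obtain m n :: int where mn: "p \<delta> - L \<delta> = of_int (2 * m) * of_real pi" "p \<epsilon> - L \<epsilon> = of_int (2 * n) * of_real pi"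
        using int by metis
      have "p \<delta> - L \<delta> - (p \<epsilon> - L \<epsilon>) = of_real (2 * of_int (m - n) * pi)" unfolding mn by (simp add: algebra_simps)
      then have "norm (p \<delta> - L \<delta> - (p \<epsilon> - L \<epsilon>)) = \<bar>2 * of_int (m - n) * pi\<bar>"
        by (simp only: norm_of_real)
      also have "\<dots> = 2 * \<bar>of_int (m - n)\<bar> * pi" unfolding abs_mult by simp
      finally have "norm (p \<delta> - L \<delta> - (p \<epsilon> - L \<epsilon>)) = 2 * \<bar>of_int (m - n)\<bar> * pi" .
      moreover have "m \<noteq> n" using ne mn by auto
      then have "\<bar>of_int (m - n) :: real\<bar> \<ge> 1" by linarith
      then have "2 * \<bar>of_int (m - n)\<bar> * pi \<ge> 2 * 1 * 2" using pi_ge_two by (intro mult_mono) auto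
      ultimately show ?thesis by linarith
    qed
    then show "\<exists>e>0. \<forall>\<delta>. \<delta> \<in> {0<..<\<epsilon>0} \<and> p \<delta> - L \<delta> \<noteq> p \<epsilon> - L \<epsilon> \<longrightarrow> e \<le> norm (p \<delta> - L \<delta> - (p \<epsilon> - L \<epsilon>))"
      by (intro exI[of _ 1]) auto
  qed auto
  then obtain c where c: "\<And>\<epsilon>. \<epsilon> \<in> {0<..<\<epsilon>0} \<Longrightarrow> p \<epsilon> - L \<epsilon> = c" by (auto simp: constant_on_def)
  obtain n :: int where n: "c = of_int (2 * n) * of_real pi" using int[of "\<epsilon>0 / 2"] c[of "\<epsilon>0 / 2"] \<epsilon>0 by auto
  have "(L \<longlongrightarrow> - \<i> * Ln 1) (at_right 0)"
    unfolding L_def[abs_def] by (intro tendsto_intros p1) auto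
  then have "((\<lambda>\<epsilon>. of_real \<theta> + c + L \<epsilon>) \<longlongrightarrow> of_real \<theta> + c + - \<i> * Ln 1) (at_right 0)" by (intro tendsto_intros)
  moreover have "eventually (\<lambda>\<epsilon>. of_real \<theta> + c + L \<epsilon> = \<phi> (Complex y \<epsilon>)) (at_right 0)"
  proof -
    have "eventually (\<lambda>\<epsilon>. \<epsilon> \<in> {0<..<\<epsilon>0}) (at_right 0)" by (rule eventually_at_right_real[OF \<epsilon>0(1)])
    then show ?thesis
    proof eventually_elim
      case (elim \<epsilon>)
      have "L \<epsilon> = p \<epsilon> - c" using c[OF elim] by (simp add: algebra_simps)
      then show ?case by (simp add: p_def)
    qed
  qed
  ultimately have "((\<lambda>\<epsilon>. \<phi> (Complex y \<epsilon>)) \<longlongrightarrow> of_real \<theta> + c + - \<i> * Ln 1) (at_right 0)"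
    by (rule Lim_transform_eventually)
  then have "has_boundary_value \<phi> y (\<theta> + 2 * n * pi)"
    unfolding has_boundary_value_def by (simp add: n)
  then show ?thesis by blast
qed

section \<open>Existence of real boundary values almost everywhere\<close>

context singular_nevanlinna
begin

lemma nu_measurable [simp]: "measurable \<nu> M = measurable borel M"
  by (rule measurable_cong_sets[OF sets_nu refl])

lemma kernel_integrable:
  assumes "Im w > 0" shows "integrable \<nu> (\<lambda>s. 1 / (of_real s - w))"
proof -
  interpret finite_measure \<nu> by (rule finite_nu)
  show ?thesis
  proof (rule integrable_const_bound[where B = "1 / Im w"])
    show "AE s in \<nu>. norm (1 / (of_real s - w)) \<le> 1 / Im w"
    proof (intro AE_I2)
      fix s
      have "Im w \<le> cmod (of_real s - w)" using abs_Im_le_cmod[of "of_real s - w"] assms by simp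
      then show "norm (1 / (of_real s - w)) \<le> 1 / Im w" using assms by (auto simp: norm_divide intro!: divide_left_mono mult_pos_pos)
    qed
  qed simp
qed

text \<open>Splits off the part independent of \<open>s\<close>, which the finite measure integrates
  to a multiple of \<open>w\<close>; only a Cauchy transform remains.\<close>

lemma nevanlinna_kernel_eq:
  "Im w > 0 \<Longrightarrow> (1 + of_real s * w) / (of_real s - w) = w + (1 + w\<^sup>2) * (1 / (of_real s - w))"
  by (subgoal_tac "of_real s - w \<noteq> 0") (auto simp: divide_simps power2_eq_square algebra_simps)

lemma nevanlinna_kernel_integrable:
  assumes "Im w > 0" shows "integrable \<nu> (\<lambda>s. (1 + of_real s * w) / (of_real s - w))"
proof -
  interpret finite_measure \<nu> by (rule finite_nu)
  show ?thesis unfolding nevanlinna_kernel_eq[OF assms]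
    by (intro Bochner_Integration.integrable_add integrable_const integrable_mult_right kernel_integrable assms)
qed

lemma phi_holomorphic: "\<phi> holomorphic_on {w. Im w > 0}"
proof -
  interpret finite_measure \<nu> by (rule finite_nu)
  have "(\<lambda>w. LINT s|\<nu>. of_real 1 / (of_real s - w)) holomorphic_on {w. Im w > 0}"
    using kernel_integrable by (intro cauchy_transform_holomorphic sets_nu) auto
  then have "(\<lambda>w. of_real \<beta> * w + of_real \<gamma> + (measure \<nu> (space \<nu>) *\<^sub>R w + (1 + w\<^sup>2) * (LINT s|\<nu>. 1 / (of_real s - w)))) holomorphic_on {w. Im w > 0}"
    unfolding scaleR_conv_of_real by (intro holomorphic_intros) auto
  then show ?thesis
  proof (rule holomorphic_transform)
    fix w assume "w \<in> {w. Im w > 0}"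
    then have w: "Im w > 0" by simp
    show "of_real \<beta> * w + of_real \<gamma> + (measure \<nu> (space \<nu>) *\<^sub>R w + (1 + w\<^sup>2) * (LINT s|\<nu>. 1 / (of_real s - w))) = \<phi> w"
      unfolding phi_eq[OF w] nevanlinna_kernel_eq[OF w]
      by (subst Bochner_Integration.integral_add[OF integrable_const integrable_mult_right[OF kernel_integrable[OF w]]])
        (simp only: integral_mult_right_zero lebesgue_integral_const)
  qed
qed

lemma Im_nevanlinna_kernel:
  assumes "Im w > 0"
  shows "Im ((1 + of_real s * w) / (of_real s - w)) = pi * (1 + s\<^sup>2) * poisson_kernel w s"
proof -
  have D: "(s - Re w)\<^sup>2 + (Im w)\<^sup>2 > 0" using assms by (intro kernel_denominator_pos) simp
  have "Im ((1 + of_real s * w) / (of_real s - w)) = Im w * (1 + s\<^sup>2) / ((s - Re w)\<^sup>2 + (Im w)\<^sup>2)"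
    by (simp add: Im_divide power2_eq_square algebra_simps)
  then show ?thesis by (simp add: poisson_kernel_def)
qed

lemma Im_phi:
  assumes "Im w > 0"
  shows "Im (\<phi> w) = \<beta> * Im w + (LINT s|\<nu>. pi * (1 + s\<^sup>2) * poisson_kernel w s)"
    and "integrable \<nu> (\<lambda>s. pi * (1 + s\<^sup>2) * poisson_kernel w s)"
    and "Im (\<phi> w) > 0"
proof -
  note int = nevanlinna_kernel_integrable[OF assms]
  show 1: "Im (\<phi> w) = \<beta> * Im w + (LINT s|\<nu>. pi * (1 + s\<^sup>2) * poisson_kernel w s)"
    unfolding phi_eq[OF assms] Im_nevanlinna_kernel[OF assms, symmetric] using int by simp
  show "integrable \<nu> (\<lambda>s. pi * (1 + s\<^sup>2) * poisson_kernel w s)"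
    unfolding Im_nevanlinna_kernel[OF assms, symmetric] using int by (rule integrable_Im)
  have "(LINT s|\<nu>. pi * (1 + s\<^sup>2) * poisson_kernel w s) \<ge> 0"
    using poisson_kernel_nonneg[OF assms] by (intro Bochner_Integration.integral_nonneg mult_nonneg_nonneg) auto
  moreover have "\<beta> * Im w > 0" using beta_pos assms by simp
  ultimately show "Im (\<phi> w) > 0" unfolding 1 by linarith
qed

text \<open>By Tonelli the mean is a \<open>\<nu>\<close>-integral of Poisson masses of a compact set disjoint from
  \<open>V\<close>. These vanish in the limit at every point of \<open>V\<close>, so dominated convergence replaces a
  differentiation theorem for measures.\<close>

lemma Im_phi_mean_tendsto_0:
  assumes V: "open V" "N \<subseteq> V"
  shows "(\<lambda>m. \<integral>\<^sup>+y\<in>{-real n..real n} - V. ennreal (Im (\<phi> (Complex y (1 / (real m + 1))))) \<partial>lborel) \<longlonglongrightarrow> 0"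
proof -
  interpret finite_measure \<nu> by (rule finite_nu)
  interpret pair_sigma_finite lborel \<nu> ..
  let ?B = "{-real n..real n} - V"
  have Bm [measurable]: "?B \<in> sets borel" using V by (intro sets.Diff) auto
  define e where "e m = 1 / (real m + 1)" for m :: nat
  have e: "e m > 0" "e m \<le> 1" for m by (auto simp: e_def)
  have e0: "e \<longlonglongrightarrow> 0" unfolding e_def[abs_def] by real_asymp
  define k where "k m y s = pi * (1 + s\<^sup>2) * poisson_kernel (Complex y (e m)) s" for m y s
  have k0: "k m y s \<ge> 0" for m y s unfolding k_def using poisson_kernel_nonneg[of "Complex y (e m)" s] e by simp
  have km [measurable]: "(\<lambda>p. k m (fst p) (snd p)) \<in> borel_measurable (borel \<Otimes>\<^sub>M borel)" for m
    unfolding k_def by measurable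
  have km' [measurable]: "(\<lambda>p. k m (snd p) (fst p)) \<in> borel_measurable (borel \<Otimes>\<^sub>M lborel)" for m
    using measurable_compose[OF measurable_pair_swap' km] by (simp add: case_prod_beta' cong: measurable_cong_sets)
  have Bm' [measurable]: "?B \<in> sets lborel" using Bm by simp
  have kms [measurable]: "(\<lambda>s. k m y s) \<in> borel_measurable borel" for m y unfolding k_def by measurable
  define J where "J m s = (\<integral>\<^sup>+y. ennreal (k m y s) * indicator ?B y \<partial>lborel)" for m s
  have Jm [measurable]: "J m \<in> borel_measurable borel" for m
    unfolding J_def by measurable
  define C where "C = pi * (1 + 2 * (real n)\<^sup>2) + 4 * real n"
  \<comment> \<open>The weight \<open>1 + s\<^sup>2\<close> is unbounded in \<open>s\<close>, but
    s^2 \<le> 2 (s - y)^2 + 2 y^2, and pi (s - y)^2 times the kernel is at most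
    \<open>e m \<le> 1\<close>. The remaining part has bounded weight.\<close>
  have kle: "k m y s \<le> pi * (1 + 2 * (real n)\<^sup>2) * poisson_kernel (Complex s (e m)) y + 2" if "y \<in> ?B" for m y s
  proof -
    have y: "y\<^sup>2 \<le> (real n)\<^sup>2" using that by (intro power2_le_iff_abs_le[THEN iffD2]) auto
    let ?P = "poisson_kernel (Complex y (e m)) s"
    have P: "?P \<ge> 0" using poisson_kernel_nonneg[of "Complex y (e m)" s] e by simp
    have "s\<^sup>2 \<le> 2 * (s - y)\<^sup>2 + 2 * y\<^sup>2"
      using zero_le_power2[of "s - 2 * y"] by (simp add: power2_eq_square algebra_simps)
    then have "1 + s\<^sup>2 \<le> (1 + 2 * (real n)\<^sup>2) + 2 * (s - y)\<^sup>2" using y by linarith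
    then have "k m y s \<le> pi * ((1 + 2 * (real n)\<^sup>2) + 2 * (s - y)\<^sup>2) * ?P"
      unfolding k_def using P by (intro mult_right_mono mult_left_mono) auto
    also have "\<dots> = pi * (1 + 2 * (real n)\<^sup>2) * ?P + 2 * (pi * (s - y)\<^sup>2 * ?P)" by (simp add: algebra_simps)
    also have "pi * (s - y)\<^sup>2 * ?P \<le> 1"
    proof -
      have D: "(s - y)\<^sup>2 + (e m)\<^sup>2 > 0" using e[of m] by (intro add_nonneg_pos) auto
      have "pi * (s - y)\<^sup>2 * ?P = (s - y)\<^sup>2 * e m / ((s - y)\<^sup>2 + (e m)\<^sup>2)" by (simp add: poisson_kernel_def)
      also have "\<dots> \<le> (s - y)\<^sup>2 * 1 / ((s - y)\<^sup>2 + (e m)\<^sup>2)" using e[of m] D by (intro divide_right_mono mult_left_mono) auto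
      also have "\<dots> \<le> 1" using D by (simp add: divide_le_eq_1)
      finally show ?thesis .
    qed
    finally show ?thesis by (simp add: poisson_kernel_swap[of y])
  qed
  have Jle: "J m s \<le> ennreal C" for m s
  proof -
    have P: "poisson_kernel (Complex s (e m)) y \<ge> 0" for y using poisson_kernel_nonneg[of "Complex s (e m)" y] e by simp
    have "J m s \<le> (\<integral>\<^sup>+y. ennreal (pi * (1 + 2 * (real n)\<^sup>2)) * ennreal (poisson_kernel (Complex s (e m)) y) + 2 * indicator {-real n..real n} y \<partial>lborel)"
      unfolding J_def
    proof (intro nn_integral_mono)
      fix y
      show "ennreal (k m y s) * indicator ?B y \<le> ennreal (pi * (1 + 2 * (real n)\<^sup>2)) * ennreal (poisson_kernel (Complex s (e m)) y) + 2 * indicator {-real n..real n} y"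
      proof (cases "y \<in> ?B")
        case True
        have "ennreal (k m y s) \<le> ennreal (pi * (1 + 2 * (real n)\<^sup>2) * poisson_kernel (Complex s (e m)) y + 2)"
          by (intro ennreal_leI kle True)
        also have "\<dots> = ennreal (pi * (1 + 2 * (real n)\<^sup>2)) * ennreal (poisson_kernel (Complex s (e m)) y) + 2"
          using P[of y] by (simp add: ennreal_mult ennreal_plus)
        finally show ?thesis using True by simp
      qed simp
    qed
    also have "\<dots> = ennreal (pi * (1 + 2 * (real n)\<^sup>2)) * (\<integral>\<^sup>+y. ennreal (poisson_kernel (Complex s (e m)) y) \<partial>lborel) + 2 * emeasure lborel {-real n..real n}"
      by (subst nn_integral_add) (auto simp: nn_integral_cmult)
    also have "\<dots> = ennreal C"
    proof -
      have "2 * emeasure lborel {-real n..real n} = ennreal 2 * ennreal (2 * real n)" by simp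
      also have "\<dots> = ennreal (4 * real n)" by (subst ennreal_mult[symmetric]) auto
      finally have "2 * emeasure lborel {-real n..real n} = ennreal (4 * real n)" .
      moreover have "(\<integral>\<^sup>+y. ennreal (poisson_kernel (Complex s (e m)) y) \<partial>lborel) = 1"
        using e[of m] by (intro poisson_kernel_nn_integral) simp
      ultimately show ?thesis by (simp add: C_def flip: ennreal_plus)
    qed
    finally show ?thesis .
  qed
  have J0: "(\<lambda>m. J m s) \<longlonglongrightarrow> 0" if sV: "s \<in> V" for s
  proof -
    obtain d where d: "d > 0" "ball s d \<subseteq> V" using openE[OF V(1) sV] by auto
    define K where "K = (1 + s\<^sup>2) / d\<^sup>2 * (2 * real n)"
    have le: "J m s \<le> ennreal (e m * K)" for m
    proof -
      have "J m s \<le> (\<integral>\<^sup>+y. ennreal (e m * ((1 + s\<^sup>2) / d\<^sup>2)) * indicator {-real n..real n} y \<partial>lborel)"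
        unfolding J_def
      proof (intro nn_integral_mono)
        fix y
        show "ennreal (k m y s) * indicator ?B y \<le> ennreal (e m * ((1 + s\<^sup>2) / d\<^sup>2)) * indicator {-real n..real n} y"
        proof (cases "y \<in> ?B")
          case True
          then have "y \<notin> ball s d" using d by auto
          then have "d\<^sup>2 \<le> (s - y)\<^sup>2" using d(1) by (subst abs_le_square_iff[symmetric]) (auto simp: dist_real_def)
          then have "d\<^sup>2 \<le> (s - y)\<^sup>2 + (e m)\<^sup>2" by (simp add: add_increasing2)
          then have "(1 + s\<^sup>2) * e m / ((s - y)\<^sup>2 + (e m)\<^sup>2) \<le> (1 + s\<^sup>2) * e m / d\<^sup>2"
            using d(1) e[of m] by (intro divide_left_mono mult_pos_pos mult_nonneg_nonneg) (auto intro: add_nonneg_pos)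
          moreover have "k m y s = (1 + s\<^sup>2) * e m / ((s - y)\<^sup>2 + (e m)\<^sup>2)" by (simp add: k_def poisson_kernel_def)
          ultimately show ?thesis using True by (auto intro!: ennreal_leI simp: mult.commute)
        qed simp
      qed
      also have "\<dots> = ennreal (e m * ((1 + s\<^sup>2) / d\<^sup>2)) * ennreal (2 * real n)" by (simp add: nn_integral_cmult)
      also have "\<dots> = ennreal (e m * K)" using e[of m] by (simp add: K_def ac_simps flip: ennreal_mult')
      finally show ?thesis .
    qed
    have "(\<lambda>m. ennreal (e m * K)) \<longlonglongrightarrow> ennreal (0 * K)" by (intro tendsto_intros tendsto_ennrealI e0)
    then have lim: "(\<lambda>m. ennreal (e m * K)) \<longlonglongrightarrow> 0" by simp
    show ?thesis
      by (rule tendsto_sandwich[OF always_eventually always_eventually tendsto_const lim]) (use le in simp_all)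
  qed
  have "(\<lambda>m. \<integral>\<^sup>+s. J m s \<partial>\<nu>) \<longlonglongrightarrow> (\<integral>\<^sup>+s. 0 \<partial>\<nu>)"
  proof (rule nn_integral_dominated_convergence[where w = "\<lambda>s. ennreal C"])
    show "(\<integral>\<^sup>+s. ennreal C \<partial>\<nu>) < \<infinity>"
    proof -
      have "emeasure \<nu> (space \<nu>) < \<top>" using emeasure_finite less_top by blast
      then show ?thesis by (simp add: ennreal_mult_less_top)
    qed
    have "- N \<in> null_sets \<nu>" using N by (intro null_setsI) (auto simp: sets_nu)
    then have "AE s in \<nu>. s \<notin> - N" by (rule AE_not_in)
    then show "AE s in \<nu>. (\<lambda>m. J m s) \<longlonglongrightarrow> 0" by eventually_elim (use J0 V in auto)
  qed (use Jle in auto)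
  then have J: "(\<lambda>m. \<integral>\<^sup>+s. J m s \<partial>\<nu>) \<longlonglongrightarrow> 0" by simp
  \<comment> \<open>The linear term of \<phi> adds \<beta> times the height times the length of the
    bounded set, which also tends to 0.\<close>
  have eq: "(\<integral>\<^sup>+y\<in>?B. ennreal (Im (\<phi> (Complex y (e m)))) \<partial>lborel) = ennreal (\<beta> * e m) * emeasure lborel ?B + (\<integral>\<^sup>+s. J m s \<partial>\<nu>)" for m
  proof -
    have "ennreal (Im (\<phi> (Complex y (e m)))) = ennreal (\<beta> * e m) + (\<integral>\<^sup>+s. ennreal (k m y s) \<partial>\<nu>)" for y
    proof -
      have i: "Im (Complex y (e m)) > 0" using e by simp
      have "(\<integral>\<^sup>+s. ennreal (k m y s) \<partial>\<nu>) = ennreal (LINT s|\<nu>. k m y s)"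
        using Im_phi(2)[OF i] k0 by (intro nn_integral_eq_integral) (auto simp: k_def)
      moreover have "(LINT s|\<nu>. k m y s) \<ge> 0" using k0 by (intro Bochner_Integration.integral_nonneg) auto
      ultimately show ?thesis using Im_phi(1)[OF i] beta_pos e[of m] by (simp add: k_def ennreal_plus)
    qed
    then have "(\<integral>\<^sup>+y\<in>?B. ennreal (Im (\<phi> (Complex y (e m)))) \<partial>lborel)
        = (\<integral>\<^sup>+y. ennreal (\<beta> * e m) * indicator ?B y + (\<integral>\<^sup>+s. ennreal (k m y s) * indicator ?B y \<partial>\<nu>) \<partial>lborel)"
    proof (intro nn_integral_cong)
      fix y
      assume *: "\<And>y. ennreal (Im (\<phi> (Complex y (e m)))) = ennreal (\<beta> * e m) + (\<integral>\<^sup>+s. ennreal (k m y s) \<partial>\<nu>)"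
      have "(\<integral>\<^sup>+s. ennreal (k m y s) * indicator ?B y \<partial>\<nu>) = (\<integral>\<^sup>+s. ennreal (k m y s) \<partial>\<nu>) * indicator ?B y"
        by (rule nn_integral_multc) simp
      then show "ennreal (Im (\<phi> (Complex y (e m)))) * indicator ?B y = ennreal (\<beta> * e m) * indicator ?B y + (\<integral>\<^sup>+s. ennreal (k m y s) * indicator ?B y \<partial>\<nu>)"
        by (simp only: * distrib_right)
    qed
    also have "\<dots> = ennreal (\<beta> * e m) * emeasure lborel ?B + (\<integral>\<^sup>+y. \<integral>\<^sup>+s. ennreal (k m y s) * indicator ?B y \<partial>\<nu> \<partial>lborel)"
    proof (subst nn_integral_add)
      have "(\<lambda>(y, s). ennreal (k m y s) * indicator ?B y) \<in> borel_measurable (lborel \<Otimes>\<^sub>M \<nu>)"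
        unfolding case_prod_beta' measurable_cong_sets[OF sets_pair_measure_cong[OF sets_lborel sets_nu] refl] by measurable
      then show "(\<lambda>y. \<integral>\<^sup>+s. ennreal (k m y s) * indicator ?B y \<partial>\<nu>) \<in> borel_measurable lborel"
        using sigma_finite_measure.borel_measurable_nn_integral_fst[OF finite_measure.axioms(1)[OF finite_nu], of "\<lambda>(y, s). ennreal (k m y s) * indicator ?B y" lborel] by simp
    qed (auto simp: nn_integral_cmult)
    also have "(\<integral>\<^sup>+y. \<integral>\<^sup>+s. ennreal (k m y s) * indicator ?B y \<partial>\<nu> \<partial>lborel) = (\<integral>\<^sup>+s. J m s \<partial>\<nu>)"
      unfolding J_def
    proof (rule Fubini'[symmetric])
      show "(\<lambda>(y, s). ennreal (k m y s) * indicator ?B y) \<in> borel_measurable (lborel \<Otimes>\<^sub>M \<nu>)"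
        unfolding case_prod_beta' measurable_cong_sets[OF sets_pair_measure_cong[OF sets_lborel sets_nu] refl] by measurable
    qed
    finally show ?thesis .
  qed
  define b where "b = measure lborel ?B"
  have "emeasure lborel ?B \<le> emeasure lborel {-real n..real n}" by (intro emeasure_mono) auto
  also have "\<dots> < \<top>" by simp
  finally have b: "emeasure lborel ?B = ennreal b" unfolding b_def by (intro emeasure_eq_ennreal_measure) simp
  have eq': "ennreal (\<beta> * e m) * emeasure lborel ?B = ennreal (\<beta> * e m * b)" for m
    unfolding b using beta_pos e[of m] by (subst ennreal_mult') (auto simp: b_def)
  have "(\<lambda>m. ennreal (\<beta> * e m * b) + (\<integral>\<^sup>+s. J m s \<partial>\<nu>)) \<longlonglongrightarrow> ennreal (\<beta> * 0 * b) + 0"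
    by (intro tendsto_add J tendsto_ennrealI tendsto_mult tendsto_const e0)
  then have "(\<lambda>m. \<integral>\<^sup>+y\<in>?B. ennreal (Im (\<phi> (Complex y (e m)))) \<partial>lborel) \<longlonglongrightarrow> 0"
    unfolding eq eq' by simp
  then show ?thesis unfolding e_def .
qed

lemma exp_phi_holomorphic: "l \<ge> 0 \<Longrightarrow> (\<lambda>w. exp (\<i> * of_real l * \<phi> w)) holomorphic_on {w. Im w > 0}"
  by (intro holomorphic_intros phi_holomorphic)

lemma norm_exp_phi: "cmod (exp (\<i> * of_real l * \<phi> w)) = exp (- (l * Im (\<phi> w)))"
  by simp

lemma norm_exp_phi_le: "l \<ge> 0 \<Longrightarrow> Im w > 0 \<Longrightarrow> cmod (exp (\<i> * of_real l * \<phi> w)) \<le> 1"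
  using Im_phi(3)[of w] by simp

text \<open>The bounded function \<open>exp (\<i> * \<phi>)\<close> has vertical limits \<zeta> by
  the Hardy space result. That \<bar>\<zeta>\<bar> = 1 a.e. is where singularity is used: on bounded
  sets outside a thin neighbourhood of \<open>N\<close>, the integral of 1 - \<bar>\<zeta>\<bar> is
  bounded by a limit of integrals of \<open>Im \<phi>\<close>.\<close>

lemma boundary_value_AE: "AE y in lborel. \<exists>r. has_boundary_value \<phi> y r"
proof -
  define g where "g w = exp (\<i> * of_real 1 * \<phi> w)" for w
  have g: "g holomorphic_on {w. Im w > 0}" "\<And>w. Im w > 0 \<Longrightarrow> cmod (g w) \<le> 1" "\<And>w. cmod (g w) = exp (- Im (\<phi> w))"
    using exp_phi_holomorphic[of 1] norm_exp_phi_le[of 1] norm_exp_phi[of 1] by (simp_all add: g_def[abs_def])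
  \<comment> \<open>A bounded function need not be square integrable on lines. Division by
    \<open>w + \<i>\<close>, which has no zero in the upper half-plane, supplies the majorant
    \<open>1 / (1 + x\<^sup>2)\<close> of integral pi, and multiplying back recovers the
    limit.\<close>
  define F where "F w = g w / (w + \<i>)" for w
  have ne: "w + \<i> \<noteq> 0" if "Im w > 0" for w using that by (auto simp: complex_eq_iff)
  have F: "F holomorphic_on {w. Im w > 0}"
    unfolding F_def using ne by (intro holomorphic_intros g) auto
  have Fle: "cmod (F w) \<le> 1 / cmod (w + \<i>)" if "Im w > 0" for w
    using g(2)[OF that] by (simp add: F_def norm_divide divide_right_mono)
  have F2: "(cmod (F (Complex x \<epsilon>)))\<^sup>2 \<le> 1 / (1 + x\<^sup>2)" if "\<epsilon> > 0" for x \<epsilon>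
  proof -
    have "1 \<le> (\<epsilon> + 1)\<^sup>2" using that by (simp add: one_le_power)
    then have le: "1 + x\<^sup>2 \<le> (cmod (Complex x \<epsilon> + \<i>))\<^sup>2" by (simp add: cmod_power2)
    have "0 < 1 + x\<^sup>2" by (simp add: add_pos_nonneg)
    have "(cmod (F (Complex x \<epsilon>)))\<^sup>2 \<le> (1 / cmod (Complex x \<epsilon> + \<i>))\<^sup>2"
      using that by (intro power_mono Fle) auto
    also have "\<dots> \<le> 1 / (1 + x\<^sup>2)"
      unfolding power_divide one_power2
      by (rule divide_left_mono[OF le _ mult_pos_pos[OF less_le_trans[OF \<open>0 < 1 + x\<^sup>2\<close> le] \<open>0 < 1 + x\<^sup>2\<close>]]) simp
    finally show ?thesis .
  qed
  obtain a b where ab: "L2_fun a" "L2_fun b" "\<And>z. Im z > 0 \<Longrightarrow> F z = Complex (poisson a z) (poisson b z)"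
  proof (rule hardy_boundary_functions[OF F, of pi])
    fix \<eta> :: real assume \<eta>: "\<eta> > 0"
    have "cmod (F z) \<le> 1" if "Im z \<ge> \<eta>" for z
    proof -
      have "1 \<le> cmod (z + \<i>)" using abs_Im_le_cmod[of "z + \<i>"] that \<eta> by simp
      then have "1 / cmod (z + \<i>) \<le> 1 / 1" by (intro frac_le) auto
      moreover have "cmod (F z) \<le> 1 / cmod (z + \<i>)" using that \<eta> by (intro Fle) simp
      ultimately show ?thesis by simp
    qed
    then show "\<exists>B. \<forall>z. Im z \<ge> \<eta> \<longrightarrow> cmod (F z) \<le> B" by blast
    have meas: "(\<lambda>x. F (Complex x \<eta>)) \<in> borel_measurable borel" by (rule holomorphic_line_measurable[OF F \<eta>])
    then show int: "integrable lborel (\<lambda>x. (cmod (F (Complex x \<eta>)))\<^sup>2)"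
    proof (intro Bochner_Integration.integrable_bound[OF integrable_inverse_one_plus_square] AE_I2)
      fix x
      show "norm ((cmod (F (Complex x \<eta>)))\<^sup>2) \<le> norm (1 / (1 + x\<^sup>2))"
        using F2[OF \<eta>, of x] by simp
    qed simp
    have "(LINT x|lborel. (cmod (F (Complex x \<eta>)))\<^sup>2) \<le> (LINT x|lborel. 1 / (1 + x\<^sup>2))"
      by (rule integral_mono[OF int integrable_inverse_one_plus_square F2[OF \<eta>]])
    then show "(LINT x|lborel. (cmod (F (Complex x \<eta>)))\<^sup>2) \<le> pi" unfolding integral_inverse_one_plus_square .
  qed (rule that)
  have [measurable]: "a \<in> borel_measurable borel" "b \<in> borel_measurable borel" using ab by (auto simp: L2_fun_def)
  define \<zeta> where "\<zeta> y = (of_real (a y) + \<i> * of_real (b y)) * (of_real y + \<i>)" for y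
  have [measurable]: "\<zeta> \<in> borel_measurable borel" unfolding \<zeta>_def[abs_def] by measurable
  have lim: "AE y in lborel. ((\<lambda>\<epsilon>. g (Complex y \<epsilon>)) \<longlongrightarrow> \<zeta> y) (at_right 0)"
    using poisson_tendsto_AE[OF L2_fun_poisson_summable[OF ab(1)]] poisson_tendsto_AE[OF L2_fun_poisson_summable[OF ab(2)]]
  proof eventually_elim
    case (elim y)
    have id: "((\<lambda>\<epsilon>::real. \<epsilon>) \<longlongrightarrow> 0) (at_right 0)" by (rule tendsto_ident_at)
    have "((\<lambda>\<epsilon>. (of_real (poisson a (Complex y \<epsilon>)) + \<i> * of_real (poisson b (Complex y \<epsilon>))) * (of_real y + \<i> * of_real \<epsilon> + \<i>))
       \<longlongrightarrow> (of_real (a y) + \<i> * of_real (b y)) * (of_real y + \<i> * of_real 0 + \<i>)) (at_right 0)"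
      using elim by (intro tendsto_intros id)
    then have "((\<lambda>\<epsilon>. (of_real (poisson a (Complex y \<epsilon>)) + \<i> * of_real (poisson b (Complex y \<epsilon>))) * (of_real y + \<i> * of_real \<epsilon> + \<i>))
       \<longlongrightarrow> \<zeta> y) (at_right 0)" by (simp add: \<zeta>_def)
    moreover have "eventually (\<lambda>\<epsilon>. (of_real (poisson a (Complex y \<epsilon>)) + \<i> * of_real (poisson b (Complex y \<epsilon>))) * (of_real y + \<i> * of_real \<epsilon> + \<i>) = g (Complex y \<epsilon>)) (at_right 0)"
      using eventually_at_right_less[of 0]
    proof eventually_elim
      case (elim \<epsilon>)
      then have i: "Im (Complex y \<epsilon>) > 0" by simp
      have "g (Complex y \<epsilon>) = F (Complex y \<epsilon>) * (Complex y \<epsilon> + \<i>)" using ne[OF i] by (simp add: F_def)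
      then show ?case unfolding ab(3)[OF i] by (simp add: Complex_eq)
    qed
    ultimately show ?case by (rule Lim_transform_eventually)
  qed
  define e where "e m = 1 / (real m + 1)" for m :: nat
  have e: "e m > 0" for m by (auto simp: e_def)
  have e0: "filterlim e (at_right 0) sequentially"
    unfolding e_def[abs_def] by real_asymp
  have normlim: "AE y in lborel. (\<lambda>m. cmod (g (Complex y (e m)))) \<longlonglongrightarrow> cmod (\<zeta> y)"
    using lim by eventually_elim (intro tendsto_norm, rule filterlim_compose[OF _ e0])
  have norm_le: "AE y in lborel. cmod (\<zeta> y) \<le> 1"
    using normlim by eventually_elim (rule LIMSEQ_le_const2, auto intro!: g(2) simp: e)
  have gm [measurable]: "(\<lambda>y. g (Complex y (e m))) \<in> borel_measurable borel" for m by (rule holomorphic_line_measurable[OF g(1) e])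
  \<comment> \<open>An open V around the null set \<open>N\<close> has measure below \<delta>.
    Outside V the modulus of \<zeta> is 1 a.e., so the bad set lies in V up to a null set.\<close>
  have null: "emeasure lborel ({y. cmod (\<zeta> y) < 1} \<inter> {-real n..real n}) \<le> ennreal \<delta>" if \<delta>: "\<delta> > 0" for n :: nat and \<delta> :: real
  proof -
    obtain V where V: "open V" "N \<subseteq> V" "emeasure lborel (V - N) < ennreal \<delta>"
      using outer_regular_lborel[OF N(1) \<delta>] by blast
    have Vm [measurable]: "V \<in> sets borel" using V by auto
    let ?B = "{-real n..real n} - V"
    have EV: "emeasure lborel V \<le> ennreal \<delta>"
    proof -
      have "emeasure lborel V = emeasure lborel ((V - N) \<union> N)" using V by (intro arg_cong2[where f = emeasure]) auto
      also have "\<dots> = emeasure lborel (V - N)" using N by (intro emeasure_Un_null_set) auto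
      finally show ?thesis using V by simp
    qed
    have "(\<integral>\<^sup>+y\<in>?B. ennreal (1 - cmod (\<zeta> y)) \<partial>lborel) = (\<integral>\<^sup>+y. liminf (\<lambda>m. ennreal (1 - cmod (g (Complex y (e m)))) * indicator ?B y) \<partial>lborel)"
    proof (intro nn_integral_cong_AE)
      show "AE y in lborel. ennreal (1 - cmod (\<zeta> y)) * indicator ?B y = liminf (\<lambda>m. ennreal (1 - cmod (g (Complex y (e m)))) * indicator ?B y)"
        using normlim
      proof eventually_elim
        case (elim y)
        then have "(\<lambda>m. ennreal (1 - cmod (g (Complex y (e m)))) * indicator ?B y) \<longlonglongrightarrow> ennreal (1 - cmod (\<zeta> y)) * indicator ?B y"
          by (cases "y \<in> ?B") (auto intro!: tendsto_intros)
        then show ?case using lim_imp_Liminf[OF sequentially_bot] by metis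
      qed
    qed
    also have "\<dots> \<le> liminf (\<lambda>m. \<integral>\<^sup>+y\<in>?B. ennreal (1 - cmod (g (Complex y (e m)))) \<partial>lborel)"
      by (intro nn_integral_liminf) measurable
    also have "\<dots> \<le> liminf (\<lambda>m. \<integral>\<^sup>+y\<in>?B. ennreal (Im (\<phi> (Complex y (e m)))) \<partial>lborel)"
    proof (intro Liminf_mono always_eventually allI nn_integral_mono mult_right_mono ennreal_leI)
      fix m y
      \<comment> \<open>This is 1 - exp (-u) \<le> u with u = \<open>Im \<phi>\<close>.\<close>
      show "1 - cmod (g (Complex y (e m))) \<le> Im (\<phi> (Complex y (e m)))"
        using exp_ge_add_one_self[of "- Im (\<phi> (Complex y (e m)))"] unfolding g(3) by linarith
    qed auto
    also have "\<dots> = 0"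
      using Im_phi_mean_tendsto_0[OF V(1,2), of n] unfolding e_def by (intro lim_imp_Liminf) auto
    finally have "(\<integral>\<^sup>+y\<in>?B. ennreal (1 - cmod (\<zeta> y)) \<partial>lborel) = 0" by simp
    then have "AE y in lborel. ennreal (1 - cmod (\<zeta> y)) * indicator ?B y = 0"
      by (subst (asm) nn_integral_0_iff_AE) auto
    then have "AE y in lborel. y \<notin> {y. cmod (\<zeta> y) < 1} \<inter> ?B"
      by eventually_elim (auto simp: ennreal_eq_0_iff indicator_def split: if_splits)
    then have "emeasure lborel {y \<in> space lborel. y \<in> {y. cmod (\<zeta> y) < 1} \<inter> ?B} = 0" by (rule emeasure_eq_0_AE)
    then have "emeasure lborel ({y. cmod (\<zeta> y) < 1} \<inter> ?B) = 0"
      by (simp only: space_lborel space_borel UNIV_I simp_thms Collect_mem_eq)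
    moreover have "emeasure lborel ({y. cmod (\<zeta> y) < 1} \<inter> {-real n..real n}) \<le> emeasure lborel (V \<union> ({y. cmod (\<zeta> y) < 1} \<inter> ?B))"
      by (intro emeasure_mono) auto
    moreover have "\<dots> \<le> emeasure lborel V + emeasure lborel ({y. cmod (\<zeta> y) < 1} \<inter> ?B)" by (intro emeasure_subadditive) auto
    ultimately show ?thesis using EV by (metis add.right_neutral order_trans)
  qed
  have "AE y in lborel. \<forall>n::nat. y \<notin> {y. cmod (\<zeta> y) < 1} \<inter> {-real n..real n}"
    unfolding AE_all_countable
  proof
    fix n :: nat
    have "emeasure lborel ({y. cmod (\<zeta> y) < 1} \<inter> {-real n..real n}) \<le> 0"
      by (rule ennreal_le_epsilon) (use null in auto)
    then show "AE y in lborel. y \<notin> {y. cmod (\<zeta> y) < 1} \<inter> {-real n..real n}"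
      by (intro AE_not_in null_setsI) auto
  qed
  then show ?thesis using lim norm_le
  proof eventually_elim
    case (elim y)
    obtain n :: nat where "\<bar>y\<bar> \<le> real n" using real_arch_simple by blast
    then have "y \<in> {-real n..real n}" by auto
    then have "cmod (\<zeta> y) = 1" using elim(1,3) by force
    moreover have "((\<lambda>\<epsilon>. exp (\<i> * \<phi> (Complex y \<epsilon>))) \<longlongrightarrow> \<zeta> y) (at_right 0)" using elim(2) by (simp add: g_def)
    ultimately show ?case
      using holomorphic_on_imp_continuous_on[OF phi_holomorphic] by (intro boundary_value_of_exp_limit)
  qed
qed

end

section \<open>Push-forward of Lebesgue measure\<close>

text \<open>The formula holds at every positive height, and the bound 1 lets the Poisson kernel
  dominate as the height tends to 0. It is applied to \<open>exp (\<i> * l * z)\<close> and to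
  \<open>exp (\<i> * l * \<phi> z)\<close> with l \<ge> 0.\<close>

lemma poisson_limit_formula:
  fixes g :: "complex \<Rightarrow> complex"
  assumes holo: "g holomorphic_on {z. Im z > 0}" and bdd: "\<And>w. Im w > 0 \<Longrightarrow> cmod (g w) \<le> 1"
    and [measurable]: "G \<in> borel_measurable borel"
    and lim: "AE t in lborel. ((\<lambda>\<epsilon>. g (Complex t \<epsilon>)) \<longlongrightarrow> G t) (at_right 0)" and z: "Im z > 0"
  shows "(LINT t|lborel. of_real (poisson_kernel z t) * G t) = g z"
proof -
  define e where "e m = 1 / (real m + 1)" for m :: nat
  have e: "e m > 0" for m by (auto simp: e_def)
  have e0: "filterlim e (at_right 0) sequentially" unfolding e_def[abs_def] by real_asymp
  have gm [measurable]: "(\<lambda>y. g (Complex y (e m))) \<in> borel_measurable borel" for m by (rule holomorphic_line_measurable[OF holo e])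
  have "(\<lambda>m. LINT t|lborel. of_real (poisson_kernel z t) * g (Complex t (e m))) \<longlonglongrightarrow> (LINT t|lborel. of_real (poisson_kernel z t) * G t)"
  proof (rule integral_dominated_convergence[where w = "poisson_kernel z"])
    show "AE t in lborel. (\<lambda>m. of_real (poisson_kernel z t) * g (Complex t (e m))) \<longlonglongrightarrow> of_real (poisson_kernel z t) * G t"
      using lim by eventually_elim (intro tendsto_mult tendsto_const, rule filterlim_compose[OF _ e0])
    show "AE t in lborel. norm (of_real (poisson_kernel z t) * g (Complex t (e m))) \<le> poisson_kernel z t" for m
    proof (intro AE_I2)
      fix t
      have "poisson_kernel z t * cmod (g (Complex t (e m))) \<le> poisson_kernel z t * 1"
        using e by (intro mult_left_mono bdd poisson_kernel_nonneg z) auto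
      then show "norm (of_real (poisson_kernel z t) * g (Complex t (e m))) \<le> poisson_kernel z t"
        using poisson_kernel_nonneg[OF z] by (simp add: norm_mult)
    qed
  qed (use poisson_kernel_integral[OF z] in auto)
  moreover have "(LINT t|lborel. of_real (poisson_kernel z t) * g (Complex t (e m))) = g (z + \<i> * of_real (e m))" for m
    using poisson_formula_shifted(2)[OF holo e z, of m 1] bdd e[of m] by (meson less_le_trans)
  moreover have "(\<lambda>m. g (z + \<i> * of_real (e m))) \<longlonglongrightarrow> g z"
  proof (rule continuous_on_tendsto_compose[OF holomorphic_on_imp_continuous_on[OF holo]])
    have "e \<longlonglongrightarrow> 0" unfolding e_def[abs_def] by real_asymp
    then have "(\<lambda>m. z + \<i> * of_real (e m)) \<longlonglongrightarrow> z + \<i> * of_real 0" by (intro tendsto_intros)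
    then show "(\<lambda>m. z + \<i> * of_real (e m)) \<longlonglongrightarrow> z" by simp
  qed (use z e in \<open>auto intro!: always_eventually add_pos_pos\<close>)
  ultimately show ?thesis using LIMSEQ_unique by fastforce
qed

text \<open>For \<open>Im z > 0\<close> this is the Cauchy distribution with location
  \<open>Re z\<close> and scale \<open>Im z\<close>.\<close>

definition poisson_measure :: "complex \<Rightarrow> real measure" where
  "poisson_measure z = density lborel (\<lambda>t. ennreal (poisson_kernel z t))"

lemma real_distribution_poisson_measure:
  assumes "Im z > 0" shows "real_distribution (poisson_measure z)"
proof -
  have "prob_space (poisson_measure z)"
    by (rule prob_spaceI) (simp add: poisson_measure_def emeasure_density poisson_kernel_nn_integral[OF assms])
  then show ?thesis
    by (simp add: real_distribution_def real_distribution_axioms_def poisson_measure_def)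
qed

lemma integral_poisson_measure:
  fixes f :: "real \<Rightarrow> 'a::{banach, second_countable_topology}"
  assumes "f \<in> borel_measurable borel" "Im z > 0"
  shows "(LINT t|poisson_measure z. f t) = (LINT t|lborel. poisson_kernel z t *\<^sub>R f t)"
  unfolding poisson_measure_def using assms poisson_kernel_nonneg[OF assms(2)]
  by (intro integral_density) auto

lemma char_uminus: "char M (- t) = cnj (char M t)"
proof -
  have "cnj (char M t) = (CLINT x|M. cnj (iexp (t * x)))"
    unfolding char_def
    by (rule integral_bounded_linear'[OF bounded_linear_cnj bounded_linear_cnj, symmetric]) simp
  also have "\<dots> = char M (- t)" unfolding char_def by (simp add: exp_cnj)
  finally show ?thesis by simp
qed

text \<open>The exponentials are bounded in the upper half-plane only for nonnegative frequencies;
  the negative ones follow by complex conjugation.\<close>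

lemma real_distribution_eqI:
  assumes "real_distribution M1" "real_distribution M2" "\<And>t. t \<ge> 0 \<Longrightarrow> char M1 t = char M2 t"
  shows "M1 = M2"
proof (rule Levy_uniqueness[OF assms(1,2)], rule ext)
  fix t
  show "char M1 t = char M2 t"
    using assms(3)[of t] assms(3)[of "- t"] char_uminus[of M1 "- t"] char_uminus[of M2 "- t"] by (cases "t \<ge> 0") auto
qed

lemma char_poisson_measure:
  assumes "Im z > 0" "l \<ge> 0" shows "char (poisson_measure z) l = exp (\<i> * of_real l * z)"
proof -
  have "(LINT t|lborel. of_real (poisson_kernel z t) * exp (\<i> * of_real l * of_real t)) = exp (\<i> * of_real l * z)"
  proof (rule poisson_limit_formula[where g = "\<lambda>z. exp (\<i> * of_real l * z)"])
    show "AE t in lborel. ((\<lambda>\<epsilon>. exp (\<i> * of_real l * Complex t \<epsilon>)) \<longlongrightarrow> exp (\<i> * of_real l * of_real t)) (at_right 0)"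
    proof (intro AE_I2)
      fix t
      have "((\<lambda>\<epsilon>. exp (\<i> * of_real l * (of_real t + \<i> * of_real \<epsilon>))) \<longlongrightarrow> exp (\<i> * of_real l * (of_real t + \<i> * of_real 0))) (at_right 0)"
        by (intro tendsto_intros)
      then show "((\<lambda>\<epsilon>. exp (\<i> * of_real l * Complex t \<epsilon>)) \<longlongrightarrow> exp (\<i> * of_real l * of_real t)) (at_right 0)"
        by (simp add: Complex_eq)
    qed
  qed (use assms in \<open>auto intro!: holomorphic_intros\<close>)
  then show ?thesis
    unfolding char_def using assms by (subst integral_poisson_measure) (simp_all add: scaleR_conv_of_real mult.assoc)
qed

section \<open>The boundary function and the image of Lebesgue measure under it\<close>

context singular_nevanlinna
begin

text \<open>A sequence of heights makes this a Borel function defined everywhere. It is the boundary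
  value wherever one exists; where the sequence diverges, \<open>lim\<close> supplies an arbitrary
  value.\<close>

definition bv :: "real \<Rightarrow> real" where
  "bv y = lim (\<lambda>m::nat. Re (\<phi> (Complex y (1 / (real m + 1)))))"

lemma bv_measurable [measurable]: "bv \<in> borel_measurable borel"
proof -
  have [measurable]: "(\<lambda>y. \<phi> (Complex y (1 / (real m + 1)))) \<in> borel_measurable borel" for m
    by (rule holomorphic_line_measurable[OF phi_holomorphic]) simp
  show ?thesis unfolding bv_def[abs_def] by measurable
qed

lemma bv_eq: assumes "has_boundary_value \<phi> y r" shows "bv y = r"
proof -
  have e0: "filterlim (\<lambda>m::nat. 1 / (real m + 1)) (at_right 0) sequentially" by real_asymp
  have "(\<lambda>m::nat. Re (\<phi> (Complex y (1 / (real m + 1))))) \<longlonglongrightarrow> Re (of_real r)"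
    by (intro tendsto_Re filterlim_compose[OF _ e0]) (use assms in \<open>simp add: has_boundary_value_def\<close>)
  then show ?thesis unfolding bv_def by (simp add: limI)
qed

lemma has_boundary_value_bv_AE: "AE y in lborel. has_boundary_value \<phi> y (bv y)"
  using boundary_value_AE by eventually_elim (auto simp: bv_eq)

lemma distr_bv_poisson_measure:
  assumes "Im z > 0" shows "distr (poisson_measure z) borel bv = poisson_measure (\<phi> z)"
proof (rule real_distribution_eqI)
  interpret real_distribution "poisson_measure z" using assms by (rule real_distribution_poisson_measure)
  have m: "bv \<in> measurable (poisson_measure z) borel" by (simp add: poisson_measure_def)
  show "real_distribution (distr (poisson_measure z) borel bv)"
    using m by (rule real_distribution_distr)
  show "real_distribution (poisson_measure (\<phi> z))" by (intro real_distribution_poisson_measure Im_phi(3) assms)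
  fix l :: real assume l: "l \<ge> 0"
  have "(LINT t|lborel. of_real (poisson_kernel z t) * exp (\<i> * of_real l * of_real (bv t))) = exp (\<i> * of_real l * \<phi> z)"
  proof (rule poisson_limit_formula[where g = "\<lambda>z. exp (\<i> * of_real l * \<phi> z)"])
    show "AE t in lborel. ((\<lambda>\<epsilon>. exp (\<i> * of_real l * \<phi> (Complex t \<epsilon>))) \<longlongrightarrow> exp (\<i> * of_real l * of_real (bv t))) (at_right 0)"
      using has_boundary_value_bv_AE unfolding has_boundary_value_def by eventually_elim (intro tendsto_intros)
  qed (use assms l in \<open>auto intro!: exp_phi_holomorphic norm_exp_phi_le simp del: norm_exp_eq_Re\<close>)
  then have "char (distr (poisson_measure z) borel bv) l = exp (\<i> * of_real l * \<phi> z)"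
    unfolding char_def using assms m
    by (subst integral_distr) (simp_all add: integral_poisson_measure scaleR_conv_of_real mult.assoc)
  also have "\<dots> = char (poisson_measure (\<phi> z)) l"
    using l by (intro char_poisson_measure[symmetric] Im_phi(3) assms)
  finally show "char (distr (poisson_measure z) borel bv) l = char (poisson_measure (\<phi> z)) l" .
qed

lemma poisson_comp_bv:
  assumes [measurable]: "a \<in> borel_measurable borel" and z: "Im z > 0"
  shows "poisson (\<lambda>t. a (bv t)) z = poisson a (\<phi> z)"
proof -
  have m [measurable]: "bv \<in> measurable (poisson_measure z) borel" by (simp add: poisson_measure_def)
  have "poisson (\<lambda>t. a (bv t)) z = (LINT t|poisson_measure z. a (bv t))"
    by (subst integral_poisson_measure) (auto simp: z poisson_def)
  also have "\<dots> = (LINT s|distr (poisson_measure z) borel bv. a s)" by (intro integral_distr[symmetric]) auto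
  also have "\<dots> = (LINT s|poisson_measure (\<phi> z). a s)" by (simp only: distr_bv_poisson_measure[OF z])
  also have "\<dots> = poisson a (\<phi> z)" by (subst integral_poisson_measure) (auto simp: z Im_phi(3) poisson_def)
  finally show ?thesis .
qed

lemma nn_integral_poisson_kernel_bv:
  assumes [measurable]: "f \<in> borel_measurable borel" and z: "Im z > 0"
  shows "(\<integral>\<^sup>+t. ennreal (poisson_kernel z t) * f (bv t) \<partial>lborel) = (\<integral>\<^sup>+s. ennreal (poisson_kernel (\<phi> z) s) * f s \<partial>lborel)"
proof -
  have m [measurable]: "bv \<in> measurable (poisson_measure z) borel" by (simp add: poisson_measure_def)
  have "(\<integral>\<^sup>+t. ennreal (poisson_kernel z t) * f (bv t) \<partial>lborel) = (\<integral>\<^sup>+t. f (bv t) \<partial>poisson_measure z)"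
    unfolding poisson_measure_def by (subst nn_integral_density) auto
  also have "\<dots> = (\<integral>\<^sup>+s. f s \<partial>distr (poisson_measure z) borel bv)" by (intro nn_integral_distr[symmetric]) auto
  also have "\<dots> = (\<integral>\<^sup>+s. f s \<partial>poisson_measure (\<phi> z))" by (simp only: distr_bv_poisson_measure[OF z])
  also have "\<dots> = (\<integral>\<^sup>+s. ennreal (poisson_kernel (\<phi> z) s) * f s \<partial>lborel)"
    unfolding poisson_measure_def by (subst nn_integral_density) auto
  finally show ?thesis .
qed

text \<open>The linear coefficient is recovered at infinity. Divided by the height n, the kernel is
  bounded by 1 as soon as n \<ge> 1 and tends to 0 pointwise, so the finite measure contributes
  nothing in the limit.\<close>

lemma phi_imaginary_axis_limit:
  "(\<lambda>m. \<phi> (\<i> * of_real (real m + 1)) / of_real (real m + 1)) \<longlonglongrightarrow> \<i> * of_real \<beta>"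
proof -
  interpret finite_measure \<nu> by (rule finite_nu)
  define n where "n m = real m + 1" for m :: nat
  have n1: "n m \<ge> 1" for m by (simp add: n_def)
  have n0: "n m > 0" for m using n1[of m] by linarith
  have inv: "(\<lambda>m. 1 / n m) \<longlonglongrightarrow> 0" unfolding n_def by real_asymp
  define K where "K m s = (1 + of_real s * (\<i> * of_real (n m))) / ((of_real s - \<i> * of_real (n m)) * of_real (n m))" for m s
  have nz: "of_real s - \<i> * of_real (n m) \<noteq> 0" for s m using n0[of m] by (auto simp: complex_eq_iff)
  have Kle: "cmod (K m s) \<le> 1" for m s
  proof -
    have "1 + s\<^sup>2 * (n m)\<^sup>2 \<le> (s\<^sup>2 + (n m)\<^sup>2) * (n m)\<^sup>2"
    proof -
      have "1 \<le> (n m)\<^sup>2 * (n m)\<^sup>2" using n1[of m] by (simp add: one_le_power flip: power_add)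
      then show ?thesis by (simp add: distrib_right)
    qed
    then have "(cmod (1 + of_real s * (\<i> * of_real (n m))))\<^sup>2 \<le> (cmod ((of_real s - \<i> * of_real (n m)) * of_real (n m)))\<^sup>2"
      unfolding norm_mult power_mult_distrib by (simp add: cmod_power2 power_mult_distrib)
    then have "cmod (1 + of_real s * (\<i> * of_real (n m))) \<le> cmod ((of_real s - \<i> * of_real (n m)) * of_real (n m))"
      by (rule power2_le_imp_le) simp
    then show ?thesis using nz[of s m] n0[of m] unfolding K_def norm_divide by (subst divide_le_eq_1_pos) auto
  qed
  have Klim: "(\<lambda>m. K m s) \<longlonglongrightarrow> 0" for s
  proof -
    have "K m s = (of_real (1 / n m) * of_real (1 / n m) + of_real s * \<i> * of_real (1 / n m)) / (of_real s * of_real (1 / n m) - \<i>)" for m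
      using nz[of s m] n0[of m] unfolding K_def by (simp add: divide_simps)
    moreover have "(\<lambda>m. (of_real (1 / n m) * of_real (1 / n m) + of_real s * \<i> * of_real (1 / n m)) / (of_real s * of_real (1 / n m) - \<i>))
       \<longlonglongrightarrow> (of_real 0 * of_real 0 + of_real s * \<i> * of_real 0) / (of_real s * of_real 0 - \<i>)"
      by (intro tendsto_intros tendsto_of_real inv) auto
    ultimately show ?thesis by simp
  qed
  have "(\<lambda>m. LINT s|\<nu>. K m s) \<longlonglongrightarrow> (LINT s|\<nu>. 0)"
  proof (rule integral_dominated_convergence[where w = "\<lambda>_. 1"])
    show "(\<lambda>s. K m s) \<in> borel_measurable \<nu>" for m unfolding K_def by simp
  qed (use Klim Kle in auto)
  then have "(\<lambda>m. \<i> * of_real \<beta> + of_real \<gamma> * of_real (1 / n m) + (LINT s|\<nu>. K m s)) \<longlonglongrightarrow> \<i> * of_real \<beta> + of_real \<gamma> * of_real 0 + (LINT s|\<nu>. 0)"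
    by (intro tendsto_intros tendsto_of_real inv)
  moreover have "\<phi> (\<i> * of_real (n m)) / of_real (n m) = \<i> * of_real \<beta> + of_real \<gamma> * of_real (1 / n m) + (LINT s|\<nu>. K m s)" for m
  proof -
    have "\<phi> (\<i> * of_real (n m)) = of_real \<beta> * (\<i> * of_real (n m)) + of_real \<gamma> + (LINT s|\<nu>. (1 + of_real s * (\<i> * of_real (n m))) / (of_real s - \<i> * of_real (n m)))"
      by (rule phi_eq) (simp add: n0)
    moreover have "(LINT s|\<nu>. (1 + of_real s * (\<i> * of_real (n m))) / (of_real s - \<i> * of_real (n m))) / of_real (n m) = (LINT s|\<nu>. K m s)"
      unfolding K_def by (simp flip: integral_divide_zero add: divide_divide_eq_left)
    ultimately show ?thesis using n0[of m] by (simp add: add_divide_distrib)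
  qed
  ultimately show ?thesis by (simp add: n_def)
qed

text \<open>The image identity at z = \<i> n is multiplied by pi n. On the left the kernel becomes 1
  / (t^2 / n^2 + 1) and increases to 1. On the right, with \<phi>(\<i> n) = n (q + \<i> p), it
  becomes p / ((s / n - q)^2 + p^2) and tends to 1 / \<beta>, since p tends to \<beta> and q to
  0.\<close>

lemma emeasure_bv_vimage_interval:
  assumes "l \<le> u" shows "emeasure lborel (bv -` {l<..<u}) = ennreal ((u - l) / \<beta>)"
proof -
  define n where "n m = real m + 1" for m :: nat
  have n1: "n m \<ge> 1" for m by (simp add: n_def)
  have n0: "n m > 0" for m using n1[of m] by linarith
  define p where "p m = Im (\<phi> (\<i> * of_real (n m))) / n m" for m
  define q where "q m = Re (\<phi> (\<i> * of_real (n m))) / n m" for m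
  have p0: "p m > 0" for m using Im_phi(3)[of "\<i> * of_real (n m)"] n0[of m] by (simp add: p_def)
  have "(\<lambda>m. Im (\<phi> (\<i> * of_real (n m)) / of_real (n m))) \<longlonglongrightarrow> Im (\<i> * of_real \<beta>)" "(\<lambda>m. Re (\<phi> (\<i> * of_real (n m)) / of_real (n m))) \<longlonglongrightarrow> Re (\<i> * of_real \<beta>)"
    unfolding n_def by (intro tendsto_Im tendsto_Re phi_imaginary_axis_limit)+
  then have pq: "p \<longlonglongrightarrow> \<beta>" "q \<longlonglongrightarrow> 0" by (simp_all add: p_def[abs_def] q_def[abs_def])
  let ?I = "\<lambda>x. indicator {l<..<u} x :: ennreal"
  define A where "A m = (\<integral>\<^sup>+t. ennreal (pi * n m * poisson_kernel (\<i> * of_real (n m)) t) * ?I (bv t) \<partial>lborel)" for m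
  have "A \<longlonglongrightarrow> (\<integral>\<^sup>+t. ?I (bv t) \<partial>lborel)"
    unfolding A_def[abs_def]
  proof (rule nn_integral_LIMSEQ)
    have eq: "pi * n m * poisson_kernel (\<i> * of_real (n m)) t = 1 / (t\<^sup>2 * (1 / n m)\<^sup>2 + 1)" for m t
    proof -
      have "pi * n m * poisson_kernel (\<i> * of_real (n m)) t = (n m)\<^sup>2 / (t\<^sup>2 + (n m)\<^sup>2)"
        by (simp add: poisson_kernel_def power2_eq_square)
      also have "\<dots> = 1 / (t\<^sup>2 * (1 / n m)\<^sup>2 + 1)"
        using n0[of m] by (simp add: field_simps add_nonneg_eq_0_iff)
      finally show ?thesis .
    qed
    have mono: "1 / (t\<^sup>2 * (1 / n i)\<^sup>2 + 1) \<le> 1 / (t\<^sup>2 * (1 / n j)\<^sup>2 + 1)" if "i \<le> j" for i j t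
    proof -
      have "1 / n j \<le> 1 / n i" using that n0[of i] n0[of j] by (intro divide_left_mono) (auto simp: n_def)
      then have "(1 / n j)\<^sup>2 \<le> (1 / n i)\<^sup>2" using n0[of j] by (intro power_mono) auto
      then show ?thesis by (intro divide_left_mono add_right_mono mult_left_mono mult_pos_pos) (auto intro!: add_nonneg_pos)
    qed
    show "incseq (\<lambda>m t. ennreal (pi * n m * poisson_kernel (\<i> * of_real (n m)) t) * ?I (bv t))"
      unfolding eq incseq_def le_fun_def by (auto intro!: mult_right_mono ennreal_leI mono)
    show "(\<lambda>m. ennreal (pi * n m * poisson_kernel (\<i> * of_real (n m)) t) * ?I (bv t)) \<longlonglongrightarrow> ?I (bv t)" for t
    proof -
      have "(\<lambda>m. 1 / n m) \<longlonglongrightarrow> 0" unfolding n_def by real_asymp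
      then have "(\<lambda>m. 1 / (t\<^sup>2 * (1 / n m)\<^sup>2 + 1)) \<longlonglongrightarrow> 1 / (t\<^sup>2 * 0\<^sup>2 + 1)" by (intro tendsto_intros) auto
      then have "(\<lambda>m. ennreal (1 / (t\<^sup>2 * (1 / n m)\<^sup>2 + 1))) \<longlonglongrightarrow> 1" using tendsto_ennrealI by fastforce
      then show ?thesis unfolding eq by (cases "bv t \<in> {l<..<u}") auto
    qed
  qed measurable
  also have "(\<integral>\<^sup>+t. ?I (bv t) \<partial>lborel) = emeasure lborel (bv -` {l<..<u})"
  proof -
    have "(\<integral>\<^sup>+t. ?I (bv t) \<partial>lborel) = (\<integral>\<^sup>+t. indicator (bv -` {l<..<u}) t \<partial>lborel)"
      by (intro nn_integral_cong) (auto simp: indicator_def)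
    then show ?thesis using measurable_sets_borel[OF bv_measurable, of "{l<..<u}"] by simp
  qed
  finally have lim1: "A \<longlonglongrightarrow> emeasure lborel (bv -` {l<..<u})" .
  have Aeq: "A m = (\<integral>\<^sup>+s. ennreal (p m / ((s * (1 / n m) - q m)\<^sup>2 + (p m)\<^sup>2)) * ?I s \<partial>lborel)" for m
  proof -
    have i: "Im (\<i> * of_real (n m)) > 0" using n0 by simp
    have "A m = (\<integral>\<^sup>+t. ennreal (pi * n m) * (ennreal (poisson_kernel (\<i> * of_real (n m)) t) * ?I (bv t)) \<partial>lborel)"
      unfolding A_def using n0[of m] poisson_kernel_nonneg[OF i] by (intro nn_integral_cong) (simp add: ennreal_mult mult.assoc)
    also have "\<dots> = ennreal (pi * n m) * (\<integral>\<^sup>+s. ennreal (poisson_kernel (\<phi> (\<i> * of_real (n m))) s) * ?I s \<partial>lborel)"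
      by (subst nn_integral_cmult) (auto simp: nn_integral_poisson_kernel_bv[OF _ i])
    also have "\<dots> = (\<integral>\<^sup>+s. ennreal (pi * n m) * (ennreal (poisson_kernel (\<phi> (\<i> * of_real (n m))) s) * ?I s) \<partial>lborel)"
      by (subst nn_integral_cmult) auto
    also have "\<dots> = (\<integral>\<^sup>+s. ennreal (p m / ((s * (1 / n m) - q m)\<^sup>2 + (p m)\<^sup>2)) * ?I s \<partial>lborel)"
    proof (intro nn_integral_cong)
      fix s
      have Re: "Re (\<phi> (\<i> * of_real (n m))) = n m * q m" and Im: "Im (\<phi> (\<i> * of_real (n m))) = n m * p m"
        using n0[of m] by (simp_all add: p_def q_def)
      have D: "(s - n m * q m)\<^sup>2 + (n m * p m)\<^sup>2 = (n m)\<^sup>2 * ((s * (1 / n m) - q m)\<^sup>2 + (p m)\<^sup>2)"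
        using n0[of m] by (simp add: power2_eq_square field_simps)
      have "pi * n m * poisson_kernel (\<phi> (\<i> * of_real (n m))) s = (n m)\<^sup>2 * p m / ((n m)\<^sup>2 * ((s * (1 / n m) - q m)\<^sup>2 + (p m)\<^sup>2))"
        unfolding poisson_kernel_def Re Im D by (simp add: power2_eq_square)
      also have "\<dots> = p m / ((s * (1 / n m) - q m)\<^sup>2 + (p m)\<^sup>2)" using n0[of m] by (intro mult_divide_mult_cancel_left) simp
      finally show "ennreal (pi * n m) * (ennreal (poisson_kernel (\<phi> (\<i> * of_real (n m))) s) * ?I s) = ennreal (p m / ((s * (1 / n m) - q m)\<^sup>2 + (p m)\<^sup>2)) * ?I s"
        using n0[of m] by (simp add: ennreal_mult'[symmetric] flip: mult.assoc)
    qed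
    finally show ?thesis .
  qed
  \<comment> \<open>The kernel on the right is at most 1 / p, so discarding the first
    \<open>N0\<close> terms gives the constant majorant \<open>2 / \<beta>\<close> on the
    interval.\<close>
  have "eventually (\<lambda>m. p m > \<beta> / 2) sequentially" using pq(1) beta_pos by (intro order_tendstoD) auto
  then obtain N0 where N0: "\<And>m. m \<ge> N0 \<Longrightarrow> p m > \<beta> / 2" by (auto simp: eventually_sequentially)
  have "(\<lambda>m. A (m + N0)) \<longlonglongrightarrow> (\<integral>\<^sup>+s. ennreal (1 / \<beta>) * ?I s \<partial>lborel)"
    unfolding Aeq
  proof (rule nn_integral_dominated_convergence[where w = "\<lambda>s. ennreal (2 / \<beta>) * ?I s"])
    show "(\<integral>\<^sup>+s. ennreal (2 / \<beta>) * ?I s \<partial>lborel) < \<infinity>"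
      using assms by (subst nn_integral_cmult) (auto simp: ennreal_mult_less_top)
    show "AE s in lborel. ennreal (p (m + N0) / ((s * (1 / n (m + N0)) - q (m + N0))\<^sup>2 + (p (m + N0))\<^sup>2)) * ?I s \<le> ennreal (2 / \<beta>) * ?I s" for m
    proof (intro AE_I2 mult_right_mono ennreal_leI)
      fix s
      let ?p = "p (m + N0)"
      have pb: "?p > \<beta> / 2" using N0 by simp
      have "?p / ((s * (1 / n (m + N0)) - q (m + N0))\<^sup>2 + ?p\<^sup>2) \<le> ?p / ?p\<^sup>2"
        using p0[of "m + N0"] by (intro divide_left_mono mult_pos_pos) (auto intro!: add_nonneg_pos)
      also have "\<dots> = 1 / ?p" using p0[of "m + N0"] by (simp add: power2_eq_square)
      also have "\<dots> \<le> 1 / (\<beta> / 2)" using pb beta_pos by (intro divide_left_mono) auto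
      finally show "?p / ((s * (1 / n (m + N0)) - q (m + N0))\<^sup>2 + ?p\<^sup>2) \<le> 2 / \<beta>" by simp
    qed simp
    show "AE s in lborel. (\<lambda>m. ennreal (p (m + N0) / ((s * (1 / n (m + N0)) - q (m + N0))\<^sup>2 + (p (m + N0))\<^sup>2)) * ?I s) \<longlonglongrightarrow> ennreal (1 / \<beta>) * ?I s"
    proof (intro AE_I2)
      fix s
      have inv: "(\<lambda>m. 1 / n m) \<longlonglongrightarrow> 0" unfolding n_def by real_asymp
      have "(\<lambda>m. p m / ((s * (1 / n m) - q m)\<^sup>2 + (p m)\<^sup>2)) \<longlonglongrightarrow> \<beta> / ((s * 0 - 0)\<^sup>2 + \<beta>\<^sup>2)"
        using beta_pos by (intro tendsto_intros pq inv) auto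
      then have "(\<lambda>m. p (m + N0) / ((s * (1 / n (m + N0)) - q (m + N0))\<^sup>2 + (p (m + N0))\<^sup>2)) \<longlonglongrightarrow> 1 / \<beta>"
        using LIMSEQ_ignore_initial_segment[of _ _ N0] beta_pos by (force simp: power2_eq_square)
      then show "(\<lambda>m. ennreal (p (m + N0) / ((s * (1 / n (m + N0)) - q (m + N0))\<^sup>2 + (p (m + N0))\<^sup>2)) * ?I s) \<longlonglongrightarrow> ennreal (1 / \<beta>) * ?I s"
        by (cases "s \<in> {l<..<u}") (auto intro: tendsto_ennrealI)
    qed
  qed measurable
  also have "(\<integral>\<^sup>+s. ennreal (1 / \<beta>) * ?I s \<partial>lborel) = ennreal ((u - l) / \<beta>)"
    using assms beta_pos by (subst nn_integral_cmult) (auto simp flip: ennreal_mult')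
  finally have "A \<longlonglongrightarrow> ennreal ((u - l) / \<beta>)" by (rule LIMSEQ_offset)
  with lim1 show ?thesis by (rule LIMSEQ_unique)
qed

lemma distr_bv: "distr lborel borel bv = density lborel (\<lambda>_. ennreal (1 / \<beta>))"
proof -
  \<comment> \<open>Uniqueness on boxes identifies \<open>lborel\<close> itself, so the image is
    first rescaled by \<beta> and the factor divided out afterwards.\<close>
  have "lborel = density (distr lborel borel bv) (\<lambda>_. ennreal \<beta>)"
  proof (rule lborel_eqI)
    fix l u :: real assume lu: "\<And>b. b \<in> Basis \<Longrightarrow> l \<bullet> b \<le> u \<bullet> b"
    then have "l \<le> u" by simp
    have box: "box l u = {l<..<u}" by simp
    have "emeasure (density (distr lborel borel bv) (\<lambda>_. ennreal \<beta>)) (box l u) = ennreal \<beta> * emeasure lborel (bv -` {l<..<u})"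
      unfolding box by (subst emeasure_density) (auto simp: nn_integral_cmult emeasure_distr)
    also have "\<dots> = ennreal (u - l)"
      using emeasure_bv_vimage_interval[OF \<open>l \<le> u\<close>] beta_pos \<open>l \<le> u\<close> by (simp flip: ennreal_mult')
    finally show "emeasure (density (distr lborel borel bv) (\<lambda>_. ennreal \<beta>)) (box l u) = (\<Prod>b\<in>Basis. (u - l) \<bullet> b)" by simp
  qed simp
  then have "density lborel (\<lambda>_. ennreal (1 / \<beta>)) = density (density (distr lborel borel bv) (\<lambda>_. ennreal \<beta>)) (\<lambda>_. ennreal (1 / \<beta>))" by simp
  also have "\<dots> = density (distr lborel borel bv) (\<lambda>_. ennreal \<beta> * ennreal (1 / \<beta>))" by (rule density_density_eq) auto
  also have "ennreal \<beta> * ennreal (1 / \<beta>) = 1" using beta_pos by (simp flip: ennreal_mult')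
  finally show ?thesis by (simp add: density_1)
qed

lemma nn_integral_bv:
  assumes [measurable]: "f \<in> borel_measurable borel"
  shows "(\<integral>\<^sup>+y. f (bv y) \<partial>lborel) = ennreal (1 / \<beta>) * (\<integral>\<^sup>+s. f s \<partial>lborel)"
proof -
  have "(\<integral>\<^sup>+y. f (bv y) \<partial>lborel) = (\<integral>\<^sup>+s. f s \<partial>distr lborel borel bv)" by (intro nn_integral_distr[symmetric]) auto
  also have "\<dots> = ennreal (1 / \<beta>) * (\<integral>\<^sup>+s. f s \<partial>lborel)"
    unfolding distr_bv by (subst nn_integral_density) (auto simp: nn_integral_cmult)
  finally show ?thesis .
qed

lemma emeasure_bv_vimage:
  assumes [measurable]: "B \<in> sets borel" shows "emeasure lborel (bv -` B) = ennreal (1 / \<beta>) * emeasure lborel B"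
proof -
  have "emeasure lborel (bv -` B) = emeasure (distr lborel borel bv) B" by (subst emeasure_distr) auto
  also have "\<dots> = ennreal (1 / \<beta>) * emeasure lborel B" unfolding distr_bv by (subst emeasure_density) (auto simp: nn_integral_cmult)
  finally show ?thesis .
qed

text \<open>Preimages of null sets are null because the image measure is a multiple of Lebesgue
  measure. This pulls a.e. statements about E and its Hilbert transform back to heights.\<close>

lemma AE_bv:
  assumes "AE s in lborel. P s" shows "AE y in lborel. P (bv y)"
proof -
  obtain Z where Z: "{s \<in> space lborel. \<not> P s} \<subseteq> Z" "Z \<in> sets lborel" "emeasure lborel Z = 0"
    using AE_E[OF assms] by metis
  have "bv -` Z \<in> null_sets lborel"
    using Z measurable_sets_borel[OF bv_measurable, of Z] by (intro null_setsI) (auto simp: emeasure_bv_vimage)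
  then have "AE y in lborel. y \<notin> bv -` Z" by (rule AE_not_in)
  then show ?thesis by eventually_elim (use Z in auto)
qed

lemma L2_fun_comp_bv:
  assumes "L2_fun a" shows "L2_fun (\<lambda>y. a (bv y))"
proof -
  have [measurable]: "a \<in> borel_measurable borel" using assms by (simp add: L2_fun_def)
  have "(\<integral>\<^sup>+s. ennreal ((a s)\<^sup>2) \<partial>lborel) < \<infinity>" using assms by (simp add: L2_fun_def nn_integral_eq_integral)
  then have "(\<integral>\<^sup>+y. ennreal ((a (bv y))\<^sup>2) \<partial>lborel) < \<infinity>"
    using nn_integral_bv[of "\<lambda>s. ennreal ((a s)\<^sup>2)"] by (simp add: ennreal_mult_less_top)
  then show ?thesis by (auto simp: L2_fun_def intro!: integrableI_bounded)
qed

end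

section \<open>Hilbert transforms and conjugate functions\<close>

definition hilbert_kernel :: "real \<Rightarrow> real \<Rightarrow> real \<Rightarrow> real" where
  "hilbert_kernel \<epsilon> x t = indicator {t. \<epsilon> < \<bar>x - t\<bar>} t / (pi * (x - t))"

lemma hilbert_kernel_measurable [measurable]: "hilbert_kernel \<epsilon> x \<in> borel_measurable borel"
  unfolding hilbert_kernel_def[abs_def] by measurable

text \<open>Outside the truncation interval (x - t)^2 + \<epsilon>^2 \<le> 2 (x - t)^2, so the
  square is dominated by a multiple of the Poisson kernel at height \<epsilon>.\<close>

lemma L2_fun_hilbert_kernel: assumes "\<epsilon> > 0" shows "L2_fun (hilbert_kernel \<epsilon> x)"
  unfolding L2_fun_def
proof
  have i: "Im (Complex x \<epsilon>) > 0" using assms by simp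
  show "integrable lborel (\<lambda>t. (hilbert_kernel \<epsilon> x t)\<^sup>2)"
  proof (rule Bochner_Integration.integrable_bound)
    show "integrable lborel (\<lambda>t. 2 / (pi * \<epsilon>) * poisson_kernel (Complex x \<epsilon>) t)"
      using poisson_kernel_integral[OF i] by (intro integrable_mult_right)
    have "(hilbert_kernel \<epsilon> x t)\<^sup>2 \<le> 2 / (pi * \<epsilon>) * poisson_kernel (Complex x \<epsilon>) t" for t
    proof (cases "\<epsilon> < \<bar>x - t\<bar>")
      case True
      then have u: "\<epsilon>\<^sup>2 \<le> (x - t)\<^sup>2" "(x - t)\<^sup>2 > 0" using assms by (auto simp: abs_le_square_iff[symmetric])
      have "(hilbert_kernel \<epsilon> x t)\<^sup>2 = 1 / (pi\<^sup>2 * (x - t)\<^sup>2)"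
        using True by (simp add: hilbert_kernel_def power_divide power_mult_distrib)
      also have "\<dots> = 2 / (pi\<^sup>2 * (2 * (x - t)\<^sup>2))" by simp
      also have "\<dots> \<le> 2 / (pi\<^sup>2 * ((t - x)\<^sup>2 + \<epsilon>\<^sup>2))"
        using u assms by (intro divide_left_mono mult_left_mono mult_pos_pos) (auto simp: power2_commute[of t x] intro: add_pos_nonneg)
      also have "\<dots> = 2 / (pi * \<epsilon>) * poisson_kernel (Complex x \<epsilon>) t"
        using assms by (simp add: poisson_kernel_def power2_eq_square[of pi])
      finally show ?thesis .
    next
      case False
      then show ?thesis using assms poisson_kernel_nonneg[OF i] by (simp add: hilbert_kernel_def)
    qed
    then show "AE t in lborel. norm ((hilbert_kernel \<epsilon> x t)\<^sup>2) \<le> norm (2 / (pi * \<epsilon>) * poisson_kernel (Complex x \<epsilon>) t)"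
      by (intro AE_I2) (simp only: real_norm_def abs_power2, rule order_trans[OF _ abs_ge_self])
  qed simp
qed simp

lemma hilbert_kernel_integrable:
  "L2_fun f \<Longrightarrow> \<epsilon> > 0 \<Longrightarrow> integrable lborel (\<lambda>t. hilbert_kernel \<epsilon> x t * f t)"
  using L2_fun_hilbert_kernel[of \<epsilon> x] by (intro integrable_mult_of_squares) (auto simp: L2_fun_def)

lemma truncated_hilbert_lborel:
  assumes [measurable]: "f \<in> borel_measurable borel"
  shows "truncated_hilbert f \<epsilon> x = (LINT t|lborel. hilbert_kernel \<epsilon> x t * f t)"
proof -
  have "truncated_hilbert f \<epsilon> x = 1 / pi * (LINT t|lebesgue. indicator {t. \<epsilon> < \<bar>x - t\<bar>} t *\<^sub>R (f t / (x - t)))"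
    by (simp add: truncated_hilbert_def set_lebesgue_integral_def)
  also have "\<dots> = 1 / pi * (LINT t|lborel. indicator {t. \<epsilon> < \<bar>x - t\<bar>} t *\<^sub>R (f t / (x - t)))"
    by (subst integral_completion) auto
  also have "\<dots> = (LINT t|lborel. hilbert_kernel \<epsilon> x t * f t)"
    by (subst integral_mult_right_zero[symmetric]) (simp add: hilbert_kernel_def field_simps)
  finally show ?thesis .
qed

lemma set_integrable_hilbert:
  assumes f: "L2_fun f" and "\<epsilon> > 0"
  shows "set_integrable lebesgue {t. \<epsilon> < \<bar>x - t\<bar>} (\<lambda>t. f t / (x - t))"
proof -
  have [measurable]: "f \<in> borel_measurable borel" using f by (simp add: L2_fun_def)
  have "integrable lborel (\<lambda>t. pi * (hilbert_kernel \<epsilon> x t * f t))"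
    by (intro integrable_mult_right hilbert_kernel_integrable assms)
  also have "(\<lambda>t. pi * (hilbert_kernel \<epsilon> x t * f t)) = (\<lambda>t. indicator {t. \<epsilon> < \<bar>x - t\<bar>} t *\<^sub>R (f t / (x - t)))"
    by (simp add: hilbert_kernel_def)
  finally show ?thesis
    unfolding set_integrable_def by (subst integrable_completion) auto
qed

text \<open>With u = x - t: for \<bar>u\<bar> > \<epsilon> the difference is \<epsilon>^2 / (pi u
  (u^2 + \<epsilon>^2)) and one factor \<epsilon> is absorbed by \<bar>u\<bar>; for \<bar>u\<bar>
  \<le> \<epsilon> only the conjugate kernel remains, with \<bar>u\<bar> in place of \<epsilon> in
  the numerator.\<close>

lemma hilbert_minus_conj_kernel_le:
  assumes "\<epsilon> > 0"
  shows "\<bar>hilbert_kernel \<epsilon> x t - conj_kernel (Complex x \<epsilon>) t\<bar> \<le> poisson_kernel (Complex x \<epsilon>) t"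
proof -
  define u where "u = x - t"
  have D: "u\<^sup>2 + \<epsilon>\<^sup>2 > 0" using assms by (simp add: add_nonneg_pos)
  have eqs: "conj_kernel (Complex x \<epsilon>) t = u / (pi * (u\<^sup>2 + \<epsilon>\<^sup>2))" "poisson_kernel (Complex x \<epsilon>) t = \<epsilon> / (pi * (u\<^sup>2 + \<epsilon>\<^sup>2))"
    by (simp_all add: conj_kernel_def poisson_kernel_def u_def power2_commute)
  show ?thesis
  proof (cases "\<epsilon> < \<bar>u\<bar>")
    case True
    then have "u \<noteq> 0" using assms by auto
    have "hilbert_kernel \<epsilon> x t - conj_kernel (Complex x \<epsilon>) t = \<epsilon>\<^sup>2 / (pi * u * (u\<^sup>2 + \<epsilon>\<^sup>2))"
      using True \<open>u \<noteq> 0\<close> D unfolding eqs hilbert_kernel_def by (simp add: u_def[symmetric] divide_simps) (simp add: power2_eq_square algebra_simps)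
    also have "\<bar>\<dots>\<bar> = \<epsilon> * \<epsilon> / (pi * \<bar>u\<bar> * (u\<^sup>2 + \<epsilon>\<^sup>2))"
      using D by (simp add: abs_mult power2_eq_square)
    also have "\<dots> \<le> \<epsilon> * \<bar>u\<bar> / (pi * \<bar>u\<bar> * (u\<^sup>2 + \<epsilon>\<^sup>2))"
      using True assms D by (intro divide_right_mono mult_left_mono) auto
    also have "\<dots> = \<epsilon> / (pi * (u\<^sup>2 + \<epsilon>\<^sup>2))" using \<open>u \<noteq> 0\<close> by simp
    finally show ?thesis unfolding eqs .
  next
    case False
    then have "hilbert_kernel \<epsilon> x t = 0" by (simp add: hilbert_kernel_def u_def)
    then have "\<bar>hilbert_kernel \<epsilon> x t - conj_kernel (Complex x \<epsilon>) t\<bar> = \<bar>u\<bar> / (pi * (u\<^sup>2 + \<epsilon>\<^sup>2))"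
      unfolding eqs using D by (simp add: abs_mult)
    also have "\<dots> \<le> \<epsilon> / (pi * (u\<^sup>2 + \<epsilon>\<^sup>2))" using False D by (intro divide_right_mono) auto
    finally show ?thesis unfolding eqs .
  qed
qed

text \<open>The difference of the two kernels is odd about \<open>x\<close> and bounded by the Poisson kernel.\<close>

lemma truncated_hilbert_minus_conj_poisson_le:
  assumes a: "L2_fun a" and "\<epsilon> > 0"
  shows "\<bar>truncated_hilbert a \<epsilon> x - conj_poisson a (Complex x \<epsilon>)\<bar> \<le> poisson (\<lambda>t. \<bar>a t - a x\<bar>) (Complex x \<epsilon>)"
proof -
  have [measurable]: "a \<in> borel_measurable borel" using a by (simp add: L2_fun_def)
  let ?z = "Complex x \<epsilon>"
  have i: "Im ?z > 0" using assms by simp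
  define K where "K t = hilbert_kernel \<epsilon> x t - conj_kernel ?z t" for t
  have [measurable]: "K \<in> borel_measurable borel" unfolding K_def[abs_def] by measurable
  have Kle: "\<bar>K t\<bar> \<le> poisson_kernel ?z t" for t unfolding K_def by (rule hilbert_minus_conj_kernel_le[OF assms(2)])
  have Kint: "integrable lborel K"
    using Kle by (intro Bochner_Integration.integrable_bound[OF poisson_kernel_integral(1)[OF i]]) (auto intro: order_trans[OF _ abs_ge_self])
  have odd: "K (2 * x - t) = - K t" for t
    by (simp add: K_def hilbert_kernel_def conj_kernel_def indicator_def power2_commute abs_minus_commute minus_divide_left[symmetric] divide_simps) (auto simp: algebra_simps)
  have "(LINT t|lborel. K t) = (LINT t|lborel. K (2 * x + (-1) * t))"
    by (subst lborel_integral_real_affine[of "-1" K "2 * x"]) auto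
  also have "\<dots> = - (LINT t|lborel. K t)" using odd by simp
  finally have K0: "(LINT t|lborel. K t) = 0" by simp
  have Ka: "integrable lborel (\<lambda>t. K t * a t)"
    unfolding K_def left_diff_distrib using hilbert_kernel_integrable[OF assms] conj_kernel_integrable[OF a i]
    by (rule Bochner_Integration.integrable_diff)
  have "truncated_hilbert a \<epsilon> x - conj_poisson a ?z = (LINT t|lborel. K t * a t)"
    unfolding K_def left_diff_distrib conj_poisson_def truncated_hilbert_lborel[OF \<open>a \<in> borel_measurable borel\<close>]
    using hilbert_kernel_integrable[OF assms] conj_kernel_integrable[OF a i]
    by (rule Bochner_Integration.integral_diff[symmetric])
  \<comment> \<open>As \<open>K\<close> has integral 0, the constant \<open>a x\<close> may be
    subtracted, which brings in the Lebesgue point.\<close>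
  also have "\<dots> = (LINT t|lborel. K t * (a t - a x))"
    using Ka Kint K0 by (simp add: right_diff_distrib)
  finally have "\<bar>truncated_hilbert a \<epsilon> x - conj_poisson a ?z\<bar> \<le> (LINT t|lborel. \<bar>K t * (a t - a x)\<bar>)"
    using integral_norm_bound[of lborel "\<lambda>t. K t * (a t - a x)"] by simp
  also have "\<dots> \<le> (LINT t|lborel. poisson_kernel ?z t * \<bar>a t - a x\<bar>)"
  proof (rule integral_mono)
    show "integrable lborel (\<lambda>t. \<bar>K t * (a t - a x)\<bar>)"
      using Bochner_Integration.integrable_diff[OF Ka integrable_mult_left[OF Kint, of "a x"]] by (simp add: right_diff_distrib)
    show "integrable lborel (\<lambda>t. poisson_kernel ?z t * \<bar>a t - a x\<bar>)"
      by (intro poisson_summable_integrable poisson_summable_dist L2_fun_poisson_summable a i)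
    show "\<bar>K t * (a t - a x)\<bar> \<le> poisson_kernel ?z t * \<bar>a t - a x\<bar>" for t
      unfolding abs_mult using Kle by (intro mult_right_mono) auto
  qed
  finally show ?thesis by (simp add: poisson_def)
qed

lemma truncated_hilbert_tendsto_AE:
  assumes a: "L2_fun a" and b: "L2_fun b" and conj: "\<And>z. Im z > 0 \<Longrightarrow> conj_poisson a z = poisson b z"
  shows "AE x in lborel. ((\<lambda>\<epsilon>. truncated_hilbert a \<epsilon> x) \<longlongrightarrow> b x) (at_right 0)"
  using poisson_lebesgue_point_AE[OF L2_fun_poisson_summable[OF a]] poisson_tendsto_AE[OF L2_fun_poisson_summable[OF b]]
proof eventually_elim
  case (elim x)
  have "eventually (\<lambda>\<epsilon>. norm (truncated_hilbert a \<epsilon> x - poisson b (Complex x \<epsilon>)) \<le> poisson (\<lambda>t. \<bar>a t - a x\<bar>) (Complex x \<epsilon>)) (at_right 0)"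
    using eventually_at_right_less[of 0]
  proof eventually_elim
    case (elim \<epsilon>)
    have "Im (Complex x \<epsilon>) > 0" using elim by simp
    from conj[OF this] show ?case using truncated_hilbert_minus_conj_poisson_le[OF a elim, of x] by simp
  qed
  then have "((\<lambda>\<epsilon>. truncated_hilbert a \<epsilon> x - poisson b (Complex x \<epsilon>)) \<longlongrightarrow> 0) (at_right 0)"
    by (rule Lim_null_comparison) (rule elim)
  from tendsto_add[OF this elim(2)] show ?case by simp
qed

text \<open>For \<open>L2_fun f\<close> and \<open>Im z > 0\<close> this is the Cauchy transform of
  \<open>f\<close> divided by pi \<i>, hence holomorphic in the upper half-plane.\<close>

definition cauchy_poisson :: "(real \<Rightarrow> real) \<Rightarrow> complex \<Rightarrow> complex" where
  "cauchy_poisson f z = Complex (poisson f z) (conj_poisson f z)"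

lemma cauchy_kernel_eq:
  assumes "Im z > 0"
  shows "of_real r / (of_real t - z) = of_real pi * \<i> * Complex (poisson_kernel z t * r) (conj_kernel z t * r)"
proof -
  define D where "D = (t - Re z)\<^sup>2 + (Im z)\<^sup>2"
  have k: "poisson_kernel z t = Im z / D / pi" "conj_kernel z t = (Re z - t) / D / pi"
    by (simp_all add: poisson_kernel_def conj_kernel_def D_def mult.commute)
  have "Re (of_real r / (of_real t - z)) = r * (t - Re z) / D" "Im (of_real r / (of_real t - z)) = r * Im z / D"
    by (simp_all add: Re_divide Im_divide D_def)
  then show ?thesis
    unfolding k complex_eq_iff by (simp add: minus_divide_left algebra_simps diff_divide_distrib)
qed

lemma cauchy_transform_integral:
  assumes f: "L2_fun f" and z: "Im z > 0"
  shows "integrable lborel (\<lambda>t. of_real (f t) / (of_real t - z))"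
    and "(LINT t|lborel. of_real (f t) / (of_real t - z)) = of_real pi * \<i> * cauchy_poisson f z"
proof -
  have 1: "integrable lborel (\<lambda>t. poisson_kernel z t * f t)" by (intro poisson_summable_integrable L2_fun_poisson_summable f z)
  have 2: "integrable lborel (\<lambda>t. conj_kernel z t * f t)" by (rule conj_kernel_integrable[OF f z])
  have eq: "of_real (f t) / (of_real t - z) = of_real pi * \<i> * (of_real (poisson_kernel z t * f t) + \<i> * of_real (conj_kernel z t * f t))" for t
    unfolding cauchy_kernel_eq[OF z] by (simp only: Complex_eq)
  have 3: "integrable lborel (\<lambda>t. of_real (poisson_kernel z t * f t) :: complex)" "integrable lborel (\<lambda>t. \<i> * of_real (conj_kernel z t * f t))"
    by (intro integrable_of_real 1) (intro integrable_mult_right integrable_of_real 2)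
  show "integrable lborel (\<lambda>t. of_real (f t) / (of_real t - z))"
    unfolding eq by (intro integrable_mult_right Bochner_Integration.integrable_add 3)
  show "(LINT t|lborel. of_real (f t) / (of_real t - z)) = of_real pi * \<i> * cauchy_poisson f z"
    unfolding eq integral_mult_right_zero Bochner_Integration.integral_add[OF 3] integral_complex_of_real
    by (simp only: cauchy_poisson_def Complex_eq poisson_def conj_poisson_def)
qed

lemma cauchy_poisson_holomorphic:
  assumes "L2_fun f" shows "cauchy_poisson f holomorphic_on {z. Im z > 0}"
proof -
  have "(\<lambda>z. LINT t|lborel. of_real (f t) / (of_real t - z)) holomorphic_on {z. Im z > 0}"
    by (rule cauchy_transform_holomorphic) (auto simp: cauchy_transform_integral[OF assms])
  then have "(\<lambda>z. (LINT t|lborel. of_real (f t) / (of_real t - z)) / (of_real pi * \<i>)) holomorphic_on {z. Im z > 0}"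
    by (intro holomorphic_intros) auto
  then show ?thesis
    by (rule holomorphic_transform) (simp add: cauchy_transform_integral[OF assms])
qed

text \<open>Otherwise the image would be open, but the imaginary axis contains no nonempty open
  set.\<close>

lemma holomorphic_Re_zero_constant:
  assumes "f holomorphic_on S" "open S" "connected S" "\<And>z. z \<in> S \<Longrightarrow> Re (f z) = 0"
  shows "f constant_on S"
proof (rule ccontr)
  assume "\<not> f constant_on S"
  then have "open (f ` S)" using open_mapping_thm[OF assms(1,2,3,2)] by simp
  moreover have "S \<noteq> {}" using \<open>\<not> f constant_on S\<close> by (auto simp: constant_on_def)
  ultimately obtain w e where w: "w \<in> f ` S" "e > 0" "ball w e \<subseteq> f ` S" by (metis ex_in_conv imageI openE)
  have "w + of_real (e / 2) \<in> ball w e" using w(2) by (simp add: dist_norm)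
  then have "Re (w + of_real (e / 2)) = 0" using w assms(4) by (metis imageE subsetD)
  moreover have "Re w = 0" using w assms(4) by auto
  ultimately show False using w(2) by simp
qed

lemma poisson_imaginary_axis_tendsto_0:
  assumes f: "L2_fun f" shows "(\<lambda>m. poisson f (Complex 0 (real m + 1))) \<longlonglongrightarrow> 0"
proof -
  let ?I = "LINT t|lborel. (f t)\<^sup>2"
  have le: "(poisson f (Complex 0 (real m + 1)))\<^sup>2 \<le> 1 / (pi * (real m + 1)) * ?I" for m
  proof -
    have "Im (Complex 0 (real m + 1)) > 0" by simp
    from order_trans[OF poisson_square_le(1,2)[OF f this]] show ?thesis by simp
  qed
  have "(\<lambda>m. 1 / (pi * (real m + 1))) \<longlonglongrightarrow> 0" by real_asymp
  then have "(\<lambda>m. 1 / (pi * (real m + 1)) * ?I) \<longlonglongrightarrow> 0 * ?I" by (intro tendsto_intros)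
  then have "(\<lambda>m. 1 / (pi * (real m + 1)) * ?I) \<longlonglongrightarrow> 0" by simp
  then have "(\<lambda>m. (poisson f (Complex 0 (real m + 1)))\<^sup>2) \<longlonglongrightarrow> 0"
    by (rule tendsto_sandwich[OF always_eventually always_eventually tendsto_const, rotated 2]) (use le in simp_all)
  then show ?thesis using tendsto_real_sqrt[of "\<lambda>m. (poisson f (Complex 0 (real m + 1)))\<^sup>2" 0 sequentially] by (simp add: tendsto_rabs_zero_iff)
qed

text \<open>On the imaginary axis the size of the conjugate kernel decreases with the height, so
  height 1 provides the majorant. Together with the decay of \<open>poisson\<close> this fixes the
  additive constant of a harmonic conjugate.\<close>

lemma conj_poisson_imaginary_axis_tendsto_0:
  assumes f: "L2_fun f" shows "(\<lambda>m. conj_poisson f (Complex 0 (real m + 1))) \<longlonglongrightarrow> 0"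
proof -
  have [measurable]: "f \<in> borel_measurable borel" using f by (simp add: L2_fun_def)
  have ck: "conj_kernel (Complex 0 (real m + 1)) t = - t / (pi * (t\<^sup>2 + (real m + 1)\<^sup>2))" for m t by (simp add: conj_kernel_def)
  have "(\<lambda>m. LINT t|lborel. conj_kernel (Complex 0 (real m + 1)) t * f t) \<longlonglongrightarrow> (LINT t|(lborel :: real measure). 0)"
  proof (rule integral_dominated_convergence[where w = "\<lambda>t. norm (conj_kernel (Complex 0 1) t * f t)"])
    show "integrable lborel (\<lambda>t. norm (conj_kernel (Complex 0 1) t * f t))"
      by (intro integrable_norm conj_kernel_integrable f) simp
    show "AE t in lborel. (\<lambda>m. conj_kernel (Complex 0 (real m + 1)) t * f t) \<longlonglongrightarrow> 0"
    proof (intro AE_I2)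
      fix t
      have "(\<lambda>m. - t / (pi * (t\<^sup>2 + (real m + 1)\<^sup>2))) \<longlonglongrightarrow> 0" by real_asymp
      then have "(\<lambda>m. - t / (pi * (t\<^sup>2 + (real m + 1)\<^sup>2)) * f t) \<longlonglongrightarrow> 0 * f t" by (intro tendsto_intros)
      then show "(\<lambda>m. conj_kernel (Complex 0 (real m + 1)) t * f t) \<longlonglongrightarrow> 0" unfolding ck by simp
    qed
    show "AE t in lborel. norm (conj_kernel (Complex 0 (real m + 1)) t * f t) \<le> norm (conj_kernel (Complex 0 1) t * f t)" for m
    proof (intro AE_I2)
      fix t :: real
      have "1 \<le> (real m + 1)\<^sup>2" by (simp add: one_le_power)
      then have "\<bar>t\<bar> / (pi * (t\<^sup>2 + (real m + 1)\<^sup>2)) \<le> \<bar>t\<bar> / (pi * (t\<^sup>2 + 1))"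
        by (intro divide_left_mono mult_left_mono mult_pos_pos) (auto intro!: add_nonneg_pos)
      then have "\<bar>conj_kernel (Complex 0 (real m + 1)) t\<bar> \<le> \<bar>conj_kernel (Complex 0 1) t\<bar>"
        by (simp add: conj_kernel_def abs_divide abs_mult)
      then show "norm (conj_kernel (Complex 0 (real m + 1)) t * f t) \<le> norm (conj_kernel (Complex 0 1) t * f t)"
        by (simp add: abs_mult mult_right_mono)
    qed
  qed measurable
  then show ?thesis by (simp add: conj_poisson_def)
qed

text \<open>The given holomorphic function and \<open>cauchy_poisson a\<close> have the same real
  part, so they differ by an imaginary constant, which is 0 by decay along the imaginary
  axis.\<close>

lemma conj_poisson_eq_poisson:
  assumes a: "L2_fun a" and b: "L2_fun b"
    and holo: "(\<lambda>z. Complex (poisson a z) (poisson b z)) holomorphic_on {z. Im z > 0}" and z: "Im z > 0"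
  shows "conj_poisson a z = poisson b z"
proof -
  let ?D = "\<lambda>z. Complex (poisson a z) (poisson b z) - cauchy_poisson a z"
  have "?D constant_on {z. Im z > 0}"
    by (intro holomorphic_Re_zero_constant holomorphic_intros holo cauchy_poisson_holomorphic a
          open_halfspace_Im_gt convex_connected convex_halfspace_Im_gt) (simp add: cauchy_poisson_def)
  then obtain c where c: "\<And>z. Im z > 0 \<Longrightarrow> ?D z = c" by (auto simp: constant_on_def)
  have Im: "poisson b z - conj_poisson a z = Im c" if "Im z > 0" for z
    using arg_cong[OF c[OF that], of Im] by (simp add: cauchy_poisson_def)
  have "(\<lambda>m. poisson b (Complex 0 (real m + 1)) - conj_poisson a (Complex 0 (real m + 1))) \<longlonglongrightarrow> 0 - 0"
    by (intro tendsto_diff poisson_imaginary_axis_tendsto_0 conj_poisson_imaginary_axis_tendsto_0 a b)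
  then have "(\<lambda>m. Im c) \<longlonglongrightarrow> 0" by (simp add: Im)
  then have "Im c = 0" by (simp add: LIMSEQ_const_iff)
  then show ?thesis using Im[OF z] by simp
qed

section \<open>Square integrals along horizontal lines and existence of the conjugate
  function\<close>

lemma poisson_line_square:
  assumes f: "L2_fun f" and e: "e > 0"
  shows "integrable lborel (\<lambda>x. (poisson f (Complex x e))\<^sup>2)"
    and "(LINT x|lborel. (poisson f (Complex x e))\<^sup>2) \<le> (LINT x|lborel. (f x)\<^sup>2)"
proof -
  have m: "(\<lambda>x. poisson f (Complex x e)) \<in> borel_measurable borel"
  proof -
    have "(\<lambda>x. Re (cauchy_poisson f (Complex x e))) \<in> borel_measurable borel"
      using holomorphic_line_measurable[OF cauchy_poisson_holomorphic[OF f] e] by measurable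
    then show ?thesis by (simp add: cauchy_poisson_def)
  qed
  have "(\<integral>\<^sup>+x. ennreal ((poisson f (Complex x e))\<^sup>2) \<partial>lborel) \<le> (\<integral>\<^sup>+x. ennreal ((f x)\<^sup>2) \<partial>lborel)"
    by (rule poisson_square_nn_integral_le[OF f e])
  also have "\<dots> < \<infinity>" using f by (simp add: L2_fun_def nn_integral_eq_integral)
  finally show i: "integrable lborel (\<lambda>x. (poisson f (Complex x e))\<^sup>2)"
    using m by (intro integrableI_bounded) auto
  show "(LINT x|lborel. (poisson f (Complex x e))\<^sup>2) \<le> (LINT x|lborel. (f x)\<^sup>2)"
    by (rule poisson_square_integral_le[OF f e i])
qed

lemma conj_poisson_line_measurable:
  assumes f: "L2_fun f" and e: "e > 0"
  shows "(\<lambda>x. conj_poisson f (Complex x e)) \<in> borel_measurable borel"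
proof -
  have "(\<lambda>x. Im (cauchy_poisson f (Complex x e))) \<in> borel_measurable borel"
    using holomorphic_line_measurable[OF cauchy_poisson_holomorphic[OF f] e] by measurable
  then show ?thesis by (simp add: cauchy_poisson_def)
qed

text \<open>For compactly supported \<open>f\<close> the square of the Cauchy transform decays quadratically, so
  its integral along a horizontal line vanishes; the real part of this says
  \<open>\<parallel>P\<^sub>\<epsilon> f\<parallel> = \<parallel>Q\<^sub>\<epsilon> f\<parallel>\<close>.\<close>

lemma conj_poisson_line_square_bounded_support:
  assumes f: "L2_fun f" and e: "e > 0" and supp: "\<And>t. \<bar>t\<bar> > R \<Longrightarrow> f t = 0" and "R > 0"
  shows "integrable lborel (\<lambda>x. (conj_poisson f (Complex x e))\<^sup>2)"
    and "(LINT x|lborel. (conj_poisson f (Complex x e))\<^sup>2) \<le> (LINT x|lborel. (f x)\<^sup>2)"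
proof -
  have [measurable]: "f \<in> borel_measurable borel" using f by (simp add: L2_fun_def)
  have fint: "integrable lborel f"
  proof -
    have ind: "integrable lborel (\<lambda>t. (indicator {-R..R} t :: real)\<^sup>2)"
    proof -
      have "(\<lambda>t. (indicator {-R..R} t :: real)\<^sup>2) = indicator {-R..R}" by (auto simp: indicator_def)
      moreover have "integrable lborel (indicator {-R..R} :: real \<Rightarrow> real)" using \<open>R > 0\<close> by (intro integrable_real_indicator) auto
      ultimately show ?thesis by (simp only:)
    qed
    have f2: "integrable lborel (\<lambda>t. (f t)\<^sup>2)" using f by (simp add: L2_fun_def)
    have "integrable lborel (\<lambda>t. indicator {-R..R} t * f t)"
      by (rule integrable_mult_of_squares[OF _ _ ind f2]) measurable
    moreover have "indicator {-R..R} t * f t = f t" for t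
      using supp[of t] by (cases "\<bar>t\<bar> > R") (auto simp: indicator_def)
    ultimately show ?thesis by (simp only:)
  qed
  define I where "I = (LINT t|lborel. \<bar>f t\<bar>)"
  define h where "h w = (cauchy_poisson f (w + \<i> * of_real e))\<^sup>2" for w
  let ?U = "{w. Im w > - e}"
  have hU: "h holomorphic_on ?U"
  proof -
    have "(\<lambda>w. w + \<i> * of_real e) holomorphic_on ?U" by (intro holomorphic_intros)
    from holomorphic_on_compose_gen[OF this cauchy_poisson_holomorphic[OF f]]
    have "(\<lambda>w. cauchy_poisson f (w + \<i> * of_real e)) holomorphic_on ?U" by (force simp: o_def)
    then show ?thesis unfolding h_def by (rule holomorphic_on_power)
  qed
  \<comment> \<open>For \<open>cmod w \<ge> 2 * R\<close> every point of the support has distance at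
    least \<open>cmod w / 2\<close> from \<open>w + \<i> * e\<close>, so the transform is bounded by
    the L1 norm of \<open>f\<close> times 2 / (pi \<bar>w\<bar>).\<close>
  have decay: "cmod (h w) \<le> (2 * I / pi)\<^sup>2 / (cmod w)\<^sup>2" if w: "Im w \<ge> 0" "cmod w \<ge> 2 * R" for w
  proof -
    let ?z = "w + \<i> * of_real e"
    have z: "Im ?z > 0" using w e by simp
    have w0: "cmod w > 0" using w \<open>R > 0\<close> by linarith
    have "(cmod w)\<^sup>2 \<le> (cmod ?z)\<^sup>2" using w e by (simp add: cmod_power2 power_mono)
    then have zw: "cmod w \<le> cmod ?z" by (rule power2_le_imp_le) simp
    have le: "cmod (of_real (f t) / (of_real t - ?z)) \<le> \<bar>f t\<bar> * (2 / cmod w)" for t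
    proof (cases "\<bar>t\<bar> > R")
      case False
      have "cmod w / 2 \<le> cmod (of_real t - ?z)"
        using norm_triangle_ineq2[of ?z "of_real t"] zw w False by (simp add: norm_minus_commute)
      then have "\<bar>f t\<bar> / cmod (of_real t - ?z) \<le> \<bar>f t\<bar> / (cmod w / 2)"
        using w0 by (intro divide_left_mono mult_pos_pos) auto
      then show ?thesis by (simp add: norm_divide)
    qed (simp add: supp)
    have "pi * cmod (cauchy_poisson f ?z) = cmod (LINT t|lborel. of_real (f t) / (of_real t - ?z))"
      by (simp add: cauchy_transform_integral[OF f z] norm_mult)
    also have "\<dots> \<le> (LINT t|lborel. cmod (of_real (f t) / (of_real t - ?z)))" by (rule integral_norm_bound)
    also have "\<dots> \<le> (LINT t|lborel. \<bar>f t\<bar> * (2 / cmod w))"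
      by (intro integral_mono integrable_norm cauchy_transform_integral[OF f z] integrable_mult_left integrable_abs fint le)
    also have "\<dots> = I * (2 / cmod w)" unfolding I_def by simp
    finally have "cmod (cauchy_poisson f ?z) \<le> 2 * I / pi / cmod w"
      using w0 by (simp add: field_simps)
    then have "(cmod (cauchy_poisson f ?z))\<^sup>2 \<le> (2 * I / pi / cmod w)\<^sup>2" by (intro power_mono) auto
    then show ?thesis by (simp add: h_def norm_power power_divide power_mult_distrib)
  qed
  have U: "open ?U" "convex ?U" "{z. Im z \<ge> 0} \<subseteq> ?U"
    using e by (auto simp: open_halfspace_Im_gt convex_halfspace_Im_gt)
  note h = integrable_and_integral_real_line_zero[OF U hU decay]
  have Re: "Re (h (of_real x)) = (poisson f (Complex x e))\<^sup>2 - (conj_poisson f (Complex x e))\<^sup>2" for x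
    by (simp add: h_def cauchy_poisson_def power2_eq_square flip: Complex_eq)
  have "integrable lborel (\<lambda>x. Re (h (of_real x)))" "(LINT x|lborel. Re (h (of_real x))) = 0"
  proof -
    show "integrable lborel (\<lambda>x. Re (h (of_real x)))" by (rule integrable_Re[OF h(1)])
    show "(LINT x|lborel. Re (h (of_real x))) = 0" using integral_Re[OF h(1)] h(2) by simp
  qed
  then have d: "integrable lborel (\<lambda>x. (poisson f (Complex x e))\<^sup>2 - (conj_poisson f (Complex x e))\<^sup>2)"
    "(LINT x|lborel. (poisson f (Complex x e))\<^sup>2 - (conj_poisson f (Complex x e))\<^sup>2) = 0" unfolding Re by auto
  note p = poisson_line_square[OF f e]
  show q: "integrable lborel (\<lambda>x. (conj_poisson f (Complex x e))\<^sup>2)"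
    using Bochner_Integration.integrable_diff[OF p(1) d(1)] by simp
  show "(LINT x|lborel. (conj_poisson f (Complex x e))\<^sup>2) \<le> (LINT x|lborel. (f x)\<^sup>2)"
    using d(2) p q by simp
qed

text \<open>Truncations of \<open>f\<close> to growing intervals have bounded support and no larger
  norm; their conjugate integrals converge pointwise, and Fatou carries the bound to the
  limit.\<close>

lemma conj_poisson_line_square:
  assumes f: "L2_fun f" and e: "e > 0"
  shows "integrable lborel (\<lambda>x. (conj_poisson f (Complex x e))\<^sup>2)"
    and "(LINT x|lborel. (conj_poisson f (Complex x e))\<^sup>2) \<le> (LINT x|lborel. (f x)\<^sup>2)"
proof -
  have [measurable]: "f \<in> borel_measurable borel" using f by (simp add: L2_fun_def)
  define F where "F m t = f t * indicator {-(real m + 1)..real m + 1} t" for m t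
  have Fm [measurable]: "F m \<in> borel_measurable borel" for m unfolding F_def[abs_def] by measurable
  have Fle: "\<bar>F m t\<bar> \<le> \<bar>f t\<bar>" for m t by (auto simp: F_def indicator_def)
  have F2: "(F m t)\<^sup>2 \<le> (f t)\<^sup>2" for m t using Fle by (simp add: abs_le_square_iff)
  have FL2: "L2_fun (F m)" for m
    unfolding L2_fun_def
  proof
    show "integrable lborel (\<lambda>t. (F m t)\<^sup>2)"
    proof (rule Bochner_Integration.integrable_bound)
      show "integrable lborel (\<lambda>t. (f t)\<^sup>2)" using f by (simp add: L2_fun_def)
      show "AE t in lborel. norm ((F m t)\<^sup>2) \<le> norm ((f t)\<^sup>2)" using F2 by (intro AE_I2) (simp only: real_norm_def abs_power2)
    qed measurable
  qed simp
  let ?M = "LINT x|lborel. (f x)\<^sup>2"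
  have Fint: "(LINT x|lborel. (F m x)\<^sup>2) \<le> ?M" for m
    using FL2[of m] f F2 by (intro integral_mono) (auto simp: L2_fun_def)
  have lim: "(\<lambda>m. conj_poisson (F m) (Complex x e)) \<longlonglongrightarrow> conj_poisson f (Complex x e)" for x
    unfolding conj_poisson_def
  proof (rule integral_dominated_convergence[where w = "\<lambda>t. norm (conj_kernel (Complex x e) t * f t)"])
    show "integrable lborel (\<lambda>t. norm (conj_kernel (Complex x e) t * f t))"
      using e by (intro integrable_norm conj_kernel_integrable f) simp
    show "AE t in lborel. (\<lambda>m. conj_kernel (Complex x e) t * F m t) \<longlonglongrightarrow> conj_kernel (Complex x e) t * f t"
    proof (intro AE_I2 tendsto_mult tendsto_const)
      fix t :: real
      obtain N :: nat where N: "\<bar>t\<bar> \<le> real N" using real_arch_simple by blast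
      have "eventually (\<lambda>m. F m t = f t) sequentially"
        using eventually_ge_at_top[of N] by eventually_elim (use N in \<open>auto simp: F_def indicator_def\<close>)
      then show "(\<lambda>m. F m t) \<longlonglongrightarrow> f t" by (rule tendsto_eventually)
    qed
    show "AE t in lborel. norm (conj_kernel (Complex x e) t * F m t) \<le> norm (conj_kernel (Complex x e) t * f t)" for m
      using Fle by (intro AE_I2) (simp add: abs_mult mult_left_mono)
  qed measurable
  have Q: "integrable lborel (\<lambda>x. (conj_poisson (F m) (Complex x e))\<^sup>2)"
    "(LINT x|lborel. (conj_poisson (F m) (Complex x e))\<^sup>2) \<le> ?M" for m
  proof -
    have supp: "F m t = 0" if "\<bar>t\<bar> > real m + 1" for t using that by (auto simp: F_def indicator_def)
    have "0 < real m + 1" by simp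
    note Q = conj_poisson_line_square_bounded_support[OF FL2[of m] e supp this]
    show "integrable lborel (\<lambda>x. (conj_poisson (F m) (Complex x e))\<^sup>2)" by (rule Q)
    show "(LINT x|lborel. (conj_poisson (F m) (Complex x e))\<^sup>2) \<le> ?M" by (rule order_trans[OF Q(2) Fint])
  qed
  have mQ [measurable]: "(\<lambda>x. conj_poisson (F m) (Complex x e)) \<in> borel_measurable borel" for m
    by (rule conj_poisson_line_measurable[OF FL2 e])
  have "(\<integral>\<^sup>+x. ennreal ((conj_poisson f (Complex x e))\<^sup>2) \<partial>lborel) = (\<integral>\<^sup>+x. liminf (\<lambda>m. ennreal ((conj_poisson (F m) (Complex x e))\<^sup>2)) \<partial>lborel)"
  proof (intro nn_integral_cong)
    fix x
    have "(\<lambda>m. ennreal ((conj_poisson (F m) (Complex x e))\<^sup>2)) \<longlonglongrightarrow> ennreal ((conj_poisson f (Complex x e))\<^sup>2)"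
      by (intro tendsto_ennrealI tendsto_power lim)
    then show "ennreal ((conj_poisson f (Complex x e))\<^sup>2) = liminf (\<lambda>m. ennreal ((conj_poisson (F m) (Complex x e))\<^sup>2))"
      using lim_imp_Liminf[OF sequentially_bot] by metis
  qed
  also have "\<dots> \<le> liminf (\<lambda>m. \<integral>\<^sup>+x. ennreal ((conj_poisson (F m) (Complex x e))\<^sup>2) \<partial>lborel)"
    by (intro nn_integral_liminf) measurable
  also have "\<dots> \<le> limsup (\<lambda>m. \<integral>\<^sup>+x. ennreal ((conj_poisson (F m) (Complex x e))\<^sup>2) \<partial>lborel)"
    by (intro Liminf_le_Limsup) simp
  also have "\<dots> \<le> ennreal ?M"
  proof (intro Limsup_bounded always_eventually allI)
    fix m
    have "(\<integral>\<^sup>+x. ennreal ((conj_poisson (F m) (Complex x e))\<^sup>2) \<partial>lborel) = ennreal (LINT x|lborel. (conj_poisson (F m) (Complex x e))\<^sup>2)"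
      using Q(1) by (intro nn_integral_eq_integral) auto
    then show "(\<integral>\<^sup>+x. ennreal ((conj_poisson (F m) (Complex x e))\<^sup>2) \<partial>lborel) \<le> ennreal ?M"
      using Q(2) by (simp add: ennreal_leI)
  qed
  finally have le: "(\<integral>\<^sup>+x. ennreal ((conj_poisson f (Complex x e))\<^sup>2) \<partial>lborel) \<le> ennreal ?M" .
  show i: "integrable lborel (\<lambda>x. (conj_poisson f (Complex x e))\<^sup>2)"
    using le conj_poisson_line_measurable[OF f e] by (intro integrableI_bounded) (auto intro: le_less_trans)
  have "ennreal (LINT x|lborel. (conj_poisson f (Complex x e))\<^sup>2) \<le> ennreal ?M"
    using le i by (subst (asm) nn_integral_eq_integral) auto
  then show "(LINT x|lborel. (conj_poisson f (Complex x e))\<^sup>2) \<le> ?M" by (subst (asm) ennreal_le_iff) auto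
qed

text \<open>Produces the Hilbert transform of \<open>f\<close> as the boundary function of the
  imaginary part of \<open>cauchy_poisson f\<close>, before any principal value is shown to
  converge. The bound \<open>2 * ?M\<close> is one \<open>?M\<close> for each of the real and
  imaginary parts.\<close>

lemma conjugate_function_exists:
  assumes f: "L2_fun f"
  obtains g where "L2_fun g" "\<And>z. Im z > 0 \<Longrightarrow> conj_poisson f z = poisson g z"
proof -
  have fm [measurable]: "f \<in> borel_measurable borel" using f by (simp add: L2_fun_def)
  let ?M = "LINT x|lborel. (f x)\<^sup>2"
  have norm: "(cmod (cauchy_poisson f z))\<^sup>2 = (poisson f z)\<^sup>2 + (conj_poisson f z)\<^sup>2" for z
    by (simp add: cmod_power2 cauchy_poisson_def)
  obtain a b where ab: "L2_fun a" "L2_fun b" "\<And>z. Im z > 0 \<Longrightarrow> cauchy_poisson f z = Complex (poisson a z) (poisson b z)"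
  proof (rule hardy_boundary_functions[OF cauchy_poisson_holomorphic[OF f], of "2 * ?M"])
    fix \<eta> :: real assume \<eta>: "\<eta> > 0"
    \<comment> \<open>The real part is at most its square plus 1, hence at most
      \<open>1 / (pi * \<eta>) * ?M + 1\<close>. The imaginary part is at most the square integral
      of the conjugate kernel plus that of \<open>f\<close>.\<close>
    define B where "B = 1 / (pi * \<eta>) * ?M + 1 + (1 / (pi * \<eta>) + ?M)"
    have M0: "?M \<ge> 0" by (intro Bochner_Integration.integral_nonneg) auto
    have "cmod (cauchy_poisson f z) \<le> B" if z: "Im z \<ge> \<eta>" for z
    proof -
      have i: "Im z > 0" using z \<eta> by simp
      have inv: "1 / (pi * Im z) \<le> 1 / (pi * \<eta>)" using z \<eta> by (intro divide_left_mono mult_left_mono mult_pos_pos) auto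
      have "(poisson f z)\<^sup>2 \<le> 1 / (pi * Im z) * ?M" by (rule order_trans[OF poisson_square_le(1,2)[OF f i]])
      also have "\<dots> \<le> 1 / (pi * \<eta>) * ?M" by (intro mult_right_mono inv M0)
      finally have p: "(poisson f z)\<^sup>2 \<le> 1 / (pi * \<eta>) * ?M" .
      have abs1: "\<bar>r\<bar> \<le> r\<^sup>2 + 1" for r :: real
        using zero_le_power2[of "\<bar>r\<bar> - 1"] zero_le_power2[of r] by (simp add: power2_diff)
      have ck2: "integrable lborel (\<lambda>t. (conj_kernel z t)\<^sup>2)" using L2_fun_conj_kernel[OF i] by (simp add: L2_fun_def)
      have "\<bar>conj_poisson f z\<bar> \<le> (LINT t|lborel. \<bar>conj_kernel z t * f t\<bar>)"
        using integral_norm_bound[of lborel "\<lambda>t. conj_kernel z t * f t"] by (simp add: conj_poisson_def)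
      also have "\<dots> \<le> (LINT t|lborel. (conj_kernel z t)\<^sup>2 + (f t)\<^sup>2)"
      proof (intro integral_mono integrable_abs conj_kernel_integrable f i Bochner_Integration.integrable_add ck2)
        show "integrable lborel (\<lambda>t. (f t)\<^sup>2)" using f by (simp add: L2_fun_def)
        show "\<bar>conj_kernel z t * f t\<bar> \<le> (conj_kernel z t)\<^sup>2 + (f t)\<^sup>2" for t by (rule abs_mult_le_sum_squares)
      qed
      also have "\<dots> = (LINT t|lborel. (conj_kernel z t)\<^sup>2) + ?M" using f ck2 by (simp add: L2_fun_def)
      also have "(LINT t|lborel. (conj_kernel z t)\<^sup>2) \<le> (LINT t|lborel. poisson_kernel z t / (pi * Im z))"
        using poisson_kernel_integral(1)[OF i] by (intro integral_mono ck2 conj_kernel_square_le[OF i] integrable_divide) auto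
      also have "\<dots> = 1 / (pi * Im z)" using poisson_kernel_integral(2)[OF i] by simp
      finally have q: "\<bar>conj_poisson f z\<bar> \<le> 1 / (pi * \<eta>) + ?M" using inv by linarith
      have "cmod (cauchy_poisson f z) \<le> \<bar>poisson f z\<bar> + \<bar>conj_poisson f z\<bar>"
        using cmod_le[of "cauchy_poisson f z"] by (simp add: cauchy_poisson_def)
      then show ?thesis using p q abs1[of "poisson f z"] by (simp add: B_def)
    qed
    then show "\<exists>B. \<forall>z. Im z \<ge> \<eta> \<longrightarrow> cmod (cauchy_poisson f z) \<le> B" by blast
    note P = poisson_line_square[OF f \<eta>] and Q = conj_poisson_line_square[OF f \<eta>]
    show "integrable lborel (\<lambda>x. (cmod (cauchy_poisson f (Complex x \<eta>)))\<^sup>2)"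
      unfolding norm by (intro Bochner_Integration.integrable_add P Q)
    show "(LINT x|lborel. (cmod (cauchy_poisson f (Complex x \<eta>)))\<^sup>2) \<le> 2 * ?M"
      unfolding norm using P Q by simp
  qed (rule that)
  show thesis
    by (rule that[OF ab(2)]) (use ab(3) in \<open>auto simp: cauchy_poisson_def\<close>)
qed

section \<open>The double Hilbert transform\<close>

text \<open>E is only Lebesgue measurable and the sections of S only almost equal to preimages of a
  Borel set; completeness turns this into measurability with the right measure.\<close>

lemma lebesgue_set_AE_borel:
  assumes "AE x in lborel. x \<in> A \<longleftrightarrow> x \<in> B" and B: "B \<in> sets borel"
  shows "A \<in> sets lebesgue" "emeasure lebesgue A = emeasure lborel B"
proof -
  have ae: "AE x in lebesgue. x \<in> B \<longleftrightarrow> x \<in> A"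
    by (rule AE_completion) (use assms(1) in eventually_elim, auto)
  have "B \<in> sets lebesgue" using B by simp
  then show A: "A \<in> sets lebesgue" by (rule completion.in_sets_AE[OF ae]) simp
  have "emeasure lebesgue A = emeasure lebesgue B"
    using ae A B by (intro emeasure_eq_AE) auto
  then show "emeasure lebesgue A = emeasure lborel B" using B by simp
qed

text \<open>Slopes 1 and -1 treat at once the translation t \<mapsto> t - r of horizontal sections
  and the reflection u \<mapsto> x - u of vertical ones.\<close>

lemma nn_integral_affine_unit:
  fixes f :: "real \<Rightarrow> ennreal"
  assumes "f \<in> borel_measurable borel" "\<bar>c\<bar> = 1"
  shows "(\<integral>\<^sup>+x. f (d + c * x) \<partial>lborel) = (\<integral>\<^sup>+x. f x \<partial>lborel)"
proof -
  have "c \<noteq> 0" using assms by auto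
  then show ?thesis using nn_integral_real_affine[OF assms(1), of c d] assms(2) by simp
qed

lemma affine_vimage_borel:
  fixes c d :: real
  assumes "B \<in> sets borel" shows "(\<lambda>x. d + c * x) -` B \<in> sets borel"
proof -
  have "(\<lambda>x. d + c * x) \<in> borel_measurable borel" by measurable
  from measurable_sets[OF this assms] show ?thesis by simp
qed

lemma emeasure_affine_unit:
  fixes c d :: real
  assumes [measurable]: "B \<in> sets borel" and "\<bar>c\<bar> = 1"
  shows "emeasure lborel ((\<lambda>x. d + c * x) -` B) = emeasure lborel B"
proof -
  have [measurable]: "(\<lambda>x. d + c * x) -` B \<in> sets borel" by (rule affine_vimage_borel) fact
  have "emeasure lborel ((\<lambda>x. d + c * x) -` B) = (\<integral>\<^sup>+x. indicator B (d + c * x) \<partial>lborel)"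
  proof -
    have "emeasure lborel ((\<lambda>x. d + c * x) -` B) = (\<integral>\<^sup>+x. indicator ((\<lambda>x. d + c * x) -` B) x \<partial>lborel)" by simp
    also have "(\<lambda>x. indicator ((\<lambda>x. d + c * x) -` B) x :: ennreal) = (\<lambda>x. indicator B (d + c * x))"
      by (auto simp: indicator_def fun_eq_iff)
    finally show ?thesis .
  qed
  also have "\<dots> = emeasure lborel B" by (subst nn_integral_affine_unit) (auto simp: assms)
  finally show ?thesis .
qed

lemma AE_affine_unit:
  fixes c d :: real
  assumes "AE s in lborel. P s" "\<bar>c\<bar> = 1" shows "AE t in lborel. P (d + c * t)"
proof -
  obtain Z where Z: "{s \<in> space lborel. \<not> P s} \<subseteq> Z" "Z \<in> sets lborel" "emeasure lborel Z = 0"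
    using AE_E[OF assms(1)] by metis
  have "(\<lambda>x. d + c * x) -` Z \<in> null_sets lborel"
    using Z by (intro null_setsI) (auto simp: emeasure_affine_unit affine_vimage_borel assms)
  then have "AE y in lborel. y \<notin> (\<lambda>x. d + c * x) -` Z" by (rule AE_not_in)
  then show ?thesis by eventually_elim (use Z in auto)
qed

lemma L2_fun_affine_unit:
  assumes "L2_fun a" "\<bar>c\<bar> = 1" shows "L2_fun (\<lambda>u. a (d + c * u))"
proof -
  have [measurable]: "a \<in> borel_measurable borel" using assms by (simp add: L2_fun_def)
  have "(\<integral>\<^sup>+s. ennreal ((a s)\<^sup>2) \<partial>lborel) < \<infinity>" using assms by (simp add: L2_fun_def nn_integral_eq_integral)
  then have "(\<integral>\<^sup>+u. ennreal ((a (d + c * u))\<^sup>2) \<partial>lborel) < \<infinity>"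
    using nn_integral_affine_unit[of "\<lambda>s. ennreal ((a s)\<^sup>2)" c d] assms by simp
  then show ?thesis by (auto simp: L2_fun_def intro!: integrableI_bounded)
qed

section \<open>Hilbert transforms of translates and of functions known up to null sets\<close>

lemma truncated_hilbert_translate:
  assumes "a \<in> borel_measurable borel"
  shows "truncated_hilbert (\<lambda>t. a (t - r)) \<epsilon> x = truncated_hilbert a \<epsilon> (x - r)"
proof -
  have [measurable]: "a \<in> borel_measurable borel" by fact
  have "truncated_hilbert (\<lambda>t. a (t - r)) \<epsilon> x = (LINT t|lborel. hilbert_kernel \<epsilon> x t * a (t - r))"
    by (rule truncated_hilbert_lborel) measurable
  also have "\<dots> = (LINT t|lborel. hilbert_kernel \<epsilon> x (r + 1 * t) * a ((r + 1 * t) - r))"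
    by (subst lborel_integral_real_affine[of 1 _ r]) auto
  also have "\<dots> = (LINT t|lborel. hilbert_kernel \<epsilon> (x - r) t * a t)"
    by (intro Bochner_Integration.integral_cong) (auto simp: hilbert_kernel_def indicator_def algebra_simps)
  also have "\<dots> = truncated_hilbert a \<epsilon> (x - r)" by (rule truncated_hilbert_lborel[symmetric]) measurable
  finally show ?thesis .
qed

lemma borel_measurable_lebesgue_AE_eq:
  fixes a F :: "real \<Rightarrow> real"
  assumes "a \<in> borel_measurable borel" "AE t in lborel. F t = a t"
  shows "F \<in> borel_measurable lebesgue"
proof (rule Equivalence_Measurable_On_Borel.borel_measurable_AE)
  show "a \<in> borel_measurable lebesgue" using assms(1) by (intro measurable_completion) simp
  show "AE t in lebesgue. a t = F t" by (rule AE_completion) (use assms(2) in eventually_elim, simp)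
qed

lemma square_integrable_AE_eq:
  assumes a: "L2_fun a" and ae: "AE t in lborel. F t = a t"
  shows "square_integrable F"
  unfolding square_integrable_def
proof
  have am: "a \<in> borel_measurable borel" using a by (simp add: L2_fun_def)
  show F: "F \<in> borel_measurable lebesgue" by (rule borel_measurable_lebesgue_AE_eq[OF am ae])
  have "integrable lebesgue (\<lambda>t. (a t)\<^sup>2)"
    using a by (subst integrable_completion) (auto simp: L2_fun_def)
  moreover have "(\<lambda>t. (F t)\<^sup>2) \<in> borel_measurable lebesgue" using F by measurable
  moreover have "AE t in lebesgue. (a t)\<^sup>2 = (F t)\<^sup>2" by (rule AE_completion) (use ae in eventually_elim, simp)
  ultimately show "integrable lebesgue (\<lambda>t. (F t)\<^sup>2)" by (rule integrable_cong_AE_imp)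
qed

lemma truncated_hilbert_AE_eq:
  assumes am: "a \<in> borel_measurable borel" and ae: "AE t in lborel. F t = a t"
  shows "truncated_hilbert F \<epsilon> x = truncated_hilbert a \<epsilon> x"
    and "set_integrable lebesgue {t. \<epsilon> < \<bar>x - t\<bar>} (\<lambda>t. a t / (x - t)) \<Longrightarrow> set_integrable lebesgue {t. \<epsilon> < \<bar>x - t\<bar>} (\<lambda>t. F t / (x - t))"
proof -
  have [measurable]: "F \<in> borel_measurable lebesgue" by (rule borel_measurable_lebesgue_AE_eq[OF am ae])
  have [measurable]: "a \<in> borel_measurable lebesgue" using am by (intro measurable_completion) simp
  have k [measurable]: "(\<lambda>t. indicator {t. \<epsilon> < \<bar>x - t\<bar>} t / (x - t) :: real) \<in> borel_measurable lebesgue"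
    by (intro measurable_completion) measurable
  have eq: "indicator {t. \<epsilon> < \<bar>x - t\<bar>} t *\<^sub>R (h t / (x - t)) = indicator {t. \<epsilon> < \<bar>x - t\<bar>} t / (x - t) * h t" for h :: "real \<Rightarrow> real" and t
    by simp
  have ae': "AE t in lebesgue. indicator {t. \<epsilon> < \<bar>x - t\<bar>} t / (x - t) * a t = indicator {t. \<epsilon> < \<bar>x - t\<bar>} t / (x - t) * F t"
    by (rule AE_completion) (use ae in eventually_elim, simp)
  have Fm: "(\<lambda>t. indicator {t. \<epsilon> < \<bar>x - t\<bar>} t / (x - t) * F t) \<in> borel_measurable lebesgue" by (intro borel_measurable_times k) measurable
  have am': "(\<lambda>t. indicator {t. \<epsilon> < \<bar>x - t\<bar>} t / (x - t) * a t) \<in> borel_measurable lebesgue" by (intro borel_measurable_times k) measurable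
  show "truncated_hilbert F \<epsilon> x = truncated_hilbert a \<epsilon> x"
    unfolding truncated_hilbert_def set_lebesgue_integral_def eq using integral_cong_AE[OF am' Fm ae'] by simp
  show "set_integrable lebesgue {t. \<epsilon> < \<bar>x - t\<bar>} (\<lambda>t. F t / (x - t))" if "set_integrable lebesgue {t. \<epsilon> < \<bar>x - t\<bar>} (\<lambda>t. a t / (x - t))"
    using that unfolding set_integrable_def eq by (rule integrable_cong_AE_imp[OF _ Fm ae'])
qed

text \<open>Truncated integrals depend only on the a.e. class, so replacing \<open>F\<close> by a
  Borel representative alters neither existence nor value of the principal value, at any
  \<open>x\<close>.\<close>

lemma hilbert_eqI:
  assumes a: "L2_fun a" and ae: "AE t in lborel. F t = a t"
    and lim: "((\<lambda>\<epsilon>. truncated_hilbert a \<epsilon> x) \<longlongrightarrow> h) (at_right 0)"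
  shows "hilbert_exists F x" "hilbert F x = h"
proof -
  have am: "a \<in> borel_measurable borel" using a by (simp add: L2_fun_def)
  note eq = truncated_hilbert_AE_eq[OF am ae]
  have lim': "((\<lambda>\<epsilon>. truncated_hilbert F \<epsilon> x) \<longlongrightarrow> h) (at_right 0)" using lim by (simp add: eq(1))
  then show "hilbert F x = h" unfolding hilbert_def by (intro tendsto_Lim) simp_all
  show "hilbert_exists F x"
    unfolding hilbert_exists_def using lim' eq(2) set_integrable_hilbert[OF a] by blast
qed

text \<open>The cut-off is the strict inequality \<open>\<epsilon> < \<bar>x - t\<bar>\<close>: as
  the radius decreases to \<epsilon>, the regions of integration increase to exactly the region for
  \<epsilon>, hence continuity from the right.\<close>

lemma truncated_hilbert_right_continuous:
  assumes a: "L2_fun a" and "\<epsilon> > 0" and q: "\<And>j. q j > \<epsilon>" "q \<longlonglongrightarrow> \<epsilon>"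
  shows "(\<lambda>j. truncated_hilbert a (q j) x) \<longlonglongrightarrow> truncated_hilbert a \<epsilon> x"
proof -
  have [measurable]: "a \<in> borel_measurable borel" using a by (simp add: L2_fun_def)
  show ?thesis
    unfolding truncated_hilbert_lborel[OF \<open>a \<in> borel_measurable borel\<close>]
  proof (rule integral_dominated_convergence[where w = "\<lambda>t. norm (hilbert_kernel \<epsilon> x t * a t)"])
    show "integrable lborel (\<lambda>t. norm (hilbert_kernel \<epsilon> x t * a t))"
      by (intro integrable_norm hilbert_kernel_integrable assms)
    show "AE t in lborel. (\<lambda>j. hilbert_kernel (q j) x t * a t) \<longlonglongrightarrow> hilbert_kernel \<epsilon> x t * a t"
    proof (intro AE_I2 tendsto_mult tendsto_const)
      fix t
      show "(\<lambda>j. hilbert_kernel (q j) x t) \<longlonglongrightarrow> hilbert_kernel \<epsilon> x t"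
      proof (cases "\<epsilon> < \<bar>x - t\<bar>")
        case True
        then have "eventually (\<lambda>j. q j < \<bar>x - t\<bar>) sequentially" using q(2) by (rule order_tendstoD(2)[rotated])
        then have "eventually (\<lambda>j. hilbert_kernel (q j) x t = hilbert_kernel \<epsilon> x t) sequentially"
          by eventually_elim (use True in \<open>simp add: hilbert_kernel_def\<close>)
        then show ?thesis by (rule tendsto_eventually)
      next
        case False
        then have "hilbert_kernel (q j) x t = hilbert_kernel \<epsilon> x t" for j using q(1)[of j] by (simp add: hilbert_kernel_def)
        then show ?thesis by simp
      qed
    qed
    show "AE t in lborel. norm (hilbert_kernel (q j) x t * a t) \<le> norm (hilbert_kernel \<epsilon> x t * a t)" for j
    proof (intro AE_I2)
      fix t
      have "\<bar>hilbert_kernel (q j) x t\<bar> \<le> \<bar>hilbert_kernel \<epsilon> x t\<bar>"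
        using q(1)[of j] by (auto simp: hilbert_kernel_def indicator_def)
      then show "norm (hilbert_kernel (q j) x t * a t) \<le> norm (hilbert_kernel \<epsilon> x t * a t)"
        by (simp add: abs_mult mult_right_mono)
    qed
  qed measurable
qed

text \<open>Convergence along all real \<open>\<epsilon>\<close> can be tested on rational \<open>\<epsilon>\<close>; this makes the set of
  convergence measurable in the plane.\<close>

lemma truncated_hilbert_tendsto_iff_rat:
  assumes a: "L2_fun a"
  shows "((\<lambda>\<epsilon>. truncated_hilbert a \<epsilon> x) \<longlongrightarrow> l) (at_right 0) \<longleftrightarrow>
    (\<forall>k::nat. \<exists>n::nat. \<forall>r::rat. 0 < real_of_rat r \<and> real_of_rat r < 1 / (real n + 1) \<longrightarrow>
       \<bar>truncated_hilbert a (real_of_rat r) x - l\<bar> \<le> 1 / (real k + 1))" (is "?L \<longleftrightarrow> ?R")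
proof
  assume ?L
  show ?R
  proof
    fix k :: nat
    have "eventually (\<lambda>\<epsilon>. dist (truncated_hilbert a \<epsilon> x) l < 1 / (real k + 1)) (at_right 0)"
      using \<open>?L\<close> by (rule tendstoD) simp
    then obtain b where b: "b > 0" "\<And>\<epsilon>. 0 < \<epsilon> \<Longrightarrow> \<epsilon> < b \<Longrightarrow> dist (truncated_hilbert a \<epsilon> x) l < 1 / (real k + 1)"
      by (auto simp: eventually_at_right_field)
    obtain n :: nat where n: "1 / (real n + 1) < b" using reals_Archimedean[OF b(1)] by (auto simp: inverse_eq_divide add.commute)
    show "\<exists>n::nat. \<forall>r::rat. 0 < real_of_rat r \<and> real_of_rat r < 1 / (real n + 1) \<longrightarrow>
       \<bar>truncated_hilbert a (real_of_rat r) x - l\<bar> \<le> 1 / (real k + 1)"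
    proof (intro exI[of _ n] allI impI)
      fix r assume "0 < real_of_rat r \<and> real_of_rat r < 1 / (real n + 1)"
      then show "\<bar>truncated_hilbert a (real_of_rat r) x - l\<bar> \<le> 1 / (real k + 1)"
        using b(2)[of "real_of_rat r"] n by (auto simp: dist_real_def)
    qed
  qed
next
  assume R: ?R
  show ?L
  proof (rule tendstoI)
    fix e :: real assume "e > 0"
    obtain k :: nat where k: "1 / (real k + 1) < e" using reals_Archimedean[OF \<open>e > 0\<close>] by (auto simp: inverse_eq_divide add.commute)
    obtain n :: nat where n: "\<And>r::rat. 0 < real_of_rat r \<Longrightarrow> real_of_rat r < 1 / (real n + 1) \<Longrightarrow>
       \<bar>truncated_hilbert a (real_of_rat r) x - l\<bar> \<le> 1 / (real k + 1)" using R by blast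
    have "\<bar>truncated_hilbert a \<epsilon> x - l\<bar> \<le> 1 / (real k + 1)" if \<epsilon>: "0 < \<epsilon>" "\<epsilon> < 1 / (real n + 1)" for \<epsilon>
    proof -
      have "\<exists>r::rat. \<epsilon> < real_of_rat r \<and> real_of_rat r < min (\<epsilon> + 1 / (real j + 1)) (1 / (real n + 1))" for j :: nat
        using of_rat_dense[of \<epsilon> "min (\<epsilon> + 1 / (real j + 1)) (1 / (real n + 1))"] \<epsilon> by auto
      then obtain r where r: "\<And>j. \<epsilon> < real_of_rat (r j)" "\<And>j. real_of_rat (r j) < min (\<epsilon> + 1 / (real j + 1)) (1 / (real n + 1))"
        by metis
      have lim: "(\<lambda>j. real_of_rat (r j)) \<longlonglongrightarrow> \<epsilon>"
      proof (rule tendsto_sandwich[OF always_eventually always_eventually tendsto_const])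
        show "(\<lambda>j. \<epsilon> + 1 / (real j + 1)) \<longlonglongrightarrow> \<epsilon>" by real_asymp
        show "\<forall>j. \<epsilon> \<le> real_of_rat (r j)" using r(1) less_imp_le by blast
        show "\<forall>j. real_of_rat (r j) \<le> \<epsilon> + 1 / (real j + 1)"
        proof
          fix j show "real_of_rat (r j) \<le> \<epsilon> + 1 / (real j + 1)" using r(2)[of j] by linarith
        qed
      qed
      \<comment> \<open>The rationals approach \<epsilon> from above, the side of continuity, and
        the non-strict bound survives the limit.\<close>
      have "(\<lambda>j. \<bar>truncated_hilbert a (real_of_rat (r j)) x - l\<bar>) \<longlonglongrightarrow> \<bar>truncated_hilbert a \<epsilon> x - l\<bar>"
        by (intro tendsto_intros truncated_hilbert_right_continuous[OF a \<epsilon>(1) r(1) lim])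
      then show ?thesis
      proof (rule LIMSEQ_le_const2, intro exI[of _ 0] allI impI)
        fix j
        have "0 < real_of_rat (r j)" using r(1)[of j] \<epsilon> by linarith
        moreover have "real_of_rat (r j) < 1 / (real n + 1)" using r(2)[of j] by linarith
        ultimately show "\<bar>truncated_hilbert a (real_of_rat (r j)) x - l\<bar> \<le> 1 / (real k + 1)" by (rule n)
      qed
    qed
    then show "eventually (\<lambda>\<epsilon>. dist (truncated_hilbert a \<epsilon> x) l < e) (at_right 0)"
      unfolding eventually_at_right_field using k
      by (intro exI[of _ "1 / (real n + 1)"]) (auto simp: dist_real_def intro: le_less_trans)
  qed
qed

lemma hilbert_kernel_measurable_comp [measurable (raw)]:
  assumes [measurable]: "f \<in> borel_measurable M" "g \<in> borel_measurable M"
  shows "(\<lambda>x. hilbert_kernel \<epsilon> (f x) (g x)) \<in> borel_measurable M"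
proof -
  have "(\<lambda>x. hilbert_kernel \<epsilon> (f x) (g x)) = (\<lambda>x. if \<epsilon> < \<bar>f x - g x\<bar> then 1 / (pi * (f x - g x)) else 0)"
    by (auto simp: hilbert_kernel_def fun_eq_iff)
  then show ?thesis by simp
qed

text \<open>Reflecting the line at x / 2 corresponds to the antiholomorphic map w \<mapsto> x -
  \<open>cnj w\<close> of the half-plane. It preserves Poisson integrals and changes the sign of
  conjugate ones.\<close>

lemma poisson_reflect:
  assumes [measurable]: "g \<in> borel_measurable borel"
  shows "poisson (\<lambda>u. g (x - u)) w = poisson g (x - cnj w)"
    and "conj_poisson (\<lambda>u. g (x - u)) w = - conj_poisson g (x - cnj w)"
proof -
  have "poisson g (x - cnj w) = (LINT u|lborel. poisson_kernel (x - cnj w) (x + (-1) * u) * g (x + (-1) * u))"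
    unfolding poisson_def by (subst lborel_integral_real_affine[of "-1" _ x]) auto
  also have "\<dots> = poisson (\<lambda>u. g (x - u)) w"
    unfolding poisson_def by (intro Bochner_Integration.integral_cong) (auto simp: poisson_kernel_def power2_commute)
  finally show "poisson (\<lambda>u. g (x - u)) w = poisson g (x - cnj w)" by simp
  have "conj_poisson g (x - cnj w) = (LINT u|lborel. conj_kernel (x - cnj w) (x + (-1) * u) * g (x + (-1) * u))"
    unfolding conj_poisson_def by (subst lborel_integral_real_affine[of "-1" _ x]) auto
  also have "\<dots> = (LINT u|lborel. - (conj_kernel w u * g (x - u)))"
  proof (intro Bochner_Integration.integral_cong refl)
    fix u
    have "conj_kernel (x - cnj w) (x + (-1) * u) = (u - Re w) / (pi * ((Re w - u)\<^sup>2 + (Im w)\<^sup>2))"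
      by (simp add: conj_kernel_def)
    also have "\<dots> = - conj_kernel w u"
      unfolding conj_kernel_def power2_commute[of "Re w" u] minus_divide_left by simp
    finally show "conj_kernel (x - cnj w) (x + (-1) * u) * g (x + (-1) * u) = - (conj_kernel w u * g (x - u))" by simp
  qed
  also have "\<dots> = - conj_poisson (\<lambda>u. g (x - u)) w" by (simp add: conj_poisson_def)
  finally show "conj_poisson (\<lambda>u. g (x - u)) w = - conj_poisson g (x - cnj w)" by simp
qed

section \<open>Hilbert transforms along vertical lines and the equation in the plane\<close>

context singular_nevanlinna
begin

text \<open>After reflection the conjugate of \<open>?f\<close> is minus \<open>?g\<close>, so \<i>
  times \<open>cauchy_poisson ?f\<close> has real part P \<open>?g\<close> and imaginary part P
  \<open>?f\<close>. Composed with \<phi> it stays holomorphic, and \<open>poisson_comp_bv\<close>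
  identifies both parts.\<close>

lemma conj_poisson_comp_bv:
  assumes f: "L2_fun f" and g: "L2_fun g" and fg: "\<And>z. Im z > 0 \<Longrightarrow> conj_poisson f z = poisson g z"
    and z: "Im z > 0"
  shows "conj_poisson (\<lambda>t. g (x - bv t)) z = poisson (\<lambda>t. f (x - bv t)) z"
proof -
  have [measurable]: "f \<in> borel_measurable borel" "g \<in> borel_measurable borel" using f g by (auto simp: L2_fun_def)
  let ?f = "\<lambda>u. f (x - u)" and ?g = "\<lambda>u. g (x - u)"
  have L2: "L2_fun ?f" "L2_fun ?g" using L2_fun_affine_unit[of _ "-1" x] f g by auto
  show ?thesis
  proof (rule conj_poisson_eq_poisson[OF L2_fun_comp_bv[OF L2(2)] L2_fun_comp_bv[OF L2(1)] _ z])
    have "(\<lambda>z. \<i> * cauchy_poisson ?f (\<phi> z)) holomorphic_on {z. Im z > 0}"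
    proof (intro holomorphic_intros)
      have "cauchy_poisson ?f \<circ> \<phi> holomorphic_on {z. Im z > 0}"
        by (rule holomorphic_on_compose_gen[OF phi_holomorphic cauchy_poisson_holomorphic[OF L2(1)]]) (auto simp: Im_phi(3))
      then show "(\<lambda>z. cauchy_poisson ?f (\<phi> z)) holomorphic_on {z. Im z > 0}" by (simp add: o_def)
    qed
    then show "(\<lambda>z. Complex (poisson (\<lambda>y. g (x - bv y)) z) (poisson (\<lambda>y. f (x - bv y)) z)) holomorphic_on {z. Im z > 0}"
    proof (rule holomorphic_transform)
      fix z assume "z \<in> {z. Im z > 0}"
      then have z: "Im z > 0" by simp
      have "Im (x - cnj (\<phi> z)) > 0" using Im_phi(3)[OF z] by simp
      then have "poisson ?g (\<phi> z) = - conj_poisson ?f (\<phi> z)"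
        by (simp add: poisson_reflect fg)
      moreover have "poisson (\<lambda>y. g (x - bv y)) z = poisson ?g (\<phi> z)" "poisson (\<lambda>y. f (x - bv y)) z = poisson ?f (\<phi> z)"
        using poisson_comp_bv[of ?g z] poisson_comp_bv[of ?f z] z by auto
      ultimately show "\<i> * cauchy_poisson ?f (\<phi> z) = Complex (poisson (\<lambda>y. g (x - bv y)) z) (poisson (\<lambda>y. f (x - bv y)) z)"
        by (simp add: cauchy_poisson_def complex_eq_iff)
    qed
  qed
qed

lemma herglotz_set_iff: "has_boundary_value \<phi> y (bv y) \<Longrightarrow> (x, y) \<in> herglotz_set \<phi> E \<longleftrightarrow> x - bv y \<in> E"
  unfolding herglotz_set_def mem_Collect_eq prod.case using bv_eq by metis

lemma AE_reflect_bv: "AE u in lborel. P u \<Longrightarrow> AE y in lborel. P (x - bv y)"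
  using AE_bv[OF AE_affine_unit[of P "-1" x]] by simp

text \<open>On almost every horizontal line the indicator of S is a translate of \<open>f\<close>,
  with transform a translate of \<open>g\<close>. On every vertical line the first transform is a.e.
  \<open>g (x - bv y)\<close>, and \<open>conj_poisson_comp_bv\<close> leads back to
  \<open>f (x - bv y)\<close>.\<close>

lemma herglotz_set_double_hilbert:
  assumes E': "E' \<in> sets borel" "emeasure lborel E' < \<infinity>" and EE': "AE u in lborel. u \<in> E' \<longleftrightarrow> u \<in> E"
  shows "slicewise_double_hilbert_eq (indicator (herglotz_set \<phi> E)) (indicator (herglotz_set \<phi> E))"
proof -
  let ?F = "indicator (herglotz_set \<phi> E) :: real \<times> real \<Rightarrow> real"
  define f where "f = (indicator E' :: real \<Rightarrow> real)"
  have fm [measurable]: "f \<in> borel_measurable borel" using E' by (simp add: f_def)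
  have f1: "integrable lborel f" unfolding f_def using E' by (intro integrable_real_indicator) auto
  have f: "L2_fun f"
  proof -
    have "(\<lambda>t. (f t)\<^sup>2) = f" by (auto simp: f_def indicator_def)
    then show ?thesis using f1 by (simp add: L2_fun_def)
  qed
  obtain g where g: "L2_fun g" "\<And>z. Im z > 0 \<Longrightarrow> conj_poisson f z = poisson g z"
    using conjugate_function_exists[OF f] by blast
  have gm [measurable]: "g \<in> borel_measurable borel" using g by (simp add: L2_fun_def)
  have Hf: "AE u in lborel. ((\<lambda>\<epsilon>. truncated_hilbert f \<epsilon> u) \<longlongrightarrow> g u) (at_right 0)"
    by (rule truncated_hilbert_tendsto_AE[OF f g])
  have slice: "AE t in lborel. ?F (t, y) = f (t - bv y)" if "has_boundary_value \<phi> y (bv y)" for y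
  proof -
    have "AE t in lborel. (- bv y) + 1 * t \<in> E' \<longleftrightarrow> (- bv y) + 1 * t \<in> E" by (rule AE_affine_unit[OF EE']) simp
    then show ?thesis by eventually_elim (auto simp: f_def indicator_def herglotz_set_iff[OF that])
  qed
  have fr: "L2_fun (\<lambda>t. f (t - r))" for r using L2_fun_affine_unit[OF f, of 1 "-r"] by simp
  have H1: "hilbert_exists (\<lambda>t. ?F (t, y)) x \<and> hilbert1 ?F (x, y) = g (x - bv y)"
    if "has_boundary_value \<phi> y (bv y)" and "((\<lambda>\<epsilon>. truncated_hilbert f \<epsilon> (x - bv y)) \<longlongrightarrow> g (x - bv y)) (at_right 0)" for x y
  proof -
    have "((\<lambda>\<epsilon>. truncated_hilbert (\<lambda>t. f (t - bv y)) \<epsilon> x) \<longlongrightarrow> g (x - bv y)) (at_right 0)"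
      using that(2) by (simp add: truncated_hilbert_translate)
    from hilbert_eqI[OF fr slice[OF that(1)] this] show ?thesis by (simp add: hilbert1_def)
  qed
  define G where "G x t = g (x - bv t)" for x t
  have G: "L2_fun (G x)" for x
    unfolding G_def[abs_def] using L2_fun_comp_bv[OF L2_fun_affine_unit[OF g(1), of "-1" x]] by simp
  have H1_AE: "AE y in lborel. hilbert_exists (\<lambda>t. ?F (t, y)) x \<and> hilbert1 ?F (x, y) = G x y" for x
    using has_boundary_value_bv_AE AE_reflect_bv[OF Hf, of x] unfolding G_def by eventually_elim (rule H1)
  have H1_eq: "AE y in lborel. hilbert1 ?F (x, y) = G x y" for x
    using H1_AE[of x] by eventually_elim simp
  have fx: "L2_fun (\<lambda>t. f (x - bv t))" for x
    using L2_fun_comp_bv[OF L2_fun_affine_unit[OF f, of "-1" x]] by simp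
  have HG: "AE y in lborel. ((\<lambda>\<epsilon>. truncated_hilbert (G x) \<epsilon> y) \<longlongrightarrow> f (x - bv y)) (at_right 0)" for x
    using truncated_hilbert_tendsto_AE[OF G[of x] fx[of x]] conj_poisson_comp_bv[OF f g] unfolding G_def[abs_def] by blast
  have H2: "hilbert_exists (\<lambda>t. hilbert1 ?F (x, t)) y \<and> hilbert2 (hilbert1 ?F) (x, y) = f (x - bv y)"
    if "((\<lambda>\<epsilon>. truncated_hilbert (G x) \<epsilon> y) \<longlongrightarrow> f (x - bv y)) (at_right 0)" for x y
    using hilbert_eqI[OF G H1_eq that] by (simp add: hilbert2_def)
  show ?thesis
    unfolding slicewise_double_hilbert_eq_def
  proof (intro conjI)
    show "AE y in lebesgue. integrable lebesgue (\<lambda>t. ?F (t, y)) \<and> square_integrable (\<lambda>t. ?F (t, y)) \<and>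
        (AE x in lebesgue. hilbert_exists (\<lambda>t. ?F (t, y)) x)"
    proof (rule AE_completion, use has_boundary_value_bv_AE in eventually_elim)
      fix y assume y: "has_boundary_value \<phi> y (bv y)"
      have "AE x in lborel. ((\<lambda>\<epsilon>. truncated_hilbert f \<epsilon> (- bv y + 1 * x)) \<longlongrightarrow> g (- bv y + 1 * x)) (at_right 0)"
        by (rule AE_affine_unit[OF Hf]) simp
      then have "AE x in lborel. hilbert_exists (\<lambda>t. ?F (t, y)) x"
        by eventually_elim (use H1[OF y] in simp)
      moreover have "integrable lebesgue (\<lambda>t. ?F (t, y))"
      proof (rule integrable_cong_AE_imp)
        have "integrable lborel (\<lambda>t. f (- bv y + 1 * t))" using f1 by (intro lborel_integrable_real_affine) auto
        then show "integrable lebesgue (\<lambda>t. f (t - bv y))" by (subst integrable_completion) auto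
        show "(\<lambda>t. ?F (t, y)) \<in> borel_measurable lebesgue"
          by (rule borel_measurable_lebesgue_AE_eq[OF _ slice[OF y]]) measurable
        show "AE t in lebesgue. f (t - bv y) = ?F (t, y)"
          by (rule AE_completion) (use slice[OF y] in eventually_elim, simp)
      qed
      ultimately show "integrable lebesgue (\<lambda>t. ?F (t, y)) \<and> square_integrable (\<lambda>t. ?F (t, y)) \<and>
        (AE x in lebesgue. hilbert_exists (\<lambda>t. ?F (t, y)) x)"
        using square_integrable_AE_eq[OF fr slice[OF y]] AE_completion by blast
    qed
    show "AE x in lebesgue. (AE y in lebesgue. hilbert_exists (\<lambda>t. ?F (t, y)) x) \<and>
        square_integrable (\<lambda>t. hilbert1 ?F (x, t)) \<and> (AE y in lebesgue. hilbert_exists (\<lambda>t. hilbert1 ?F (x, t)) y)"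
    proof (rule AE_I2, intro conjI)
      fix x
      show "AE y in lebesgue. hilbert_exists (\<lambda>t. ?F (t, y)) x"
        by (rule AE_completion) (use H1_AE[of x] in eventually_elim, simp)
      show "square_integrable (\<lambda>t. hilbert1 ?F (x, t))" by (rule square_integrable_AE_eq[OF G H1_eq])
      show "AE y in lebesgue. hilbert_exists (\<lambda>t. hilbert1 ?F (x, t)) y"
        by (rule AE_completion) (use HG[of x] in eventually_elim, simp add: H2)
    qed
    obtain Z where Z: "{u \<in> space lborel. \<not> (u \<in> E' \<longleftrightarrow> u \<in> E)} \<subseteq> Z" "Z \<in> sets lborel" "emeasure lborel Z = 0"
      using AE_E[OF EE'] by metis
    obtain Y where Y: "{y \<in> space lborel. \<not> has_boundary_value \<phi> y (bv y)} \<subseteq> Y" "Y \<in> sets lborel" "emeasure lborel Y = 0"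
      using AE_E[OF has_boundary_value_bv_AE] by metis
    have [measurable]: "Z \<in> sets borel" "Y \<in> sets borel" using Z Y by auto
    \<comment> \<open>Validity on almost every point of each vertical line gives validity a.e. in
      the plane only for a measurable set. P is a Borel condition: convergence is tested on rational
      radii, and the exceptional values and heights are enlarged to the Borel null sets Z and
      Y.\<close>
    define P where "P p \<longleftrightarrow> ((\<lambda>\<epsilon>. truncated_hilbert (G (fst p)) \<epsilon> (snd p)) \<longlongrightarrow> f (fst p - bv (snd p))) (at_right 0)
       \<and> fst p - bv (snd p) \<notin> Z \<and> snd p \<notin> Y" for p :: "real \<times> real"
    have "AE p in lborel \<Otimes>\<^sub>M lborel. P p"
    proof (rule lborel_pair.AE_pair_measure)
      have tm [measurable]: "(\<lambda>p. truncated_hilbert (G (fst p)) \<epsilon> (snd p)) \<in> borel_measurable (borel \<Otimes>\<^sub>M borel)" for \<epsilon>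
      proof -
        have "G x \<in> borel_measurable borel" for x using G by (simp add: L2_fun_def)
        from truncated_hilbert_lborel[OF this]
        have "(\<lambda>p. truncated_hilbert (G (fst p)) \<epsilon> (snd p)) = (\<lambda>p. LINT t|lborel. hilbert_kernel \<epsilon> (snd p) t * g (fst p - bv t))"
          by (simp add: G_def)
        also have "\<dots> \<in> borel_measurable (borel \<Otimes>\<^sub>M borel)" by measurable
        finally show ?thesis .
      qed
      have "Measurable.pred (borel \<Otimes>\<^sub>M borel) P"
        unfolding P_def[abs_def] truncated_hilbert_tendsto_iff_rat[OF G] by measurable
      then have "{p \<in> space (borel \<Otimes>\<^sub>M borel). P p} \<in> sets (borel \<Otimes>\<^sub>M borel)" by (simp add: pred_def)
      then show "{p \<in> space (lborel \<Otimes>\<^sub>M lborel). P p} \<in> sets (lborel \<Otimes>\<^sub>M lborel)"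
        by (simp add: space_pair_measure cong: sets_pair_measure_cong)
      have Znull: "AE u in lborel. u \<notin> Z" and Ynull: "AE y in lborel. y \<notin> Y" using Z Y by (auto intro!: AE_not_in null_setsI)
      show "AE x in lborel. AE y in lborel. P (x, y)"
      proof (rule AE_I2)
        fix x
        show "AE y in lborel. P (x, y)"
          using HG[of x] AE_reflect_bv[OF Znull, of x] Ynull by eventually_elim (simp add: P_def)
      qed
    qed
    then have "AE p in lborel. P p" unfolding lborel_prod .
    then have "AE p in lborel. hilbert2 (hilbert1 ?F) p = ?F p"
    proof eventually_elim
      case (elim p)
      obtain x y where p: "p = (x, y)" by (cases p)
      have y: "has_boundary_value \<phi> y (bv y)" using elim Y by (auto simp: P_def p)
      have "x - bv y \<in> E' \<longleftrightarrow> x - bv y \<in> E" using elim Z by (auto simp: P_def p)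
      then have "f (x - bv y) = ?F (x, y)" by (auto simp: f_def indicator_def herglotz_set_iff[OF y])
      then show ?case using H2[of x y] elim by (simp add: P_def p)
    qed
    then show "AE p in lebesgue. hilbert2 (hilbert1 ?F) p = ?F p" by (rule AE_completion)
  qed
qed

end

theorem theorem3:
  fixes E :: "real set" and \<beta> :: real and \<phi> :: "complex \<Rightarrow> complex"
    and S :: "(real \<times> real) set"
  assumes "E \<in> sets lebesgue" and "0 < emeasure lebesgue E" and "emeasure lebesgue E < \<infinity>"
    and "singular_herglotz \<beta> \<phi>"
    and "S = herglotz_set \<phi> E"
  shows "(AE y in lebesgue. \<exists>r. has_boundary_value \<phi> y r) \<and>
    (\<forall>y. (\<exists>r. has_boundary_value \<phi> y r) \<longrightarrow>
       {x. (x, y) \<in> S} \<in> sets lebesgue \<and>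
       emeasure lebesgue {x. (x, y) \<in> S} = emeasure lebesgue E) \<and>
    (\<forall>x. {y. (x, y) \<in> S} \<in> sets lebesgue \<and>
       emeasure lebesgue {y. (x, y) \<in> S} = emeasure lebesgue E / ennreal \<beta>) \<and>
    slicewise_double_hilbert_eq (indicator S) (indicator S)"
proof -
  obtain \<gamma> \<nu> N where "singular_nevanlinna \<beta> \<gamma> \<nu> N \<phi>" using singular_herglotz_nevanlinna[OF assms(4)] by blast
  then interpret singular_nevanlinna \<beta> \<gamma> \<nu> N \<phi> .
  \<comment> \<open>A Borel set equal to E up to a null set, so that its preimages under the Borel
    function \<open>bv\<close> are Borel.\<close>
  define E' where "E' = main_part lborel E"
  have E'm: "E' \<in> sets borel" using main_part_sets[OF assms(1)] by (simp add: E'_def)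
  have EE': "AE u in lborel. u \<in> E' \<longleftrightarrow> u \<in> E" unfolding E'_def by (rule AE_in_main_part[OF assms(1)])
  have emE: "emeasure lebesgue E = emeasure lborel E'"
    using EE' E'm by (intro lebesgue_set_AE_borel) (auto elim: eventually_mono)
  show ?thesis
  proof (intro conjI allI impI)
    show "AE y in lebesgue. \<exists>r. has_boundary_value \<phi> y r" using boundary_value_AE by (rule AE_completion)
  next
    fix y assume "\<exists>r. has_boundary_value \<phi> y r"
    then have y: "has_boundary_value \<phi> y (bv y)" using bv_eq by blast
    have ae: "AE x in lborel. x \<in> {x. (x, y) \<in> S} \<longleftrightarrow> x \<in> (\<lambda>x. - bv y + 1 * x) -` E'"
      using AE_affine_unit[OF EE', of 1 "- bv y", simplified]
      by (auto simp: assms(5) herglotz_set_iff[OF y] elim!: eventually_mono)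
    have m: "(\<lambda>x. - bv y + 1 * x) -` E' \<in> sets borel" by (rule affine_vimage_borel[OF E'm])
    show "{x. (x, y) \<in> S} \<in> sets lebesgue" by (rule lebesgue_set_AE_borel(1)[OF ae m])
    show "emeasure lebesgue {x. (x, y) \<in> S} = emeasure lebesgue E"
      unfolding lebesgue_set_AE_borel(2)[OF ae m] emE by (rule emeasure_affine_unit[OF E'm]) simp
  next
    fix x
    let ?B = "bv -` ((\<lambda>u. x + (-1) * u) -` E')"
    have ae: "AE y in lborel. y \<in> {y. (x, y) \<in> S} \<longleftrightarrow> y \<in> ?B"
      using has_boundary_value_bv_AE AE_reflect_bv[OF EE', of x]
      by eventually_elim (auto simp: assms(5) herglotz_set_iff)
    have m1: "(\<lambda>u. x + (-1) * u) -` E' \<in> sets borel" by (rule affine_vimage_borel[OF E'm])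
    have m: "?B \<in> sets borel" using measurable_sets_borel[OF bv_measurable m1] by simp
    show "{y. (x, y) \<in> S} \<in> sets lebesgue" by (rule lebesgue_set_AE_borel(1)[OF ae m])
    have "emeasure lebesgue {y. (x, y) \<in> S} = ennreal (1 / \<beta>) * emeasure lborel E'"
      unfolding lebesgue_set_AE_borel(2)[OF ae m] emeasure_bv_vimage[OF m1]
      by (subst emeasure_affine_unit[OF E'm]) simp_all
    then show "emeasure lebesgue {y. (x, y) \<in> S} = emeasure lebesgue E / ennreal \<beta>"
      using beta_pos by (simp add: emE divide_ennreal_def inverse_ennreal inverse_eq_divide mult.commute)
  next
    show "slicewise_double_hilbert_eq (indicator S) (indicator S)"
      unfolding assms(5) using E'm EE' assms(3) emE by (intro herglotz_set_double_hilbert) auto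
  qed
qed

end
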